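(* Let $\mathcal X,\mathcal Y$ be nonzero complex Banach spaces and let $A\in\mathcal B(\mathcal X)$, $B\in\mathcal B(\mathcal Y)$ satisfy $\widehat{\sigma(A)}\cap\sigma(B)=\emptyset$. Assume that $\operatorname{cap}(\widehat{\sigma(A)})>0$. Let $g$ be the Green's function of $\mathbb C\setminus\widehat{\sigma(A)}$ with singularity at $\infty$, and set $\alpha=\min_{\mu\in\sigma(B)}g(\mu)$. Then $0<\alpha<\infty$ and $$\eta(A,B)=e^{-\alpha}.$$
   Context: $\mathcal B(\mathcal X)$ denotes the bounded linear operators on $\mathcal X$ and $\sigma(T)$ the spectrum of $T$. For compact $K\subset\mathbb C$, $\widehat K=\{z\in\mathbb C: |p(z)|\le\sup_{\zeta\in K}|p(\zeta)|\text{ for all polynomials }p\}$ is its polynomially convex hull, and $\operatorname{cap}$ denotes logarithmic capacity. The quantity $\eta$ is $$\eta(A,B)=\inf_p\big(\|p(A)\|\,\|p(B)^{-1}\|\big)^{1/\deg p},$$ the infimum being over all nonconstant complex polynomials $p$ for which $p(B)$ is invertible. For a polynomially convex compact set $K$ of positive capacity, the Green's function $g$ of $\mathbb C\setminus K$ with singularity at $\infty$ is the positive harmonic function on $\mathbb C\setminus K$ (bounded away from neighbourhoods of $\infty$) with $g(z)=\log|z|+O(1)$ as $z\to\infty$ and $g(z)\to0$ as $z\to\zeta$ from $\mathbb C\setminus K$ for nearly every $\zeta\in\partial K$ (i.e. for all $\zeta\in\partial K$ outside a Borel set of capacity zero). *)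

theory Defs
  imports
    "HOL-Analysis.Analysis"
    "HOL-Probability.Probability_Measure"
    "HOL-Computational_Algebra.Polynomial"
    "HOL-Library.Landau_Symbols"
begin

section \<open>Complex Banach spaces and bounded complex-linear operators\<close>

class complex_normed_vector = real_normed_vector +
  fixes scaleC :: "complex \<Rightarrow> 'a \<Rightarrow> 'a"  (infixr "*\<^sub>C" 75)
  assumes scaleC_add_right: "c *\<^sub>C (x + y) = c *\<^sub>C x + c *\<^sub>C y"
    and scaleC_add_left: "(c + d) *\<^sub>C x = c *\<^sub>C x + d *\<^sub>C x"
    and scaleC_scaleC: "c *\<^sub>C d *\<^sub>C x = (c * d) *\<^sub>C x"
    and scaleC_of_real: "complex_of_real r *\<^sub>C x = r *\<^sub>R x"
    and norm_scaleC: "norm (c *\<^sub>C x) = cmod c * norm x"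

class complex_banach = complex_normed_vector + banach

text \<open>
  Elements of \<open>B(X)\<close> are represented as functions; their norm is the library's
  operator norm \<^const>\<open>onorm\<close>.
\<close>

definition bounded_clinear :: "('a::complex_normed_vector \<Rightarrow> 'b::complex_normed_vector) \<Rightarrow> bool" where
  "bounded_clinear T \<longleftrightarrow> bounded_linear T \<and> (\<forall>c x. T (c *\<^sub>C x) = c *\<^sub>C T x)"

definition invertible_op :: "('a::complex_normed_vector \<Rightarrow> 'a) \<Rightarrow> bool" where
  "invertible_op T \<longleftrightarrow> (\<exists>S. bounded_clinear S \<and> S \<circ> T = id \<and> T \<circ> S = id)"

definition spectrum :: "('a::complex_normed_vector \<Rightarrow> 'a) \<Rightarrow> complex set" where
  "spectrum T = {c. \<not> invertible_op (\<lambda>x. T x - c *\<^sub>C x)}"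

definition poly_op :: "complex poly \<Rightarrow> ('a::complex_normed_vector \<Rightarrow> 'a) \<Rightarrow> 'a \<Rightarrow> 'a" where
  "poly_op p T x = (\<Sum>i\<le>degree p. coeff p i *\<^sub>C (T ^^ i) x)"

text \<open>
  When \<open>p(B)\<close> is invertible, the function inverse \<^const>\<open>inv\<close> is its inverse in \<open>B(Y)\<close>.
\<close>

definition eta :: "('a::complex_normed_vector \<Rightarrow> 'a) \<Rightarrow> ('b::complex_normed_vector \<Rightarrow> 'b) \<Rightarrow> real" where
  "eta A B =
     (INF p\<in>{p. 0 < degree p \<and> invertible_op (poly_op p B)}.
        root (degree p) (onorm (poly_op p A) * onorm (inv (poly_op p B))))"

section \<open>Potential theory in the plane\<close>

text \<open>The real supremum below is the intended one for nonempty compact \<open>K\<close>.\<close>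

definition poly_hull :: "complex set \<Rightarrow> complex set" where
  "poly_hull K = {z. \<forall>p. cmod (poly p z) \<le> (SUP \<zeta>\<in>K. cmod (poly p \<zeta>))}"

text \<open>
  \<open>log_dist z z = -\<infinity>\<close>; note that the library's convention is \<open>ln 0 = 0\<close>.
\<close>

definition log_dist :: "complex \<Rightarrow> complex \<Rightarrow> ereal" where
  "log_dist z w = (if z = w then - \<infinity> else ereal (ln (dist z w)))"

text \<open>
  The energy \<open>I(\<mu>) = \<integral>\<integral> log |z - w| d\<mu>(w) d\<mu>(z)\<close>, as the integral of the positive part
  minus that of the negative part (\<^const>\<open>e2ennreal\<close> sends negative values to \<open>0\<close>).
  For compactly supported finite \<open>\<mu>\<close> the positive part has finite integral, so the
  difference is meaningful, with value in \<open>[-\<infinity>, \<infinity>)\<close>.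
\<close>

definition log_energy :: "complex measure \<Rightarrow> ereal" where
  "log_energy \<mu> =
     enn2ereal (\<integral>\<^sup>+z. (\<integral>\<^sup>+w. e2ennreal (log_dist z w) \<partial>\<mu>) \<partial>\<mu>)
     - enn2ereal (\<integral>\<^sup>+z. (\<integral>\<^sup>+w. e2ennreal (- log_dist z w) \<partial>\<mu>) \<partial>\<mu>)"

definition exp_ereal :: "ereal \<Rightarrow> ennreal" where
  "exp_ereal x = (case x of ereal r \<Rightarrow> ennreal (exp r) | PInfty \<Rightarrow> \<infinity> | MInfty \<Rightarrow> 0)"

text \<open>
  The supremum runs over the Borel probability measures with compact support contained
  in \<open>E\<close>, i.e. those carried by some compact subset of \<open>E\<close>.  The set \<open>E\<close> need not be
  compact, so that Borel sets of capacity zero make sense; the capacity of the empty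
  set is \<open>0\<close>.
\<close>

definition log_capacity :: "complex set \<Rightarrow> ennreal" where
  "log_capacity E =
     (SUP \<mu>\<in>{\<mu>. prob_space \<mu> \<and> sets \<mu> = sets borel \<and>
                 (\<exists>K. compact K \<and> K \<subseteq> E \<and> emeasure \<mu> K = 1)}.
        exp_ereal (log_energy \<mu>))"

text \<open>
  Harmonic means of class \<open>C\<^sup>2\<close> with vanishing Laplacian: \<open>hx\<close>, \<open>hy\<close> are the first and
  \<open>hxx\<close>, \<open>hxy\<close>, \<open>hyx\<close>, \<open>hyy\<close> the second partial derivatives of \<open>h\<close>.
\<close>

definition harmonic_on :: "(complex \<Rightarrow> real) \<Rightarrow> complex set \<Rightarrow> bool" where
  "harmonic_on h U \<longleftrightarrow> open U \<and>
     (\<exists>hx hy hxx hxy hyx hyy.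
        continuous_on U hxx \<and> continuous_on U hxy \<and> continuous_on U hyx \<and> continuous_on U hyy \<and>
        (\<forall>z\<in>U.
           (h has_derivative (\<lambda>v. hx z * Re v + hy z * Im v)) (at z) \<and>
           (hx has_derivative (\<lambda>v. hxx z * Re v + hxy z * Im v)) (at z) \<and>
           (hy has_derivative (\<lambda>v. hyx z * Re v + hyy z * Im v)) (at z) \<and>
           hxx z + hyy z = 0))"

text \<open>
  Singularity at \<open>\<infinity>\<close>; the values of \<open>g\<close> on \<open>K\<close> are irrelevant.  The clause with
  \<open>R\<close> says that \<open>g\<close> is bounded off each neighbourhood of \<open>\<infinity>\<close>.
\<close>

definition green_function :: "complex set \<Rightarrow> (complex \<Rightarrow> real) \<Rightarrow> bool" where
  "green_function K g \<longleftrightarrow>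
     harmonic_on g (- K) \<and>
     (\<forall>z\<in>- K. 0 < g z) \<and>
     (\<forall>R. bounded (g ` (- K \<inter> cball 0 R))) \<and>
     (\<lambda>z. g z - ln (cmod z)) \<in> O[at_infinity](\<lambda>_. 1) \<and>
     (\<exists>N\<in>sets borel. log_capacity N = 0 \<and>
        (\<forall>\<zeta>\<in>frontier K - N. (g \<longlongrightarrow> 0) (at \<zeta> within - K)))"

end

theory Submission
  imports Defs "HOL-Computational_Algebra.Fundamental_Theorem_Algebra" "HOL-Probability.Helly_Selection"
begin

text \<open>
  Write \<open>K\<close> for the hull of the spectrum of \<open>A\<close>. The lower bound for \<open>eta\<close> is the
  Bernstein--Walsh inequality, since \<open>\<parallel>p(A)\<parallel>\<close> dominates \<open>\<bar>p\<bar>\<close> on \<open>K\<close> and \<open>\<parallel>p(B)\<^sup>-\<^sup>1\<parallel>\<close> dominates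
  \<open>1 / \<bar>p\<bar>\<close> on the spectrum of \<open>B\<close>. For the upper bound, high powers of \<open>p\<close> reduce the problem
  by the spectral radius formula to finding polynomials with \<open>log (\<bar>p\<bar> / sup\<^sub>K \<bar>p\<bar>) / deg p\<close> at least
  \<open>g - \<epsilon>\<close> on the spectrum of \<open>B\<close>. Fekete polynomials have this property by the maximum principle,
  where the capacity-zero set on which the boundary values of \<open>g\<close> are not controlled is handled
  by a product over points of \<open>K\<close> that is very small near that set. Such products exist, as
  otherwise a weak limit of empirical measures of Leja-type points would be a measure of finite
  energy on the exceptional set.
\<close>

subsection \<open>Bounded operators and their spectra\<close>

text \<open>The spectral radius formula is needed only along the exponents \<open>2 ^ m\<close>: for
  the upper bound on \<open>eta\<close> it is enough to find one power of \<open>p\<close> for which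
  both operator norms are small. Along these exponents it follows from an averaging identity for
  resolvents, without complex integration, and the same estimate shows that spectra are nonempty.
  The obstacle in the comparison is that \<open>g\<close> tends to 0 only at nearly every frontier
  point of \<open>K\<close>, so a Fekete potential does not control \<open>g\<close> near the
  remaining points. A fixed level \<eta> is treated: the points of \<open>K\<close> at which the set
  where \<open>g\<close> is at least \<eta> accumulates form a compact set of capacity zero. The
  order of the choices matters: the level and the weight of the penalty, the penalising product, a
  distance \<open>r\<close> from \<open>K\<close>, and last the degree \<open>N\<close>. With
  \<open>r\<close> fixed, the loss in the Fekete estimate is of order \<open>ln N / N\<close>. Weak
  limits of measures in the plane are taken on the line: a continuous curve covering a square lifts
  the points to [0, 1], where Helly's selection theorem applies.\<close>

lemma scaleC_one [simp]: "1 *\<^sub>C x = x"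
  using scaleC_of_real[of 1 x] by simp

lemma scaleC_zero_left [simp]: "0 *\<^sub>C x = 0"
  using scaleC_of_real[of 0 x] by simp

lemma scaleC_zero_right [simp]: "c *\<^sub>C (0::'a::complex_normed_vector) = 0"
  using norm_scaleC[of c "0::'a"] by simp

lemma scaleC_minus_left: "(- c) *\<^sub>C x = - (c *\<^sub>C x)"
  using scaleC_add_left[of c "-c" x] by (simp add: eq_neg_iff_add_eq_0 add.commute)

lemma scaleC_minus_right: "c *\<^sub>C (- x) = - (c *\<^sub>C x)"
  using scaleC_add_right[of c x "-x"] by (simp add: eq_neg_iff_add_eq_0 add.commute)

lemma scaleC_diff_left: "(c - d) *\<^sub>C x = c *\<^sub>C x - d *\<^sub>C x"
  using scaleC_add_left[of c "-d" x] by (simp add: scaleC_minus_left)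

lemma scaleC_diff_right: "c *\<^sub>C (x - y) = c *\<^sub>C x - c *\<^sub>C y"
  using scaleC_add_right[of c x "-y"] by (simp add: scaleC_minus_right)

lemma scaleC_scaleR: "c *\<^sub>C (r *\<^sub>R x) = r *\<^sub>R (c *\<^sub>C x)"
  by (simp flip: scaleC_of_real add: scaleC_scaleC mult.commute)

lemma bounded_linear_scaleC: "bounded_linear (\<lambda>x. c *\<^sub>C x)"
  by (rule bounded_linear_intro[where K="cmod c"])
     (auto simp: scaleC_add_right scaleC_scaleR norm_scaleC)

lemma
  assumes "bounded_clinear T"
  shows bounded_clinear_bounded_linear: "bounded_linear T"
    and bounded_clinear_add: "T (x + y) = T x + T y"
    and bounded_clinear_diff: "T (x - y) = T x - T y"
    and bounded_clinear_scaleC: "T (c *\<^sub>C x) = c *\<^sub>C T x"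
    and bounded_clinear_zero: "T 0 = 0"
proof -
  show *: "bounded_linear T" using assms by (simp add: bounded_clinear_def)
  then interpret bounded_linear T .
  show "T (x + y) = T x + T y" "T (x - y) = T x - T y" "T 0 = 0"
    by (auto simp: add diff zero)
  show "T (c *\<^sub>C x) = c *\<^sub>C T x" using assms by (simp add: bounded_clinear_def)
qed

lemmas bounded_clinear_simps =
  bounded_clinear_add bounded_clinear_diff bounded_clinear_scaleC bounded_clinear_zero

lemma bounded_clinear_id [simp]: "bounded_clinear (\<lambda>x. x)"
  by (simp add: bounded_clinear_def)

lemma bounded_clinear_compose:
  "bounded_clinear S \<Longrightarrow> bounded_clinear T \<Longrightarrow> bounded_clinear (\<lambda>x. S (T x))"
  unfolding bounded_clinear_def by (auto intro: bounded_linear_compose)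

lemma bounded_clinear_sum_ops:
  "bounded_clinear S \<Longrightarrow> bounded_clinear T \<Longrightarrow> bounded_clinear (\<lambda>x. S x + T x)"
  unfolding bounded_clinear_def by (auto intro: bounded_linear_add simp: scaleC_add_right)

lemma bounded_clinear_diff_ops:
  "bounded_clinear S \<Longrightarrow> bounded_clinear T \<Longrightarrow> bounded_clinear (\<lambda>x. S x - T x)"
  unfolding bounded_clinear_def by (auto intro: bounded_linear_sub simp: scaleC_diff_right)

lemma bounded_clinear_scaleC_op:
  "bounded_clinear T \<Longrightarrow> bounded_clinear (\<lambda>x. c *\<^sub>C T x)"
  unfolding bounded_clinear_def
  by (auto intro: bounded_linear_compose[OF bounded_linear_scaleC] simp: scaleC_scaleC mult.commute)

lemma bounded_clinear_zero_op [simp]: "bounded_clinear (\<lambda>x. 0)"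
  by (simp add: bounded_clinear_def)

lemma bounded_clinear_power:
  fixes T :: "'a::complex_normed_vector \<Rightarrow> 'a"
  shows "bounded_clinear T \<Longrightarrow> bounded_clinear (T ^^ n)"
proof (induction n)
  case (Suc n)
  then show ?case using bounded_clinear_compose[of T "T ^^ n"] by (simp add: o_def)
qed (simp add: id_def)

lemmas bounded_clinear_intros =
  bounded_clinear_id bounded_clinear_sum_ops bounded_clinear_diff_ops
  bounded_clinear_scaleC_op bounded_clinear_zero_op

lemma norm_le_onorm:
  "bounded_clinear T \<Longrightarrow> norm (T x) \<le> onorm T * norm x"
  by (rule onorm[OF bounded_clinear_bounded_linear])

lemma onorm_nonneg: "bounded_clinear T \<Longrightarrow> 0 \<le> onorm T"
  by (rule onorm_pos_le[OF bounded_clinear_bounded_linear])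

lemma invertible_opI:
  assumes "bounded_clinear S" "\<And>x. S (T x) = x" "\<And>x. T (S x) = x"
  shows "invertible_op T"
  using assms unfolding invertible_op_def by (intro exI[of _ S]) (auto simp: fun_eq_iff)

lemma
  assumes "invertible_op T"
  shows invertible_op_inv: "bounded_clinear (inv T)"
    and inv_op_left: "inv T (T x) = x"
    and inv_op_right: "T (inv T x) = x"
proof -
  obtain S where S: "bounded_clinear S" "S \<circ> T = id" "T \<circ> S = id"
    using assms unfolding invertible_op_def by blast
  then have "inv T = S" by (metis inv_unique_comp)
  then show "bounded_clinear (inv T)" using S(1) by simp
  show "inv T (T x) = x" "T (inv T x) = x"
    using S \<open>inv T = S\<close> by (simp_all add: fun_eq_iff)
qed

lemma inv_op_eq:
  assumes "\<And>x. S (T x) = x" "\<And>x. T (S x) = x"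
  shows "inv T = S"
  using assms by (intro inv_unique_comp) (auto simp: fun_eq_iff)

lemma invertible_op_compose:
  assumes "invertible_op S" "invertible_op T"
  shows "invertible_op (\<lambda>x. S (T x))"
  by (rule invertible_opI[of "\<lambda>x. inv T (inv S x)"])
     (simp_all add: bounded_clinear_compose invertible_op_inv inv_op_left inv_op_right assms)

text \<open>If \<open>R\<close> inverts the product, then \<open>S\<close> commutes with
  \<open>R\<close>: write \<open>S x\<close> as \<open>S (S (T (R x)))\<close> and move one factor
  \<open>S\<close> past \<open>T\<close>. Hence \<open>T\<close> after \<open>R\<close> is a
  two-sided inverse of \<open>S\<close>.\<close>

lemma invertible_op_commuting_factor:
  assumes "invertible_op (\<lambda>x. S (T x))" "\<And>x. S (T x) = T (S x)"
    and S: "bounded_clinear S" and T: "bounded_clinear T"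
  shows "invertible_op S"
proof -
  define R where "R = inv (\<lambda>x. S (T x))"
  have R: "bounded_clinear R"
    unfolding R_def by (rule invertible_op_inv[OF assms(1)])
  have l: "R (S (T x)) = x" for x
    unfolding R_def by (rule inv_op_left[OF assms(1)])
  have r: "S (T (R x)) = x" for x
    unfolding R_def by (rule inv_op_right[OF assms(1)])
  have "R (S x) = R (S (S (T (R x))))" for x by (simp only: r)
  also have "R (S (S (T (R x)))) = R (S (T (S (R x))))" for x by (simp only: assms(2))
  also have "R (S (T (S (R x)))) = S (R x)" for x by (rule l)
  finally have comm: "R (S x) = S (R x)" for x .
  have "T (R (S x)) = x" for x by (simp only: comm assms(2)[symmetric] r)
  then show ?thesis
    by (rule invertible_opI[OF bounded_clinear_compose[OF T R] _ r])
qed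

lemma invertible_op_scaleC:
  assumes "c \<noteq> 0" "invertible_op T" and T: "bounded_clinear T"
  shows "invertible_op (\<lambda>x. c *\<^sub>C T x)"
proof (rule invertible_opI)
  have I: "bounded_clinear (inv T)" by (rule invertible_op_inv[OF assms(2)])
  then show "bounded_clinear (\<lambda>x. inverse c *\<^sub>C inv T x)" by (rule bounded_clinear_scaleC_op)
  show "inverse c *\<^sub>C inv T (c *\<^sub>C T x) = x" for x
    using assms by (simp add: bounded_clinear_simps(3)[OF I] scaleC_scaleC inv_op_left)
  show "c *\<^sub>C T (inverse c *\<^sub>C inv T x) = x" for x
    using assms by (simp add: bounded_clinear_simps(3)[OF T] scaleC_scaleC inv_op_right[OF assms(2)])
qed

text \<open>Instead of summing the Neumann series, \<open>x - T x = y\<close> is solved as the fixed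
  point equation of the contraction that maps \<open>x\<close> to \<open>y + T x\<close>. Uniqueness
  makes the solution operator linear, and the fixed point equation itself bounds it by
  \<open>1 / (1 - onorm T)\<close>.\<close>

lemma neumann:
  fixes T :: "'x::complex_banach \<Rightarrow> 'x"
  assumes T: "bounded_clinear T" and less: "onorm T < 1"
  shows "invertible_op (\<lambda>x. x - T x)"
proof -
  define U where "U = (\<lambda>x. x - T x)"
  have "\<exists>!x. y + T x = x" for y
  proof (rule banach_fix_type[of "onorm T"])
    have "dist (y + T u) (y + T v) = norm (T (u - v))" for u v
      unfolding dist_norm bounded_clinear_simps(2)[OF T] by simp
    then show "\<forall>u v. dist (y + T u) (y + T v) \<le> onorm T * dist u v"
      using norm_le_onorm[OF T] by (metis dist_norm)
  qed (use less onorm_nonneg[OF T] in auto)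
  moreover have "U x = y \<longleftrightarrow> y + T x = x" for x y by (auto simp: U_def algebra_simps)
  ultimately have ex: "\<exists>!x. U x = y" for y by simp
  have bij: "bij U" using ex by (metis bij_def inj_def surj_def)
  have U: "bounded_clinear U" unfolding U_def by (intro bounded_clinear_intros T)
  have l: "inv U (U x) = x" and r: "U (inv U x) = x" for x
    using bij by (auto simp: bij_def surj_f_inv_f)
  have sc: "inv U (c *\<^sub>C x) = c *\<^sub>C inv U x" for c x
    using l[of "c *\<^sub>C inv U x"] by (simp add: bounded_clinear_simps(3)[OF U] r)
  have "bounded_linear (inv U)"
  proof (rule bounded_linear_intro[where K="1 / (1 - onorm T)"])
    show "inv U (x + y) = inv U x + inv U y" for x y
      using l[of "inv U x + inv U y"] by (simp add: bounded_clinear_simps(1)[OF U] r)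
    show "inv U (a *\<^sub>R x) = a *\<^sub>R inv U x" for a x
      using sc[of "complex_of_real a"] by (simp add: scaleC_of_real)
    show "norm (inv U x) \<le> norm x * (1 / (1 - onorm T))" for x
    proof -
      have "norm (inv U x) = norm (x + T (inv U x))"
        using r[of x] by (simp add: U_def algebra_simps)
      also have "\<dots> \<le> norm x + onorm T * norm (inv U x)"
        by (rule order_trans[OF norm_triangle_ineq add_left_mono[OF norm_le_onorm[OF T]]])
      finally show ?thesis using less by (simp add: field_simps)
    qed
  qed
  then have "bounded_clinear (inv U)" by (simp add: bounded_clinear_def sc)
  then show ?thesis
    using invertible_opI[of "inv U" U] l r by (simp add: U_def)
qed

text \<open>Factor \<open>T - c\<close> as \<open>T (1 - c T^-1)\<close>. Besides the openness of
  the resolvent set, the quantitative form later yields the lower bound for the norm of the inverse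
  of \<open>p(B)\<close>.\<close>

lemma invertible_op_perturb:
  fixes T :: "'x::complex_banach \<Rightarrow> 'x"
  assumes T: "invertible_op T" "bounded_clinear T" and "cmod c * onorm (inv T) < 1"
  shows "invertible_op (\<lambda>x. T x - c *\<^sub>C x)"
proof -
  have I: "bounded_clinear (inv T)" by (rule invertible_op_inv[OF T(1)])
  have "onorm (\<lambda>x. c *\<^sub>C inv T x) \<le> cmod c * onorm (inv T)"
    by (rule onorm_bound) (use norm_le_onorm[OF I] onorm_nonneg[OF I] in \<open>auto simp: norm_scaleC mult.assoc intro!: mult_left_mono\<close>)
  then have "invertible_op (\<lambda>x. x - c *\<^sub>C inv T x)"
    using assms by (intro neumann bounded_clinear_intros I) auto
  from invertible_op_compose[OF T(1) this] show ?thesis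
    by (simp add: bounded_clinear_simps[OF T(2)] inv_op_right[OF T(1)])
qed

lemma spectrum_bound:
  fixes T :: "'x::complex_banach \<Rightarrow> 'x"
  assumes T: "bounded_clinear T" and "c \<in> spectrum T"
  shows "cmod c \<le> onorm T"
proof (rule ccontr)
  assume less: "\<not> cmod c \<le> onorm T"
  then have c: "c \<noteq> 0" using onorm_nonneg[OF T] by auto
  have "onorm (\<lambda>x. inverse c *\<^sub>C T x) \<le> inverse (cmod c) * onorm T"
    by (rule onorm_bound) (use norm_le_onorm[OF T] onorm_nonneg[OF T] in
        \<open>auto simp: norm_scaleC norm_inverse mult.assoc intro!: mult_left_mono\<close>)
  also have "\<dots> < 1" using less c by (simp add: field_simps)
  finally have "invertible_op (\<lambda>x. x - inverse c *\<^sub>C T x)"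
    by (intro neumann bounded_clinear_intros T)
  from invertible_op_scaleC[OF _ this, of "- c"] c T
  have "invertible_op (\<lambda>x. T x - c *\<^sub>C x)"
    by (simp add: scaleC_diff_right scaleC_scaleC scaleC_minus_left
        bounded_clinear_diff_ops bounded_clinear_scaleC_op)
  then show False using assms(2) by (simp add: spectrum_def)
qed

lemma closed_spectrum:
  fixes T :: "'x::complex_banach \<Rightarrow> 'x"
  assumes T: "bounded_clinear T"
  shows "closed (spectrum T)"
proof -
  have "\<exists>e>0. \<forall>d. dist d c < e \<longrightarrow> d \<in> - spectrum T" if "c \<in> - spectrum T" for c
  proof -
    define U where "U = (\<lambda>x. T x - c *\<^sub>C x)"
    have U: "invertible_op U" "bounded_clinear U"
      using that by (auto simp: spectrum_def U_def intro!: bounded_clinear_intros T)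
    define e where "e = 1 / (onorm (inv U) + 1)"
    have nn: "0 \<le> onorm (inv U)" by (rule onorm_nonneg[OF invertible_op_inv[OF U(1)]])
    have "invertible_op (\<lambda>x. T x - d *\<^sub>C x)" if d: "dist d c < e" for d
    proof -
      have "cmod (d - c) * onorm (inv U) \<le> cmod (d - c) * (onorm (inv U) + 1)"
        by (intro mult_left_mono) auto
      also have "\<dots> < 1" using d nn by (simp add: e_def dist_norm field_simps)
      finally have "invertible_op (\<lambda>x. U x - (d - c) *\<^sub>C x)"
        by (intro invertible_op_perturb U)
      then show ?thesis by (simp add: U_def scaleC_diff_left algebra_simps)
    qed
    moreover have "e > 0" using nn by (simp add: e_def)
    ultimately show ?thesis by (auto simp: spectrum_def)
  qed
  then have "open (- spectrum T)" by (simp add: open_dist)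
  then show ?thesis by (simp add: closed_def)
qed

lemma compact_spectrum:
  fixes T :: "'x::complex_banach \<Rightarrow> 'x"
  assumes T: "bounded_clinear T"
  shows "compact (spectrum T)"
  using closed_spectrum[OF T] spectrum_bound[OF T]
  by (auto simp: compact_eq_bounded_closed bounded_iff)

subsection \<open>Polynomials of an operator\<close>

lemma poly_op_altdef:
  assumes "degree p \<le> n"
  shows "poly_op p T x = (\<Sum>i\<le>n. coeff p i *\<^sub>C (T ^^ i) x)"
  unfolding poly_op_def
  by (rule sum.mono_neutral_left) (use assms in \<open>auto simp: coeff_eq_0\<close>)

lemma poly_op_0 [simp]: "poly_op 0 T x = 0"
  by (simp add: poly_op_def)

lemma poly_op_pCons:
  fixes T :: "'x::complex_normed_vector \<Rightarrow> 'x"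
  assumes T: "bounded_clinear T"
  shows "poly_op (pCons a p) T x = a *\<^sub>C x + T (poly_op p T x)"
proof -
  interpret bounded_linear T by (rule bounded_clinear_bounded_linear[OF T])
  have "poly_op (pCons a p) T x = (\<Sum>i\<le>Suc (degree p). coeff (pCons a p) i *\<^sub>C (T ^^ i) x)"
    by (rule poly_op_altdef) (rule degree_pCons_le)
  also have "\<dots> = a *\<^sub>C x + (\<Sum>i\<le>degree p. coeff p i *\<^sub>C T ((T ^^ i) x))"
    by (subst sum.atMost_Suc_shift) simp
  also have "(\<Sum>i\<le>degree p. coeff p i *\<^sub>C T ((T ^^ i) x)) = T (poly_op p T x)"
    by (simp add: poly_op_def sum bounded_clinear_scaleC[OF T])
  finally show ?thesis .
qed

lemma bounded_clinear_poly_op: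
  assumes T: "bounded_clinear T"
  shows "bounded_clinear (poly_op p T)"
proof (induction p)
  case (pCons a p)
  have "poly_op (pCons a p) T = (\<lambda>x. a *\<^sub>C x + T (poly_op p T x))"
    by (simp add: fun_eq_iff poly_op_pCons[OF T])
  then show ?case
    using bounded_clinear_compose[OF T pCons(2)]
    by (simp add: bounded_clinear_intros)
qed (simp add: fun_eq_iff[symmetric] poly_op_def[abs_def])

lemma poly_op_add:
  assumes T: "bounded_clinear T"
  shows "poly_op (p + q) T x = poly_op p T x + poly_op q T x"
  by (induction p q rule: poly_induct2)
     (simp_all add: poly_op_pCons[OF T] bounded_clinear_add[OF T] scaleC_add_left algebra_simps)

lemma poly_op_smult:
  assumes T: "bounded_clinear T"
  shows "poly_op (smult c p) T x = c *\<^sub>C poly_op p T x"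
  by (induction p)
     (simp_all add: poly_op_pCons[OF T] bounded_clinear_scaleC[OF T] scaleC_add_right scaleC_scaleC)

lemma poly_op_mult:
  assumes T: "bounded_clinear T"
  shows "poly_op (p * q) T x = poly_op p T (poly_op q T x)"
proof (induction p)
  case (pCons a p)
  have "poly_op (pCons a p * q) T x = poly_op (smult a q) T x + poly_op (pCons 0 (p * q)) T x"
    by (simp add: poly_op_add[OF T])
  then show ?case by (simp add: poly_op_pCons[OF T] poly_op_smult[OF T] pCons)
qed simp

lemma poly_op_power:
  assumes T: "bounded_clinear T"
  shows "poly_op (p ^ n) T = poly_op p T ^^ n"
proof (induction n)
  case 0
  show ?case by (auto simp: poly_op_def)
next
  case (Suc n)
  then show ?case by (simp add: fun_eq_iff poly_op_mult[OF T])
qed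

lemma poly_op_linear:
  assumes T: "bounded_clinear T"
  shows "poly_op [:- c, 1:] T = (\<lambda>x. T x - c *\<^sub>C x)"
  by (auto simp: fun_eq_iff poly_op_pCons[OF T] scaleC_minus_left bounded_clinear_zero[OF T])

text \<open>Induction on the degree: a root splits off a linear factor, and a product of commuting
  operators is invertible exactly when both factors are. Applied to \<open>p - [:c:]\<close> this
  becomes the spectral mapping theorem.\<close>

lemma invertible_poly_op_iff:
  assumes T: "bounded_clinear T" and "p \<noteq> 0"
  shows "invertible_op (poly_op p T) \<longleftrightarrow> (\<forall>c\<in>spectrum T. poly p c \<noteq> 0)"
  using \<open>p \<noteq> 0\<close>
proof (induction "degree p" arbitrary: p)
  case 0
  then obtain a where p: "p = [:a:]" "a \<noteq> 0" by (metis degree_eq_zeroE pCons_0_0)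
  have eq: "poly_op p T = (\<lambda>x. a *\<^sub>C x)"
    by (auto simp: p fun_eq_iff poly_op_pCons[OF T] bounded_clinear_zero[OF T])
  have "invertible_op (\<lambda>x. a *\<^sub>C x)"
    by (rule invertible_opI[of "\<lambda>x. inverse a *\<^sub>C x"])
       (use p in \<open>auto simp: scaleC_scaleC intro: bounded_clinear_intros\<close>)
  then show ?case using p eq by simp
next
  case (Suc n)
  then have "degree p \<noteq> 0" by simp
  then obtain c where c: "poly p c = 0"
    using fundamental_theorem_of_algebra[of p] by (auto simp: constant_degree)
  then obtain q where q: "p = [:- c, 1:] * q" by (auto simp: poly_eq_0_iff_dvd elim: dvdE)
  have "q \<noteq> 0" using Suc q by auto
  have "degree p = Suc (degree q)" unfolding q using \<open>q \<noteq> 0\<close> by (subst degree_mult_eq) auto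
  then have IH: "invertible_op (poly_op q T) \<longleftrightarrow> (\<forall>c\<in>spectrum T. poly q c \<noteq> 0)"
    using Suc \<open>q \<noteq> 0\<close> by auto
  have p1: "poly_op p T = (\<lambda>x. poly_op [:- c, 1:] T (poly_op q T x))"
    by (simp only: fun_eq_iff q poly_op_mult[OF T]) simp
  have p2: "poly_op p T = (\<lambda>x. poly_op q T (poly_op [:- c, 1:] T x))"
    by (simp only: fun_eq_iff q mult.commute[of _ q] poly_op_mult[OF T]) simp
  have comm: "poly_op [:- c, 1:] T (poly_op q T x) = poly_op q T (poly_op [:- c, 1:] T x)" for x
    using fun_cong[OF p1, of x] fun_cong[OF p2, of x] by (rule trans[OF sym])
  have "invertible_op (poly_op p T) \<longleftrightarrow>
      invertible_op (poly_op [:- c, 1:] T) \<and> invertible_op (poly_op q T)"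
  proof
    assume inv: "invertible_op (poly_op p T)"
    show "invertible_op (poly_op [:- c, 1:] T) \<and> invertible_op (poly_op q T)"
    proof
      show "invertible_op (poly_op [:- c, 1:] T)"
        by (rule invertible_op_commuting_factor[where T="poly_op q T"])
           (use inv p1 comm bounded_clinear_poly_op[OF T] in \<open>simp_all only:\<close>)
      show "invertible_op (poly_op q T)"
        by (rule invertible_op_commuting_factor[where T="poly_op [:- c, 1:] T"])
           (use inv p2 comm[symmetric] bounded_clinear_poly_op[OF T] in \<open>simp_all only:\<close>)
    qed
  next
    assume "invertible_op (poly_op [:- c, 1:] T) \<and> invertible_op (poly_op q T)"
    then show "invertible_op (poly_op p T)"
      unfolding p1 by (elim conjE) (rule invertible_op_compose)
  qed
  also have "invertible_op (poly_op [:- c, 1:] T) \<longleftrightarrow> c \<notin> spectrum T"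
    by (simp only: poly_op_linear[OF T] spectrum_def) simp
  finally show ?case unfolding IH by (auto simp: q)
qed

lemma invertible_poly_op_minus_iff:
  assumes T: "bounded_clinear T" and "0 < degree p"
  shows "invertible_op (\<lambda>x. poly_op p T x - c *\<^sub>C x) \<longleftrightarrow> c \<notin> poly p ` spectrum T"
proof -
  have "degree (p - [:c:]) = degree p"
    using assms(2) by (metis degree_add_eq_left degree_minus degree_pCons_0 diff_conv_add_uminus)
  then have "p - [:c:] \<noteq> 0" using assms(2) by auto
  moreover have "poly_op (p - [:c:]) T = (\<lambda>x. poly_op p T x - c *\<^sub>C x)"
    by (simp only: fun_eq_iff poly_op_add[OF T] diff_conv_add_uminus)
       (simp add: poly_op_pCons[OF T] scaleC_minus_left bounded_clinear_zero[OF T])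
  ultimately show ?thesis
    using invertible_poly_op_iff[OF T, of "p - [:c:]"] by (auto simp: image_iff)
qed

lemma spectrum_poly_op:
  assumes "bounded_clinear T" "0 < degree p"
  shows "spectrum (poly_op p T) = poly p ` spectrum T"
  using invertible_poly_op_minus_iff[OF assms] by (auto simp: spectrum_def)

subsection \<open>The spectral radius\<close>

lemma onorm_funpow_le:
  fixes T :: "'x::complex_normed_vector \<Rightarrow> 'x"
  assumes T: "bounded_clinear T"
  shows "onorm (T ^^ n) \<le> onorm T ^ n"
proof (induction n)
  case 0
  show ?case using onorm_id_le by (simp add: id_def)
next
  case (Suc n)
  have "onorm (T ^^ Suc n) \<le> onorm T * onorm (T ^^ n)"
    using onorm_compose[OF bounded_clinear_bounded_linear[OF T]
        bounded_clinear_bounded_linear[OF bounded_clinear_power[OF T]]]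
    by (simp only: funpow.simps)
  also have "\<dots> \<le> onorm T * onorm T ^ n"
    by (intro mult_left_mono Suc onorm_nonneg T)
  finally show ?case by (simp only: power_Suc)
qed

lemma funpow_scaleC:
  fixes T :: "'x::complex_normed_vector \<Rightarrow> 'x"
  assumes T: "bounded_clinear T"
  shows "((\<lambda>x. c *\<^sub>C T x) ^^ n) x = (c ^ n) *\<^sub>C (T ^^ n) x"
  by (induction n) (simp_all add: bounded_clinear_scaleC[OF T] scaleC_scaleC)

lemma onorm_scaleC:
  assumes T: "bounded_clinear T"
  shows "onorm (\<lambda>x. c *\<^sub>C T x) = cmod c * onorm T"
proof -
  have "onorm (\<lambda>x. c *\<^sub>C T x) = onorm (\<lambda>x. cmod c *\<^sub>R T x)"
    by (simp add: onorm_def norm_scaleC)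
  then show ?thesis using onorm_scaleR[OF bounded_clinear_bounded_linear[OF T]] by simp
qed

text \<open>Meant for the norm of the resolvent on a compact parameter set, where the resolvent
  identity directly gives local bounds.\<close>

lemma bounded_on_compact_if_locally_bounded:
  fixes f :: "'a::metric_space \<Rightarrow> real"
  assumes "compact C"
    and "\<And>x. x \<in> C \<Longrightarrow> \<exists>r>0. \<exists>B. \<forall>y\<in>C \<inter> ball x r. f y \<le> B"
  shows "\<exists>B. \<forall>x\<in>C. f x \<le> B"
proof -
  obtain r B where rB: "\<And>x. x \<in> C \<Longrightarrow> r x > 0 \<and> (\<forall>y\<in>C \<inter> ball x (r x). f y \<le> B x)"
    using assms(2) by metis
  have "C \<subseteq> (\<Union>x\<in>C. ball x (r x))" using rB by force
  then obtain D where D: "D \<subseteq> C" "finite D" "C \<subseteq> (\<Union>x\<in>D. ball x (r x))"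
    using compactE_image[OF assms(1), of C "\<lambda>x. ball x (r x)"] by auto
  have "f x \<le> Max (B ` D)" if x: "x \<in> C" for x
  proof -
    obtain d where "d \<in> D" "x \<in> ball d (r d)" using D(3) x by blast
    then have "f x \<le> B d" using rB D x by blast
    also have "\<dots> \<le> Max (B ` D)" using D \<open>d \<in> D\<close> by simp
    finally show ?thesis .
  qed
  then show ?thesis by blast
qed

text \<open>The resolvent identity \<open>R c - R d = (c - d) R d T R c\<close> is used twice. For
  \<open>c\<close> near \<open>d\<close> the right-hand side has at most half the size of
  \<open>R c x\<close> and is absorbed, which bounds the resolvents locally and hence, by
  compactness, by some \<open>M\<close>. With this bound the identity gives the Lipschitz constant
  \<open>M * onorm T * M\<close>.\<close>

lemma resolvent_lipschitz:
  fixes T :: "'x::complex_normed_vector \<Rightarrow> 'x"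
  assumes T: "bounded_clinear T" and "compact C"
    and inv: "\<And>c. c \<in> C \<Longrightarrow> invertible_op (\<lambda>x. x - c *\<^sub>C T x)"
  obtains L where "0 \<le> L" "\<And>c d x. c \<in> C \<Longrightarrow> d \<in> C \<Longrightarrow>
    norm (inv (\<lambda>x. x - c *\<^sub>C T x) x - inv (\<lambda>x. x - d *\<^sub>C T x) x) \<le> L * cmod (c - d) * norm x"
proof -
  define R where "R = (\<lambda>c. inv (\<lambda>x. x - c *\<^sub>C T x))"
  have R: "bounded_clinear (R c)" if "c \<in> C" for c
    unfolding R_def by (rule invertible_op_inv[OF inv[OF that]])
  have l: "R c (x - c *\<^sub>C T x) = x" if "c \<in> C" for c x
    unfolding R_def by (rule inv_op_left[OF inv[OF that]])
  have r: "R c x - c *\<^sub>C T (R c x) = x" if "c \<in> C" for c x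
    unfolding R_def by (rule inv_op_right[OF inv[OF that]])
  have diff: "R c x - R d x = R d ((c - d) *\<^sub>C T (R c x))" if "c \<in> C" "d \<in> C" for c d x
  proof -
    have "R c x - R d x = R d (R c x - d *\<^sub>C T (R c x)) - R d (R c x - c *\<^sub>C T (R c x))"
      using that by (simp only: l r)
    also have "\<dots> = R d ((c - d) *\<^sub>C T (R c x))"
      by (simp only: bounded_clinear_diff[OF R[OF that(2)], symmetric]) (simp add: scaleC_diff_left)
    finally show ?thesis .
  qed
  have nT: "0 \<le> onorm T" by (rule onorm_nonneg[OF T])
  have est: "norm (R c x - R d x) \<le> onorm (R d) * (cmod (c - d) * (onorm T * norm (R c x)))"
    if "c \<in> C" "d \<in> C" for c d x
    unfolding diff[OF that]
    by (intro order_trans[OF norm_le_onorm[OF R[OF that(2)]]] mult_left_mono onorm_nonneg R that)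
       (simp add: norm_scaleC mult_left_mono norm_le_onorm[OF T])
  have "\<exists>B. \<forall>c\<in>C. onorm (R c) \<le> B"
  proof (rule bounded_on_compact_if_locally_bounded[OF \<open>compact C\<close>])
    fix d assume d: "d \<in> C"
    define e where "e = 1 / (2 * (onorm T * onorm (R d) + 1))"
    have nn: "0 \<le> onorm T * onorm (R d)" by (intro mult_nonneg_nonneg nT onorm_nonneg R d)
    have "onorm (R c) \<le> 2 * onorm (R d)" if c: "c \<in> C \<inter> ball d e" for c
    proof (rule onorm_bound)
      fix x
      have "cmod (c - d) * (onorm T * onorm (R d)) \<le> e * (onorm T * onorm (R d))"
        using c by (intro mult_right_mono nn) (auto simp: dist_norm norm_minus_commute)
      also have "\<dots> \<le> 1 / 2" using nn by (simp add: e_def field_simps)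
      finally have *: "cmod (c - d) * (onorm T * onorm (R d)) \<le> 1 / 2" .
      have "norm (R c x) \<le> norm (R d x) + norm (R c x - R d x)"
        by (metis add.commute norm_triangle_sub)
      also have "norm (R c x - R d x) \<le>
          (cmod (c - d) * (onorm T * onorm (R d))) * norm (R c x)"
        using est[of c d x] c d by (simp add: mult_ac)
      also have "\<dots> \<le> 1 / 2 * norm (R c x)" by (intro mult_right_mono * norm_ge_zero)
      also have "norm (R d x) \<le> onorm (R d) * norm x" by (rule norm_le_onorm[OF R[OF d]])
      finally show "norm (R c x) \<le> 2 * onorm (R d) * norm x" by simp
    qed (use onorm_nonneg[OF R[OF d]] in simp)
    moreover have "e > 0" using nn by (simp add: e_def)
    ultimately show "\<exists>r>0. \<exists>B. \<forall>c\<in>C \<inter> ball d r. onorm (R c) \<le> B" by blast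
  qed
  then obtain B where B: "\<And>c. c \<in> C \<Longrightarrow> onorm (R c) \<le> B" by blast
  define M where "M = max B 0"
  have M: "onorm (R c) \<le> M" "M \<ge> 0" if "c \<in> C" for c using B[OF that] by (auto simp: M_def)
  show ?thesis
  proof (rule that[of "M * onorm T * M"])
    show "0 \<le> M * onorm T * M" using nT by (simp add: M_def)
    fix c d x assume cd: "c \<in> C" "d \<in> C"
    have "norm (R c x) \<le> M * norm x"
      by (rule order_trans[OF norm_le_onorm[OF R[OF cd(1)]]])
         (intro mult_right_mono M[OF cd(1)] norm_ge_zero)
    then have "onorm T * norm (R c x) \<le> onorm T * (M * norm x)"
      by (rule mult_left_mono[OF _ nT])
    then have "cmod (c - d) * (onorm T * norm (R c x)) \<le> cmod (c - d) * (onorm T * (M * norm x))"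
      by (rule mult_left_mono) simp
    then have "norm (R c x - R d x) \<le> M * (cmod (c - d) * (onorm T * (M * norm x)))"
      by (intro order_trans[OF est[OF cd]] mult_mono[OF M(1)[OF cd(2)] _ M(2)[OF cd(1)]])
         (simp_all add: nT)
    then show "norm (inv (\<lambda>x. x - c *\<^sub>C T x) x - inv (\<lambda>x. x - d *\<^sub>C T x) x)
        \<le> M * onorm T * M * cmod (c - d) * norm x"
      by (simp add: R_def mult_ac)
  qed
qed

text \<open>The parameters are confined to the unit circle because it is stable under square roots:
  both roots of such a \<open>c\<close> lie on it again. This is what lets the relation pass to the
  squares of the operators.\<close>

definition resolvents_close :: "real \<Rightarrow> ('x::complex_normed_vector \<Rightarrow> 'x) \<Rightarrow> ('x \<Rightarrow> 'x) \<Rightarrow> bool" where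
  "resolvents_close e S T \<longleftrightarrow> (\<forall>c. cmod c = 1 \<longrightarrow>
     invertible_op (\<lambda>x. x - c *\<^sub>C S x) \<and> invertible_op (\<lambda>x. x - c *\<^sub>C T x) \<and>
     (\<forall>x. norm (inv (\<lambda>x. x - c *\<^sub>C S x) x - inv (\<lambda>x. x - c *\<^sub>C T x) x) \<le> e * norm x))"

text \<open>Partial fractions: the factors \<open>P = 1 - d S\<close> and \<open>Q = 1 + d S\<close>
  commute and add up to 2, so half the sum of their inverses inverts \<open>P Q\<close>.\<close>

lemma resolvent_square:
  fixes S :: "'x::complex_normed_vector \<Rightarrow> 'x"
  assumes S: "bounded_clinear S"
    and "invertible_op (\<lambda>x. x - d *\<^sub>C S x)" "invertible_op (\<lambda>x. x - (- d) *\<^sub>C S x)"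
  shows "invertible_op (\<lambda>x. x - d\<^sup>2 *\<^sub>C S (S x))"
    and "inv (\<lambda>x. x - d\<^sup>2 *\<^sub>C S (S x)) x =
      (1 / 2) *\<^sub>C (inv (\<lambda>x. x - d *\<^sub>C S x) x + inv (\<lambda>x. x - (- d) *\<^sub>C S x) x)"
proof -
  define P Q where "P = (\<lambda>x. x - d *\<^sub>C S x)" and "Q = (\<lambda>x. x - (- d) *\<^sub>C S x)"
  define R where "R = (\<lambda>x. (1 / 2) *\<^sub>C (inv P x + inv Q x))"
  have P: "invertible_op P" and Q: "invertible_op Q" using assms by (auto simp: P_def Q_def)
  have I: "bounded_clinear (inv P)" "bounded_clinear (inv Q)"
    by (intro invertible_op_inv P Q)+
  have sum: "P x + Q x = 2 *\<^sub>C x" for x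
    by (simp add: P_def Q_def scaleC_minus_left scaleC_add_left[of 1 1, simplified])
  have f1: "x - d\<^sup>2 *\<^sub>C S (S x) = P (Q x)" and f2: "x - d\<^sup>2 *\<^sub>C S (S x) = Q (P x)" for x
    by (simp_all add: P_def Q_def bounded_clinear_simps[OF S] scaleC_minus_left scaleC_diff_right
        scaleC_add_right scaleC_scaleC power2_eq_square)
  have l: "R (x - d\<^sup>2 *\<^sub>C S (S x)) = x" for x
  proof -
    have "R (x - d\<^sup>2 *\<^sub>C S (S x)) = (1 / 2) *\<^sub>C (inv P (P (Q x)) + inv Q (Q (P x)))"
      by (simp only: R_def f1[symmetric] f2[symmetric])
    also have "\<dots> = x"
      using sum[of x] by (simp add: inv_op_left[OF P] inv_op_left[OF Q] add.commute scaleC_scaleC)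
    finally show ?thesis .
  qed
  have half: "x = (1/2) *\<^sub>C x + (1/2) *\<^sub>C x" for x :: 'x
    by (simp flip: scaleC_add_left)
  have r: "R x - d\<^sup>2 *\<^sub>C S (S (R x)) = x" for x
  proof -
    have "R x - d\<^sup>2 *\<^sub>C S (S (R x)) =
        (1/2) *\<^sub>C (inv P x - d\<^sup>2 *\<^sub>C S (S (inv P x))) +
        (1/2) *\<^sub>C (inv Q x - d\<^sup>2 *\<^sub>C S (S (inv Q x)))"
      by (simp add: R_def bounded_clinear_simps[OF S] scaleC_diff_right
          scaleC_add_right scaleC_scaleC mult.commute)
    also have "\<dots> = (1/2) *\<^sub>C (Q x + P x)"
      by (simp only: f2[of "inv P x"] f1[of "inv Q x"] inv_op_right[OF P] inv_op_right[OF Q]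
          scaleC_add_right)
    also have "\<dots> = x" using sum[of x] by (simp add: add.commute scaleC_scaleC)
    finally show ?thesis .
  qed
  have "bounded_clinear R"
    unfolding R_def by (intro bounded_clinear_intros I)
  from invertible_opI[OF this l r] show "invertible_op (\<lambda>x. x - d\<^sup>2 *\<^sub>C S (S x))" .
  show "inv (\<lambda>x. x - d\<^sup>2 *\<^sub>C S (S x)) x =
      (1 / 2) *\<^sub>C (inv (\<lambda>x. x - d *\<^sub>C S x) x + inv (\<lambda>x. x - (- d) *\<^sub>C S x) x)"
    using inv_op_eq[of R, OF l r] by (simp add: R_def P_def Q_def)
qed

text \<open>The constant \<open>e\<close> is kept, not doubled, since each new resolvent is the
  average of the two old ones at the square roots of \<open>c\<close>. Hence squaring can be
  iterated without loss.\<close>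

lemma resolvents_close_square:
  assumes S: "bounded_clinear S" and T: "bounded_clinear T" and cl: "resolvents_close e S T"
  shows "resolvents_close e (\<lambda>x. S (S x)) (\<lambda>x. T (T x))"
  unfolding resolvents_close_def
proof (intro allI impI)
  fix c :: complex assume c: "cmod c = 1"
  define d where "d = csqrt c"
  have d2: "d\<^sup>2 = c" and d: "cmod d = 1" "cmod (- d) = 1" using c by (auto simp: d_def)
  have 1: "invertible_op (\<lambda>x. x - d *\<^sub>C S x)" "invertible_op (\<lambda>x. x - d *\<^sub>C T x)"
     "\<And>x. norm (inv (\<lambda>x. x - d *\<^sub>C S x) x - inv (\<lambda>x. x - d *\<^sub>C T x) x) \<le> e * norm x"
    using cl d(1) unfolding resolvents_close_def by blast+
  have 2: "invertible_op (\<lambda>x. x - (-d) *\<^sub>C S x)" "invertible_op (\<lambda>x. x - (-d) *\<^sub>C T x)"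
     "\<And>x. norm (inv (\<lambda>x. x - (-d) *\<^sub>C S x) x - inv (\<lambda>x. x - (-d) *\<^sub>C T x) x) \<le> e * norm x"
    using cl d(2) unfolding resolvents_close_def by blast+
  note RS = resolvent_square[OF S 1(1) 2(1), unfolded d2]
  note RT = resolvent_square[OF T 1(2) 2(2), unfolded d2]
  show "invertible_op (\<lambda>x. x - c *\<^sub>C S (S x)) \<and> invertible_op (\<lambda>x. x - c *\<^sub>C T (T x)) \<and>
     (\<forall>x. norm (inv (\<lambda>x. x - c *\<^sub>C S (S x)) x - inv (\<lambda>x. x - c *\<^sub>C T (T x)) x) \<le> e * norm x)"
  proof (intro conjI allI RS(1) RT(1))
    fix x
    show "norm (inv (\<lambda>x. x - c *\<^sub>C S (S x)) x - inv (\<lambda>x. x - c *\<^sub>C T (T x)) x) \<le> e * norm x"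
      unfolding RS(2) RT(2) scaleC_diff_right[symmetric] norm_scaleC
      using norm_triangle_ineq[of "inv (\<lambda>x. x - d *\<^sub>C S x) x - inv (\<lambda>x. x - d *\<^sub>C T x) x"
          "inv (\<lambda>x. x - (-d) *\<^sub>C S x) x - inv (\<lambda>x. x - (-d) *\<^sub>C T x) x"] 1(3)[of x] 2(3)[of x]
      by (simp add: algebra_simps)
  qed
qed

lemma resolvents_close_dyadic_power:
  assumes S: "bounded_clinear S" and T: "bounded_clinear T" and cl: "resolvents_close e S T"
  shows "resolvents_close e (S ^^ (2 ^ m)) (T ^^ (2 ^ m))"
proof (induction m)
  case 0
  show ?case using cl by simp
next
  case (Suc m)
  have "U ^^ (2 ^ Suc m) = (\<lambda>x. (U ^^ (2 ^ m)) ((U ^^ (2 ^ m)) x))" for U :: "'a \<Rightarrow> 'a"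
    by (simp add: mult_2 funpow_add o_def)
  then show ?case
    using resolvents_close_square[OF bounded_clinear_power[OF S] bounded_clinear_power[OF T] Suc]
    by simp
qed

text \<open>For \<open>onorm S\<close> at most 1/10 the inverse of \<open>1 - S\<close> differs from
  the identity by at most 1/9, so that of \<open>1 - T\<close> differs from it by at most 1/9 + 1/4
  = 13/36. With \<open>x = y - T y\<close> this says that \<open>T y = y - x\<close> has norm at
  most 13/36 of that of \<open>x\<close>, hence at most 13/23 of that of \<open>y\<close>, and 13/23
  is below 3/5.\<close>

lemma resolvents_close_imp_small:
  assumes S: "bounded_clinear S" and T: "bounded_clinear T"
    and cl: "resolvents_close (1 / 4) S T" and small: "onorm S \<le> 1 / 10"
  shows "onorm T \<le> 3 / 5"
proof (rule onorm_bound)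
  fix y
  define x where "x = y - T y"
  define X where "X = inv (\<lambda>x. x - 1 *\<^sub>C T x)"
  define Y where "Y = inv (\<lambda>x. x - 1 *\<^sub>C S x)"
  have cl1: "invertible_op (\<lambda>x. x - 1 *\<^sub>C S x)" "invertible_op (\<lambda>x. x - 1 *\<^sub>C T x)"
      "norm (Y x - X x) \<le> 1 / 4 * norm x"
    using cl unfolding resolvents_close_def X_def Y_def by (meson norm_one)+
  have X: "X x = y" using inv_op_left[OF cl1(2), of y] by (simp add: X_def x_def)
  have Y: "Y x - S (Y x) = x" using inv_op_right[OF cl1(1), of x] by (simp add: Y_def)
  have SY: "norm (S (Y x)) \<le> 1 / 10 * norm (Y x)"
    by (rule order_trans[OF norm_le_onorm[OF S]]) (intro mult_right_mono small norm_ge_zero)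
  have YS: "Y x = x + S (Y x)" using Y by (simp add: algebra_simps)
  have "norm (Y x) \<le> norm x + norm (S (Y x))"
    using norm_triangle_ineq[of x "S (Y x)"] YS by simp
  then have "norm (Y x) \<le> 10 / 9 * norm x" using SY by simp
  then have "norm (S (Y x)) \<le> 1 / 9 * norm x" using SY by simp
  then have "norm (Y x - x) \<le> 1 / 9 * norm x" using YS by (metis add_diff_cancel_left')
  moreover have "norm (X x - x) \<le> norm (Y x - x) + norm (Y x - X x)"
    using norm_triangle_ineq4[of "Y x - x" "Y x - X x"] by simp
  ultimately have "norm (y - x) \<le> 13 / 36 * norm x" using cl1(3) X by simp
  moreover have "norm x \<le> norm y + norm (y - x)"
    using norm_triangle_ineq4[of y "y - x"] by simp
  ultimately have "norm (y - x) \<le> 3 / 5 * norm y" using norm_ge_zero[of y] by argo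
  then show "norm (T y) \<le> 3 / 5 * norm y" by (simp add: x_def)
qed simp

text \<open>The later dyadic powers are powers of this one, so the norms decay. This turns the bound
  3/5, obtained at a new parameter, into the bound 1/10 that is needed to continue from
  there.\<close>

lemma dyadic_power_tendsto_0:
  fixes T :: "'x::complex_normed_vector \<Rightarrow> 'x"
  assumes T: "bounded_clinear T" and small: "onorm (T ^^ (2 ^ m)) \<le> 3 / 5"
  shows "(\<lambda>m. onorm (T ^^ (2 ^ m))) \<longlonglongrightarrow> 0"
proof -
  have "(\<lambda>k. onorm (T ^^ (2 ^ (k + m)))) \<longlonglongrightarrow> 0"
  proof (rule tendsto_sandwich[OF always_eventually always_eventually tendsto_const])
    show "\<forall>k. 0 \<le> onorm (T ^^ (2 ^ (k + m)))"
      by (intro allI onorm_nonneg bounded_clinear_power T)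
    show "(\<lambda>k. (3 / 5 :: real) ^ k) \<longlonglongrightarrow> 0" by (rule LIMSEQ_power_zero) simp
    show "\<forall>k. onorm (T ^^ (2 ^ (k + m))) \<le> (3 / 5) ^ k"
    proof
      fix k
      have "onorm (T ^^ (2 ^ (k + m))) = onorm ((T ^^ (2 ^ m)) ^^ (2 ^ k))"
        by (simp add: funpow_mult power_add mult.commute)
      also have "\<dots> \<le> onorm (T ^^ (2 ^ m)) ^ (2 ^ k)"
        by (rule onorm_funpow_le[OF bounded_clinear_power[OF T]])
      also have "\<dots> \<le> (3 / 5) ^ (2 ^ k)"
        by (intro power_mono small onorm_nonneg bounded_clinear_power T)
      also have "\<dots> \<le> (3 / 5) ^ k"
        by (rule power_decreasing) (auto intro: less_imp_le less_exp)
      finally show "onorm (T ^^ (2 ^ (k + m))) \<le> (3 / 5) ^ k" .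
    qed
  qed
  then show ?thesis by (rule LIMSEQ_offset)
qed

text \<open>
  The identity \<open>2 (1 - S\<^sup>2)\<^sup>-\<^sup>1 = (1 - S)\<^sup>-\<^sup>1 + (1 + S)\<^sup>-\<^sup>1\<close> shows that closeness of the resolvents of two
  operators passes to their dyadic powers. Hence smallness of the powers of \<open>tT\<close> propagates
  from \<open>t = 0\<close> to \<open>t = s\<close> in finitely many steps of fixed size.
\<close>

lemma dyadic_spectral_radius:
  fixes T :: "'x::complex_normed_vector \<Rightarrow> 'x"
  assumes T: "bounded_clinear T" and s: "0 \<le> s"
    and inv: "\<And>c. cmod c \<le> s \<Longrightarrow> invertible_op (\<lambda>x. x - c *\<^sub>C T x)"
  shows "(\<lambda>m. s ^ (2 ^ m) * onorm (T ^^ (2 ^ m))) \<longlonglongrightarrow> 0"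
proof -
  obtain L where L: "0 \<le> L" "\<And>c d x. c \<in> cball 0 s \<Longrightarrow> d \<in> cball 0 s \<Longrightarrow>
    norm (inv (\<lambda>x. x - c *\<^sub>C T x) x - inv (\<lambda>x. x - d *\<^sub>C T x) x) \<le> L * cmod (c - d) * norm x"
    by (rule resolvent_lipschitz[OF T compact_cball[of 0 s]]) (use inv in auto)
  define U where "U = (\<lambda>t x. complex_of_real t *\<^sub>C T x)"
  have U: "bounded_clinear (U t)" for t
    unfolding U_def by (rule bounded_clinear_scaleC_op[OF T])
  define P where "P = (\<lambda>t. (\<lambda>m. onorm (U t ^^ (2 ^ m))) \<longlonglongrightarrow> 0)"
  have step: "P u" if P: "P t" and tu: "0 \<le> t" "t \<le> s" "0 \<le> u" "u \<le> s" "L * \<bar>t - u\<bar> \<le> 1 / 4" for t u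
  proof -
    have "resolvents_close (1 / 4) (U t) (U u)"
      unfolding resolvents_close_def
    proof (intro allI impI)
      fix c :: complex assume c: "cmod c = 1"
      have eq: "(\<lambda>x. x - c *\<^sub>C U r x) = (\<lambda>x. x - (c * of_real r) *\<^sub>C T x)" for r
        by (simp add: U_def scaleC_scaleC)
      have "norm (inv (\<lambda>x. x - (c * of_real t) *\<^sub>C T x) x - inv (\<lambda>x. x - (c * of_real u) *\<^sub>C T x) x)
          \<le> 1 / 4 * norm x" for x
      proof -
        have "cmod (c * of_real t - c * of_real u) = \<bar>t - u\<bar>"
          using c by (metis mult.left_neutral norm_mult norm_of_real of_real_diff right_diff_distrib)
        then show ?thesis
          using L(2)[of "c * of_real t" "c * of_real u" x] tu c
            mult_right_mono[OF tu(5) norm_ge_zero[of x]]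
          by (simp add: norm_mult)
      qed
      then show "invertible_op (\<lambda>x. x - c *\<^sub>C U t x) \<and> invertible_op (\<lambda>x. x - c *\<^sub>C U u x) \<and>
          (\<forall>x. norm (inv (\<lambda>x. x - c *\<^sub>C U t x) x - inv (\<lambda>x. x - c *\<^sub>C U u x) x) \<le> 1 / 4 * norm x)"
        unfolding eq using inv tu c by (auto simp: norm_mult)
    qed
    then have cl: "resolvents_close (1 / 4) (U t ^^ (2 ^ m)) (U u ^^ (2 ^ m))" for m
      by (rule resolvents_close_dyadic_power[OF U U])
    have "eventually (\<lambda>m. onorm (U t ^^ (2 ^ m)) < 1 / 10) sequentially"
      using P unfolding P_def by (rule order_tendstoD) simp
    then obtain m where "onorm (U t ^^ (2 ^ m)) \<le> 1 / 10"
      by (meson eventually_sequentially less_imp_le order_refl)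
    then have "onorm (U u ^^ (2 ^ m)) \<le> 3 / 5"
      by (rule resolvents_close_imp_small[OF bounded_clinear_power[OF U] bounded_clinear_power[OF U] cl])
    then show "P u" unfolding P_def by (rule dyadic_power_tendsto_0[OF U])
  qed
  have P0: "P 0"
  proof -
    have "onorm (U 0 ^^ (2 ^ 0)) \<le> 3 / 5" by (simp add: U_def onorm_zero)
    then show ?thesis unfolding P_def by (rule dyadic_power_tendsto_0[OF U])
  qed
  \<comment> \<open>The interval from 0 to \<open>s\<close> is cut into \<open>Suc N\<close> steps,
    so that each one moves the resolvents by at most \<open>L * s / Suc N\<close>, which is at most
    1/4.\<close>
  obtain N :: nat where N: "4 * L * s \<le> real N" using real_arch_simple by blast
  have "P (real i * (s / real (Suc N)))" if "i \<le> Suc N" for i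
    using that
  proof (induction i)
    case (Suc i)
    have le: "real j * (s / real (Suc N)) \<le> s" if "j \<le> Suc N" for j
      using mult_right_mono[of "real j" "real (Suc N)" "s / real (Suc N)"] that s by simp
    have "L * (s / real (Suc N)) \<le> 1 / 4" using N by (simp add: field_simps)
    moreover have "\<bar>real i * (s / real (Suc N)) - real (Suc i) * (s / real (Suc N))\<bar> = s / real (Suc N)"
      using s by (simp add: field_simps flip: diff_divide_distrib)
    moreover have "real i * (s / real (Suc N)) \<le> s" "real (Suc i) * (s / real (Suc N)) \<le> s"
      by (rule le, use Suc.prems in simp)+
    moreover have "0 \<le> real j * (s / real (Suc N))" for j using s by simp
    ultimately show ?case using Suc
      by (intro step[OF Suc.IH]) (simp_all only: Suc_leD)
  qed (simp add: P0)
  from this[of "Suc N"] have "P s" by simp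
  moreover have "onorm (U s ^^ n) = s ^ n * onorm (T ^^ n)" for n
  proof -
    have "U s ^^ n = (\<lambda>x. (of_real s ^ n) *\<^sub>C (T ^^ n) x)"
      by (simp add: fun_eq_iff U_def funpow_scaleC[OF T])
    then show ?thesis
      using s by (simp add: onorm_scaleC[OF bounded_clinear_power[OF T]] norm_power)
  qed
  ultimately show ?thesis by (simp add: P_def)
qed

text \<open>The dyadic estimate takes the place of Liouville's theorem. With empty spectrum,
  \<open>1 - c T\<close> is invertible for every \<open>c\<close>, so
  \<open>s ^ (2 ^ m) * onorm (T ^^ (2 ^ m))\<close> tends to 0 for every nonnegative
  \<open>s\<close>. Since 0 is not in the spectrum either, \<open>s\<close> may be the norm of the
  inverse of \<open>T\<close>, and for this \<open>s\<close> the terms are at least 1.\<close>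

lemma spectrum_nonempty:
  fixes T :: "'x::complex_normed_vector \<Rightarrow> 'x"
  assumes T: "bounded_clinear T" and nz: "\<exists>x::'x. x \<noteq> 0"
  shows "spectrum T \<noteq> {}"
proof
  assume "spectrum T = {}"
  then have inv: "invertible_op (\<lambda>x. T x - c *\<^sub>C x)" for c by (auto simp: spectrum_def)
  have "invertible_op (\<lambda>x. x - c *\<^sub>C T x)" for c
  proof (cases "c = 0")
    case False
    then show ?thesis
      using invertible_op_scaleC[of "-c", OF _ inv[of "inverse c"]] T
      by (simp add: scaleC_diff_right scaleC_scaleC scaleC_minus_left
          bounded_clinear_diff_ops bounded_clinear_scaleC_op)
  qed (auto intro: invertible_opI[of "\<lambda>x. x"])
  moreover have I: "invertible_op T" using inv[of 0] by simp
  define R where "R = inv T"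
  have R: "bounded_clinear R" unfolding R_def by (rule invertible_op_inv[OF I])
  ultimately have lim: "(\<lambda>m. onorm R ^ (2 ^ m) * onorm (T ^^ (2 ^ m))) \<longlonglongrightarrow> 0"
    by (intro dyadic_spectral_radius T onorm_nonneg)
  have RT: "(R ^^ n) ((T ^^ n) x) = x" for n x
    by (induction n arbitrary: x) (simp_all add: funpow_swap1 R_def inv_op_left[OF I])
  obtain x :: 'x where x: "x \<noteq> 0" using nz by blast
  have "1 \<le> onorm R ^ n * onorm (T ^^ n)" for n
  proof -
    have "norm x \<le> onorm (R ^^ n) * norm ((T ^^ n) x)"
      using norm_le_onorm[OF bounded_clinear_power[OF R], of n "(T ^^ n) x"] by (simp add: RT)
    also have "\<dots> \<le> onorm R ^ n * (onorm (T ^^ n) * norm x)"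
      by (intro mult_mono onorm_funpow_le R norm_le_onorm bounded_clinear_power T
          zero_le_power onorm_nonneg norm_ge_zero)
    finally show ?thesis using x by (simp flip: mult.assoc)
  qed
  then have "1 \<le> (0::real)" by (intro LIMSEQ_le_const[OF lim]) auto
  then show False by simp
qed

subsection \<open>Harmonic functions\<close>

lemma harmonic_on_imp_open: "harmonic_on h U \<Longrightarrow> open U"
  by (simp add: harmonic_on_def)

lemma harmonic_on_imp_continuous_on:
  assumes "harmonic_on h U"
  shows "continuous_on U h"
proof (intro continuous_at_imp_continuous_on ballI)
  fix z assume "z \<in> U"
  then obtain D where "(h has_derivative D) (at z)"
    using assms unfolding harmonic_on_def by blast
  then show "isCont h z" by (rule has_derivative_continuous)
qed

lemma harmonic_on_subset:
  assumes "harmonic_on h U" "open V" "V \<subseteq> U"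
  shows "harmonic_on h V"
proof -
  obtain hx hy hxx hxy hyx hyy where
    c: "continuous_on U hxx" "continuous_on U hxy" "continuous_on U hyx" "continuous_on U hyy" and
    d: "\<forall>z\<in>U. (h has_derivative (\<lambda>v. hx z * Re v + hy z * Im v)) (at z) \<and>
           (hx has_derivative (\<lambda>v. hxx z * Re v + hxy z * Im v)) (at z) \<and>
           (hy has_derivative (\<lambda>v. hyx z * Re v + hyy z * Im v)) (at z) \<and>
           hxx z + hyy z = 0"
    using assms(1) unfolding harmonic_on_def by blast
  show ?thesis
    unfolding harmonic_on_def
  proof (intro conjI exI)
    show "open V" by fact
    show "\<forall>z\<in>V. (h has_derivative (\<lambda>v. hx z * Re v + hy z * Im v)) (at z) \<and>
           (hx has_derivative (\<lambda>v. hxx z * Re v + hxy z * Im v)) (at z) \<and>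
           (hy has_derivative (\<lambda>v. hyx z * Re v + hyy z * Im v)) (at z) \<and>
           hxx z + hyy z = 0"
      using d assms(3) by blast
  qed (rule continuous_on_subset[OF _ assms(3)], fact c)+
qed

lemma harmonic_on_lincomb:
  assumes "harmonic_on f U" "harmonic_on g U"
  shows "harmonic_on (\<lambda>z. a * f z + b * g z) U"
proof -
  obtain fx fy fxx fxy fyx fyy where
    cf: "continuous_on U fxx" "continuous_on U fxy" "continuous_on U fyx" "continuous_on U fyy" and
    df: "\<forall>z\<in>U. (f has_derivative (\<lambda>v. fx z * Re v + fy z * Im v)) (at z) \<and>
           (fx has_derivative (\<lambda>v. fxx z * Re v + fxy z * Im v)) (at z) \<and>
           (fy has_derivative (\<lambda>v. fyx z * Re v + fyy z * Im v)) (at z) \<and>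
           fxx z + fyy z = 0"
    using assms(1) unfolding harmonic_on_def by blast
  obtain gx gy gxx gxy gyx gyy where
    cg: "continuous_on U gxx" "continuous_on U gxy" "continuous_on U gyx" "continuous_on U gyy" and
    dg: "\<forall>z\<in>U. (g has_derivative (\<lambda>v. gx z * Re v + gy z * Im v)) (at z) \<and>
           (gx has_derivative (\<lambda>v. gxx z * Re v + gxy z * Im v)) (at z) \<and>
           (gy has_derivative (\<lambda>v. gyx z * Re v + gyy z * Im v)) (at z) \<and>
           gxx z + gyy z = 0"
    using assms(2) unfolding harmonic_on_def by blast
  have lin: "((\<lambda>z. a * p z + b * q z) has_derivative
      (\<lambda>v. (a * px + b * qx) * Re v + (a * py + b * qy) * Im v)) (at z)"
    if "(p has_derivative (\<lambda>v. px * Re v + py * Im v)) (at z)"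
       "(q has_derivative (\<lambda>v. qx * Re v + qy * Im v)) (at z)" for p q px py qx qy z
    using has_derivative_add[OF has_derivative_mult_right[OF that(1), of a]
        has_derivative_mult_right[OF that(2), of b]]
    by (simp add: algebra_simps)
  have lap: "(a * fxx z + b * gxx z) + (a * fyy z + b * gyy z) = 0" if "z \<in> U" for z
  proof -
    have "(a * fxx z + b * gxx z) + (a * fyy z + b * gyy z) =
        a * (fxx z + fyy z) + b * (gxx z + gyy z)" by algebra
    then show ?thesis using df dg that by simp
  qed
  show ?thesis
    unfolding harmonic_on_def
  proof (intro conjI exI)
    show "open U" using assms(1) by (rule harmonic_on_imp_open)
    show "\<forall>z\<in>U. ((\<lambda>z. a * f z + b * g z) has_derivative
          (\<lambda>v. (a * fx z + b * gx z) * Re v + (a * fy z + b * gy z) * Im v)) (at z) \<and>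
        ((\<lambda>z. a * fx z + b * gx z) has_derivative
          (\<lambda>v. (a * fxx z + b * gxx z) * Re v + (a * fxy z + b * gxy z) * Im v)) (at z) \<and>
        ((\<lambda>z. a * fy z + b * gy z) has_derivative
          (\<lambda>v. (a * fyx z + b * gyx z) * Re v + (a * fyy z + b * gyy z) * Im v)) (at z) \<and>
        (a * fxx z + b * gxx z) + (a * fyy z + b * gyy z) = 0"
      using df dg by (intro ballI conjI lin lap) auto
  qed (intro continuous_intros cf cg)+
qed

lemma harmonic_on_const: "open U \<Longrightarrow> harmonic_on (\<lambda>z. c) U"
  unfolding harmonic_on_def
proof (intro conjI exI)
  assume "open U"
  then show "open U" .
  show "\<forall>z\<in>U. ((\<lambda>z. c) has_derivative (\<lambda>v. 0 * Re v + 0 * Im v)) (at z) \<and>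
      ((\<lambda>z. 0) has_derivative (\<lambda>v. 0 * Re v + 0 * Im v)) (at z) \<and>
      ((\<lambda>z. 0) has_derivative (\<lambda>v. 0 * Re v + 0 * Im v)) (at z) \<and> 0 + (0::real) = 0"
    by simp
qed (rule continuous_on_const)+

lemma harmonic_on_add:
  "harmonic_on f U \<Longrightarrow> harmonic_on g U \<Longrightarrow> harmonic_on (\<lambda>z. f z + g z) U"
  using harmonic_on_lincomb[of f U g 1 1] by simp

lemma harmonic_on_diff:
  "harmonic_on f U \<Longrightarrow> harmonic_on g U \<Longrightarrow> harmonic_on (\<lambda>z. f z - g z) U"
  using harmonic_on_lincomb[of f U g 1 "-1"] by simp

lemma harmonic_on_cmult:
  "harmonic_on f U \<Longrightarrow> harmonic_on (\<lambda>z. c * f z) U"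
  using harmonic_on_lincomb[of f U f c 0] by simp

text \<open>The gradient of \<open>ln (cmod p)\<close> is the complex conjugate of the logarithmic
  derivative \<open>F = p' / p\<close>. The second partial derivatives are then read off from
  \<open>F'\<close> through the Cauchy-Riemann equations, and their trace cancels.\<close>

lemma harmonic_on_ln_poly:
  fixes p :: "complex poly"
  shows "harmonic_on (\<lambda>z. ln (cmod (poly p z))) {z. poly p z \<noteq> 0}"
proof -
  define U where "U = {z. poly p z \<noteq> 0}"
  define F where "F = (\<lambda>z. poly (pderiv p) z / poly p z)"
  define F' where "F' = (\<lambda>z. (poly (pderiv (pderiv p)) z * poly p z -
      poly (pderiv p) z * poly (pderiv p) z) / (poly p z * poly p z))"
  have "open U"
    unfolding U_def by (rule open_Collect_neq) (intro continuous_intros)+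
  have cF': "continuous_on U F'"
    unfolding F'_def by (intro continuous_intros) (auto simp: U_def)
  have dF: "(F has_derivative (\<lambda>v. F' z * v)) (at z)" if "z \<in> U" for z
  proof -
    have "(F has_field_derivative F' z) (at z)"
      unfolding F_def F'_def using that
      by (auto intro!: derivative_eq_intros poly_DERIV simp: U_def)
    then show ?thesis by (simp add: has_field_derivative_def)
  qed
  have dF1: "((\<lambda>z. Re (F z)) has_derivative (\<lambda>v. Re (F' z) * Re v + - Im (F' z) * Im v)) (at z)"
    and dF2: "((\<lambda>z. - Im (F z)) has_derivative (\<lambda>v. - Im (F' z) * Re v + - Re (F' z) * Im v)) (at z)"
    if "z \<in> U" for z
  proof -
    show "((\<lambda>z. Re (F z)) has_derivative (\<lambda>v. Re (F' z) * Re v + - Im (F' z) * Im v)) (at z)"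
      using bounded_linear.has_derivative[OF bounded_linear_Re dF[OF that]] by simp
    show "((\<lambda>z. - Im (F z)) has_derivative (\<lambda>v. - Im (F' z) * Re v + - Re (F' z) * Im v)) (at z)"
      using has_derivative_minus[OF bounded_linear.has_derivative[OF bounded_linear_Im dF[OF that]]]
      by (simp add: algebra_simps)
  qed
  have dln: "((\<lambda>z. ln (cmod (poly p z))) has_derivative
      (\<lambda>v. Re (F z) * Re v + - Im (F z) * Im v)) (at z)" if "z \<in> U" for z
  proof -
    have nz: "poly p z \<noteq> 0" using that by (simp add: U_def)
    have "((\<lambda>z. poly p z) has_derivative (\<lambda>v. poly (pderiv p) z * v)) (at z)"
      using poly_DERIV[of p z] by (simp add: has_field_derivative_def)
    from has_derivative_compose[OF this has_derivative_norm[OF nz]]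
    have "((\<lambda>z. cmod (poly p z)) has_derivative
       (\<lambda>v. (poly (pderiv p) z * v) \<bullet> sgn (poly p z))) (at z)" .
    from has_derivative_ln[OF _ this] nz
    have "((\<lambda>z. ln (cmod (poly p z))) has_derivative
       (\<lambda>v. inverse (cmod (poly p z)) * (sgn (poly p z) \<bullet> (poly (pderiv p) z * v)))) (at z)"
      by (simp add: inner_commute mult.commute)
    moreover have eq: "inverse (cmod w) * (sgn w \<bullet> (d * v)) = Re (d / w * v)" if "w \<noteq> 0" for w d v
    proof -
      have *: "Re (d / w * v) = Re (cnj w * (d * v)) / (cmod w)\<^sup>2"
        using that by (simp add: complex_div_cnj[of d w] mult.commute mult.left_commute
            flip: of_real_power)
      have "inverse (cmod w) * (sgn w \<bullet> (d * v)) = (w \<bullet> (d * v)) / (cmod w)\<^sup>2"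
        by (simp add: sgn_div_norm power2_eq_square divide_inverse)
      then show ?thesis by (simp only: *) (simp add: inner_complex_def)
    qed
    moreover have "Re (F z) * Re v + - Im (F z) * Im v = Re (F z * v)" for v by simp
    ultimately show ?thesis by (simp only: F_def eq[OF nz])
  qed
  show ?thesis
    unfolding harmonic_on_def U_def[symmetric]
  proof (intro conjI exI)
    show "open U" by fact
    show "\<forall>z\<in>U. ((\<lambda>z. ln (cmod (poly p z))) has_derivative
            (\<lambda>v. Re (F z) * Re v + (- Im (F z)) * Im v)) (at z) \<and>
        ((\<lambda>z. Re (F z)) has_derivative (\<lambda>v. Re (F' z) * Re v + (- Im (F' z)) * Im v)) (at z) \<and>
        ((\<lambda>z. - Im (F z)) has_derivative (\<lambda>v. (- Im (F' z)) * Re v + (- Re (F' z)) * Im v)) (at z) \<and>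
        Re (F' z) + (- Re (F' z)) = 0"
      using dln dF1 dF2 by auto
  qed (intro continuous_intros cF')+
qed

subsection \<open>The maximum principle\<close>

lemma second_derivative_nonpos_at_max:
  fixes f f' :: "real \<Rightarrow> real"
  assumes "e > 0" and f: "\<And>t. \<bar>t\<bar> < e \<Longrightarrow> (f has_real_derivative f' t) (at t)"
    and f': "(f' has_real_derivative D) (at 0)" and max: "\<And>t. \<bar>t\<bar> < e \<Longrightarrow> f t \<le> f 0"
  shows "D \<le> 0"
proof (rule ccontr)
  assume "\<not> D \<le> 0"
  then have "D > 0" by simp
  have "f' 0 = 0"
    by (rule DERIV_local_max[OF f \<open>e > 0\<close>]) (use \<open>e > 0\<close> max in auto)
  then obtain d where d: "d > 0" "\<And>h. 0 < h \<Longrightarrow> h < d \<Longrightarrow> 0 < f' h"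
    using DERIV_pos_inc_right[OF f' \<open>D > 0\<close>] by auto
  define h where "h = min d e / 2"
  have h: "0 < h" "h < d" "h < e" using d \<open>e > 0\<close> by (auto simp: h_def)
  have "f 0 < f h"
  proof (rule DERIV_pos_imp_increasing_open[OF h(1)])
    show "\<exists>y. (f has_real_derivative y) (at x) \<and> y > 0" if "0 < x" "x < h" for x
      using f[of x] d(2)[of x] that h by force
    show "continuous_on {0..h} f"
      by (intro DERIV_continuous_on[of _ _ f'] has_field_derivative_at_within[OF f]) (use h in auto)
  qed
  then show False using max[of h] h by simp
qed

lemma has_real_derivative_along_line:
  assumes "(u has_derivative (\<lambda>v. a * Re v + b * Im v)) (at (z + of_real t * d))"
  shows "((\<lambda>t. u (z + of_real t * d)) has_real_derivative a * Re d + b * Im d) (at t)"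
proof -
  have "((\<lambda>t. z + of_real t * d) has_derivative (\<lambda>s. of_real s * d)) (at t)"
    by (auto intro!: derivative_eq_intros)
  from has_derivative_compose[OF this assms] show ?thesis
    by (rule has_derivative_imp_has_field_derivative) (simp add: algebra_simps)
qed

text \<open>The added term makes the Laplacian equal to \<open>4 * \<delta>\<close>, whereas at a
  local maximum the second derivatives along both coordinate axes are at most 0.\<close>

lemma harmonic_plus_square_no_local_max:
  assumes u: "harmonic_on u U" and z: "z \<in> U" and "\<delta> > 0" "r > 0"
    and max: "\<And>w. w \<in> ball z r \<Longrightarrow> u w + \<delta> * (cmod w)\<^sup>2 \<le> u z + \<delta> * (cmod z)\<^sup>2"
  shows False
proof -
  obtain ux uy uxx uxy uyx uyy where
    du: "\<forall>z\<in>U. (u has_derivative (\<lambda>v. ux z * Re v + uy z * Im v)) (at z) \<and>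
           (ux has_derivative (\<lambda>v. uxx z * Re v + uxy z * Im v)) (at z) \<and>
           (uy has_derivative (\<lambda>v. uyx z * Re v + uyy z * Im v)) (at z) \<and>
           uxx z + uyy z = 0"
    using u unfolding harmonic_on_def by blast
  obtain e0 where e0: "e0 > 0" "ball z e0 \<subseteq> U"
    using harmonic_on_imp_open[OF u] z open_contains_ball by blast
  define e where "e = min e0 r"
  have e: "e > 0" "ball z e \<subseteq> U" "ball z e \<subseteq> ball z r" using e0 \<open>r > 0\<close> by (auto simp: e_def)
  have in_ball: "z + of_real t * d \<in> ball z e" if "\<bar>t\<bar> < e" "cmod d = 1" for t d
    using that by (simp add: dist_norm norm_mult)
  have "uxx z + 2 * \<delta> \<le> 0"
  proof (rule second_derivative_nonpos_at_max[OF e(1)])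
    show "((\<lambda>t. u (z + of_real t * 1) + \<delta> * (cmod (z + of_real t * 1))\<^sup>2) has_real_derivative
        (ux (z + of_real t * 1) * Re 1 + uy (z + of_real t * 1) * Im 1) + \<delta> * (2 * (Re z + t))) (at t)"
      if "\<bar>t\<bar> < e" for t
    proof (rule DERIV_add[OF has_real_derivative_along_line])
      show "(u has_derivative (\<lambda>v. ux (z + of_real t * 1) * Re v + uy (z + of_real t * 1) * Im v))
          (at (z + of_real t * 1))"
        using du in_ball[OF that, of 1] e by auto
      show "((\<lambda>t. \<delta> * (cmod (z + of_real t * 1))\<^sup>2) has_real_derivative \<delta> * (2 * (Re z + t))) (at t)"
        by (cases z) (auto simp: cmod_power2 intro!: derivative_eq_intros)
    qed
    show "((\<lambda>t. (ux (z + of_real t * 1) * Re 1 + uy (z + of_real t * 1) * Im 1) + \<delta> * (2 * (Re z + t)))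
        has_real_derivative uxx z + 2 * \<delta>) (at 0)"
    proof -
      have "((\<lambda>t. ux (z + of_real t * 1)) has_real_derivative uxx z) (at 0)"
        using has_real_derivative_along_line[of ux "uxx z" "uxy z" z 0 1] du z by simp
      moreover have "((\<lambda>t. \<delta> * (2 * (Re z + t))) has_real_derivative 2 * \<delta>) (at 0)"
        by (auto intro!: derivative_eq_intros)
      ultimately show ?thesis by (simp add: DERIV_add)
    qed
    show "u (z + of_real t * 1) + \<delta> * (cmod (z + of_real t * 1))\<^sup>2 \<le>
        u (z + of_real 0 * 1) + \<delta> * (cmod (z + of_real 0 * 1))\<^sup>2" if "\<bar>t\<bar> < e" for t
      using max[of "z + of_real t * 1"] in_ball[OF that, of 1] e by auto
  qed
  moreover have "uyy z + 2 * \<delta> \<le> 0"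
  proof (rule second_derivative_nonpos_at_max[OF e(1)])
    show "((\<lambda>t. u (z + of_real t * \<i>) + \<delta> * (cmod (z + of_real t * \<i>))\<^sup>2) has_real_derivative
        (ux (z + of_real t * \<i>) * Re \<i> + uy (z + of_real t * \<i>) * Im \<i>) + \<delta> * (2 * (Im z + t))) (at t)"
      if "\<bar>t\<bar> < e" for t
    proof (rule DERIV_add[OF has_real_derivative_along_line])
      show "(u has_derivative (\<lambda>v. ux (z + of_real t * \<i>) * Re v + uy (z + of_real t * \<i>) * Im v))
          (at (z + of_real t * \<i>))"
        using du in_ball[OF that, of \<i>] e by auto
      show "((\<lambda>t. \<delta> * (cmod (z + of_real t * \<i>))\<^sup>2) has_real_derivative \<delta> * (2 * (Im z + t))) (at t)"
        by (cases z) (auto simp: cmod_power2 intro!: derivative_eq_intros)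
    qed
    show "((\<lambda>t. (ux (z + of_real t * \<i>) * Re \<i> + uy (z + of_real t * \<i>) * Im \<i>) + \<delta> * (2 * (Im z + t)))
        has_real_derivative uyy z + 2 * \<delta>) (at 0)"
    proof -
      have "((\<lambda>t. uy (z + of_real t * \<i>)) has_real_derivative uyy z) (at 0)"
        using has_real_derivative_along_line[of uy "uyx z" "uyy z" z 0 \<i>] du z by simp
      moreover have "((\<lambda>t. \<delta> * (2 * (Im z + t))) has_real_derivative 2 * \<delta>) (at 0)"
        by (auto intro!: derivative_eq_intros)
      ultimately show ?thesis by (simp add: DERIV_add)
    qed
    show "u (z + of_real t * \<i>) + \<delta> * (cmod (z + of_real t * \<i>))\<^sup>2 \<le>
        u (z + of_real 0 * \<i>) + \<delta> * (cmod (z + of_real 0 * \<i>))\<^sup>2" if "\<bar>t\<bar> < e" for t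
      using max[of "z + of_real t * \<i>"] in_ball[OF that, of \<i>] e by auto
  qed
  moreover have "uxx z + uyy z = 0" using du z by blast
  ultimately show False using \<open>\<delta> > 0\<close> by linarith
qed

text \<open>The perturbed function \<open>w\<close> attains its maximum over \<open>C\<close> at a
  point outside the interior of \<open>C\<close>. There \<open>u\<close> is at most
  \<open>c\<close>: otherwise \<open>u > c\<close> on a neighbourhood, which would have to lie in
  \<open>C\<close>.\<close>

lemma maximum_principle_compact:
  assumes u: "harmonic_on u D" and C: "compact C" "C \<subseteq> D"
    and out: "\<And>z. z \<in> D - C \<Longrightarrow> u z \<le> c" and z0: "z0 \<in> D"
  shows "u z0 \<le> c"
proof (rule ccontr)
  assume "\<not> u z0 \<le> c"
  then have gt: "u z0 > c" and z0C: "z0 \<in> C" using out z0 by auto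
  obtain R where R: "R > 0" "\<And>z. z \<in> C \<Longrightarrow> cmod z \<le> R"
    using compact_imp_bounded[OF C(1)] by (auto simp: bounded_pos)
  \<comment> \<open>On \<open>C\<close> the perturbation is at most
    \<open>\<delta> * R\<^sup>2\<close>, half of the amount by which \<open>u z0\<close> exceeds
    \<open>c\<close>.\<close>
  define \<delta> where "\<delta> = (u z0 - c) / (2 * R\<^sup>2)"
  have \<delta>: "\<delta> > 0" using gt R by (simp add: \<delta>_def)
  define w where "w = (\<lambda>z. u z + \<delta> * (cmod z)\<^sup>2)"
  have cu: "continuous_on D u" by (rule harmonic_on_imp_continuous_on[OF u])
  have "continuous_on C w"
    unfolding w_def by (intro continuous_intros continuous_on_subset[OF cu C(2)])
  then obtain z1 where z1: "z1 \<in> C" "\<And>z. z \<in> C \<Longrightarrow> w z \<le> w z1"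
    using continuous_attains_sup[OF C(1), of w] z0C by blast
  show False
  proof (cases "z1 \<in> interior C")
    case True
    then obtain r where "r > 0" "ball z1 r \<subseteq> C" by (auto simp: mem_interior)
    then show False
      using harmonic_plus_square_no_local_max[OF u, of z1 \<delta> r] z1 C(2) \<delta>
      unfolding w_def by blast
  next
    case False
    have "u z1 \<le> c"
    proof (rule ccontr)
      assume "\<not> u z1 \<le> c"
      then have "u z1 \<in> {c<..}" by simp
      moreover have "open D" by (rule harmonic_on_imp_open[OF u])
      ultimately obtain A where A: "open A" "A \<inter> D = u -` {c<..} \<inter> D"
        using cu open_greaterThan unfolding continuous_on_open_invariant by metis
      have "z1 \<in> A \<inter> D" using A \<open>u z1 \<in> {c<..}\<close> z1(1) C(2) by auto
      moreover have "A \<inter> D \<subseteq> C" using A out by force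
      ultimately show False
        using False A(1) \<open>open D\<close> by (meson interiorI open_Int)
    qed
    have "w z1 \<le> c + \<delta> * R\<^sup>2"
      unfolding w_def using \<open>u z1 \<le> c\<close> R(2)[OF z1(1)] \<delta>
      by (intro add_mono mult_left_mono power_mono) auto
    also have "\<dots> < u z0" using gt R by (simp add: \<delta>_def field_simps)
    also have "\<dots> \<le> w z0" using \<delta> by (simp add: w_def)
    finally show False using z1(2)[OF z0C] by simp
  qed
qed

text \<open>The conditions at the frontier and at infinity say exactly what is needed for the
  closure of the set where \<open>u > c\<close> to be a compact subset of \<open>D\<close>.\<close>

lemma maximum_principle:
  assumes u: "harmonic_on u D" 
    and bdry: "\<And>\<zeta>. \<zeta> \<in> frontier D \<Longrightarrow> eventually (\<lambda>z. u z \<le> c) (at \<zeta> within D)"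
    and inf: "eventually (\<lambda>z. z \<in> D \<longrightarrow> u z \<le> c) at_infinity"
    and z0: "z0 \<in> D"
  shows "u z0 \<le> c"
proof -
  define C where "C = closure {z\<in>D. u z > c}"
  obtain B where B: "\<And>z. cmod z \<ge> B \<Longrightarrow> z \<in> D \<Longrightarrow> u z \<le> c"
    using inf by (auto simp: eventually_at_infinity)
  have "{z\<in>D. u z > c} \<subseteq> ball 0 B" using B by force
  then have "bounded {z\<in>D. u z > c}" using bounded_ball bounded_subset by blast
  then have "compact C" by (simp add: C_def compact_closure)
  moreover have "C \<subseteq> D"
  proof
    fix \<zeta> assume \<zeta>: "\<zeta> \<in> C"
    show "\<zeta> \<in> D"
    proof (rule ccontr)
      assume nD: "\<zeta> \<notin> D"
      have "\<zeta> \<in> closure D" using \<zeta> closure_mono[of "{z\<in>D. u z > c}" D] by (auto simp: C_def)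
      then have "\<zeta> \<in> frontier D"
        using nD harmonic_on_imp_open[OF u] by (simp add: frontier_def interior_open)
      from bdry[OF this] obtain d where d: "d > 0" "\<And>z. z \<in> D \<Longrightarrow> z \<noteq> \<zeta> \<Longrightarrow> dist z \<zeta> < d \<Longrightarrow> u z \<le> c"
        by (auto simp: eventually_at)
      obtain z where "z \<in> D" "u z > c" "dist z \<zeta> < d"
        using \<zeta> d(1) unfolding C_def closure_approachable by blast
      then show False using d(2)[of z] nD by force
    qed
  qed
  moreover have "u z \<le> c" if "z \<in> D - C" for z
    using that closure_subset[of "{z\<in>D. u z > c}"] by (force simp: C_def)
  ultimately show ?thesis using maximum_principle_compact[OF u] z0 by blast
qed

subsection \<open>Green's functions and the Bernstein--Walsh inequality\<close>

lemma harmonic_on_sum_ln_dist: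
  assumes "open U" "finite I" "\<And>i. i \<in> I \<Longrightarrow> a i \<notin> U"
  shows "harmonic_on (\<lambda>z. \<Sum>i\<in>I. ln (cmod (z - a i))) U"
  using assms(2,3)
proof (induction I rule: finite_induct)
  case empty
  then show ?case using harmonic_on_const[OF \<open>open U\<close>, of 0] by simp
next
  case (insert i I)
  have "harmonic_on (\<lambda>z. ln (cmod (z - a i))) U"
    using harmonic_on_subset[OF harmonic_on_ln_poly[of "[:- a i, 1:]"] \<open>open U\<close>] insert.prems
    by auto
  moreover have "harmonic_on (\<lambda>z. \<Sum>i\<in>I. ln (cmod (z - a i))) U"
    using insert by auto
  ultimately show ?case using insert by (simp add: harmonic_on_add)
qed

lemma green_function_at_infinity:
  assumes "green_function K g"
  obtains C R where "1 \<le> R" "\<And>z. R \<le> cmod z \<Longrightarrow> \<bar>g z - ln (cmod z)\<bar> \<le> C"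
proof -
  have "(\<lambda>z. g z - ln (cmod z)) \<in> O[at_infinity](\<lambda>_. 1)"
    using assms by (simp add: green_function_def)
  then obtain c where "eventually (\<lambda>z. norm (g z - ln (cmod z)) \<le> c * norm (1::real)) at_infinity"
    by (rule landau_o.bigE)
  then obtain b where b: "\<And>z. b \<le> cmod z \<Longrightarrow> \<bar>g z - ln (cmod z)\<bar> \<le> c"
    by (auto simp: eventually_at_infinity)
  show ?thesis by (rule that[of "max 1 b" c]) (use b in auto)
qed

lemma poly_growth:
  fixes p :: "complex poly"
  obtains C where "C > 0" "\<And>z. 1 \<le> cmod z \<Longrightarrow> cmod (poly p z) \<le> C * cmod z ^ degree p"
proof
  define C where "C = (\<Sum>i\<le>degree p. cmod (coeff p i)) + 1"
  show "C > 0" unfolding C_def by (intro add_nonneg_pos sum_nonneg) auto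
  fix z :: complex assume z: "1 \<le> cmod z"
  have "cmod (poly p z) \<le> (\<Sum>i\<le>degree p. cmod (coeff p i) * cmod z ^ i)"
    unfolding poly_altdef by (rule order_trans[OF norm_sum]) (simp add: norm_mult norm_power)
  also have "\<dots> \<le> (\<Sum>i\<le>degree p. cmod (coeff p i) * cmod z ^ degree p)"
    by (intro sum_mono mult_left_mono power_increasing z) auto
  also have "\<dots> \<le> C * cmod z ^ degree p"
    by (simp add: C_def sum_distrib_right[symmetric] mult_right_mono)
  finally show "cmod (poly p z) \<le> C * cmod z ^ degree p" .
qed

text \<open>Maximum principle for \<open>ln (cmod p) - ln M - (n + e) * g\<close> off
  \<open>K\<close> and off the zeros of \<open>p\<close>. At the frontier the bound \<open>M\<close>
  and the positivity of \<open>g\<close> suffice. With \<open>n * g\<close> alone the difference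
  would merely be bounded at infinity; the extra \<open>e * g\<close> drives it to minus
  infinity.\<close>

lemma bernstein_walsh:
  fixes p :: "complex poly" and g :: "complex \<Rightarrow> real"
  assumes K: "compact K" and g: "green_function K g"
    and "M > 0" and M: "\<And>w. w \<in> K \<Longrightarrow> cmod (poly p w) \<le> M" and z: "z \<notin> K"
  shows "cmod (poly p z) \<le> M * exp (real (degree p) * g z)"
proof (cases "poly p z = 0")
  case True
  then show ?thesis using \<open>M > 0\<close> by simp
next
  case False
  define n where "n = degree p"
  define D where "D = {z. poly p z \<noteq> 0} \<inter> - K"
  have gpos: "g z > 0" if "z \<notin> K" for z
    using g that by (auto simp: green_function_def)
  have "open {z. poly p z \<noteq> 0}" by (rule open_Collect_neq) (intro continuous_intros)+
  then have "open D" unfolding D_def using K by (intro open_Int open_Compl compact_imp_closed)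
  obtain C R where CR: "1 \<le> R" "\<And>z. R \<le> cmod z \<Longrightarrow> \<bar>g z - ln (cmod z)\<bar> \<le> C"
    using green_function_at_infinity[OF g] by blast
  obtain C' where C': "C' > 0" "\<And>z. 1 \<le> cmod z \<Longrightarrow> cmod (poly p z) \<le> C' * cmod z ^ n"
    using poly_growth[of p] unfolding n_def by blast
  have main: "ln (cmod (poly p z)) - ln M - (real n + e) * g z \<le> e" if e: "e > 0" for e :: real
  proof (rule maximum_principle[where D=D])
    have "harmonic_on (\<lambda>z. ln (cmod (poly p z))) D" "harmonic_on g D"
      using harmonic_on_subset[OF harmonic_on_ln_poly \<open>open D\<close>, of p]
        harmonic_on_subset[OF _ \<open>open D\<close>, of g "- K"] g
      by (auto simp: D_def green_function_def)
    then show "harmonic_on (\<lambda>z. ln (cmod (poly p z)) - ln M - (real n + e) * g z) D"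
      by (intro harmonic_on_diff harmonic_on_cmult harmonic_on_const \<open>open D\<close>)
    show "z \<in> D" using z False by (simp add: D_def)
    show "eventually (\<lambda>z. ln (cmod (poly p z)) - ln M - (real n + e) * g z \<le> e) (at \<zeta> within D)"
      if "\<zeta> \<in> frontier D" for \<zeta>
    proof -
      have "\<zeta> \<notin> D" using that \<open>open D\<close> by (simp add: frontier_def interior_open)
      then have "cmod (poly p \<zeta>) \<le> M" using M \<open>M > 0\<close> by (auto simp: D_def)
      also have "\<dots> < M * exp e" using \<open>M > 0\<close> e by simp
      finally have lt: "cmod (poly p \<zeta>) < M * exp e" .
      have "((\<lambda>z. cmod (poly p z)) \<longlongrightarrow> cmod (poly p \<zeta>)) (at \<zeta> within D)"
        by (intro tendsto_intros)
      from order_tendstoD(2)[OF this lt]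
      have "eventually (\<lambda>z. cmod (poly p z) < M * exp e) (at \<zeta> within D)" .
      moreover have "eventually (\<lambda>z. z \<in> D) (at \<zeta> within D)"
        by (simp add: eventually_at_filter)
      ultimately show ?thesis
      proof eventually_elim
        case (elim z)
        then have "ln (cmod (poly p z)) \<le> ln (M * exp e)"
            using \<open>M > 0\<close> by (subst ln_le_cancel_iff) (auto simp: D_def)
        also have "\<dots> = ln M + e" using \<open>M > 0\<close> by (simp add: ln_mult)
        finally have "ln (cmod (poly p z)) \<le> ln M + e" .
        moreover have "0 \<le> (real n + e) * g z"
          using gpos[of z] elim(2) e by (intro mult_nonneg_nonneg) (auto simp: D_def)
        ultimately show ?case by simp
      qed
    qed
    \<comment> \<open>Beyond \<open>ln (cmod z) = X\<close> the term \<open>e * ln (cmod z)\<close>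
      outweighs all the constants.\<close>
    define X where "X = (ln C' - ln M + (real n + e) * C) / e"
    show "eventually (\<lambda>z. z \<in> D \<longrightarrow> ln (cmod (poly p z)) - ln M - (real n + e) * g z \<le> e) at_infinity"
      unfolding eventually_at_infinity
    proof (intro exI[of _ "max R (exp X)"] allI impI)
      fix z assume z: "max R (exp X) \<le> cmod z" "z \<in> D"
      then have z1: "1 \<le> cmod z" using CR(1) by simp
      have "X \<le> ln (cmod z)" using z z1 by (subst ln_ge_iff) auto
      then have "ln C' - ln M + (real n + e) * C \<le> e * ln (cmod z)"
        using e by (simp add: X_def field_simps)
      moreover have "ln (cmod (poly p z)) \<le> ln C' + real n * ln (cmod z)"
      proof -
        have "ln (cmod (poly p z)) \<le> ln (C' * cmod z ^ n)"
          using C'(2)[OF z1] z(2) C'(1) z1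
          by (subst ln_le_cancel_iff) (auto simp: D_def intro!: mult_pos_pos zero_less_power)
        moreover have "z \<noteq> 0" using z1 by auto
        ultimately show ?thesis using C'(1) by (simp add: ln_mult ln_realpow)
      qed
      moreover have "(real n + e) * (ln (cmod z) - C) \<le> (real n + e) * g z"
        using CR(2)[of z] z e by (intro mult_left_mono) auto
      ultimately show "ln (cmod (poly p z)) - ln M - (real n + e) * g z \<le> e"
        using e by (simp add: algebra_simps)
    qed
  qed
  have "ln (cmod (poly p z)) \<le> ln M + real n * g z"
  proof (rule field_le_epsilon)
    fix e :: real assume "e > 0"
    \<comment> \<open>The estimate \<open>main\<close> with parameter \<open>e'\<close> has total
      error \<open>e' * (1 + g z)\<close>.\<close>
    then have "e / (1 + g z) > 0" using gpos[OF z] by simp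
    from main[OF this] have "ln (cmod (poly p z)) \<le> ln M + real n * g z + (e / (1 + g z)) * (1 + g z)"
      by (simp only: algebra_simps)
    then show "ln (cmod (poly p z)) \<le> ln M + real n * g z + e" using gpos[OF z] by simp
  qed
  then have "exp (ln (cmod (poly p z))) \<le> exp (ln M + real n * g z)" by simp
  then show ?thesis using False \<open>M > 0\<close> by (simp add: exp_add n_def)
qed

subsection \<open>A space-filling curve\<close>

lemma binary_expansion:
  fixes x :: real
  assumes "0 \<le> x" "x \<le> 1"
  obtains b :: "nat \<Rightarrow> real" where "\<And>k. b k \<in> {0, 1}" "(\<lambda>k. b k / 2 ^ Suc k) sums x"
proof -
  define bit where "bit = (\<lambda>r::real. if 1 / 2 \<le> r then 1 else 0 :: real)"
  \<comment> \<open>\<open>r k\<close> is \<open>2 ^ k\<close> times the remainder after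
    \<open>k\<close> binary digits; it stays in [0, 1], so the remainder itself tends to 0.\<close>
  define r where "r = rec_nat x (\<lambda>_ r. 2 * r - bit r)"
  have r0: "r 0 = x" and rS: "r (Suc k) = 2 * r k - bit (r k)" for k
    by (simp_all add: r_def)
  have r01: "0 \<le> r k \<and> r k \<le> 1" for k
    by (induction k) (use assms in \<open>auto simp: r0 rS bit_def\<close>)
  have partial: "(\<Sum>k<n. bit (r k) / 2 ^ Suc k) = x - r n / 2 ^ n" for n
    by (induction n) (simp_all add: r0 rS field_simps)
  have "(\<lambda>n. r n / 2 ^ n) \<longlonglongrightarrow> 0"
  proof (rule tendsto_sandwich[OF always_eventually always_eventually tendsto_const])
    show "(\<lambda>n. (1 / 2 :: real) ^ n) \<longlonglongrightarrow> 0" by (rule LIMSEQ_power_zero) simp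
  qed (use r01 in \<open>auto simp: power_divide intro!: divide_right_mono\<close>)
  then have "(\<lambda>n. x - r n / 2 ^ n) \<longlonglongrightarrow> x - 0" by (intro tendsto_intros)
  then have "(\<lambda>k. bit (r k) / 2 ^ Suc k) sums x" unfolding sums_def partial by simp
  then show ?thesis by (intro that[of "\<lambda>k. bit (r k)"]) (auto simp: bit_def)
qed

text \<open>
  Schoenberg's curve: if \<open>t\<close> has the ternary digits \<open>2 c\<^sub>0, 2 c\<^sub>1, \<dots>\<close> with \<open>c\<^sub>k\<close> in \<open>{0, 1}\<close>, then
  \<open>3\<^sup>k t\<close> lies modulo 2 in the first or last third of the unit interval, so that
  \<open>plateau (3\<^sup>k t) = c\<^sub>k\<close>.
\<close>

definition plateau :: "real \<Rightarrow> real" where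
  "plateau t = max 0 (min 1 (1 / 2 - cos (pi * t)))"

lemma plateau_bounds: "0 \<le> plateau t" "plateau t \<le> 1"
  by (auto simp: plateau_def)

lemma continuous_on_plateau: "continuous_on UNIV plateau"
  unfolding plateau_def by (intro continuous_intros)

lemma plateau_periodic: "plateau (2 * of_int m + t) = plateau t"
proof -
  have "cos (pi * (2 * of_int m + t)) = cos ((2 * pi) * of_int m + pi * t)"
    by (simp add: algebra_simps)
  also have "\<dots> = cos (pi * t)" by (simp only: cos_add cos_int_2pin sin_int_2pin mult_1 mult_zero_left diff_zero)
  finally show ?thesis by (simp add: plateau_def)
qed

text \<open>On the first third of [0, 1] the cosine of \<open>pi * t\<close> is at least 1/2 and on
  the last third at most -1/2, so the clamping in \<open>plateau\<close> returns exactly 0 or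
  1.\<close>

lemma plateau_digit:
  assumes "c \<in> {0, 1}" "2 * c / 3 \<le> t" "t \<le> (2 * c + 1) / 3"
  shows "plateau t = c"
proof (cases "c = 0")
  case True
  have "cos (pi / 3) \<le> cos (pi * t)"
    using True assms by (intro cos_monotone_0_pi_le) (auto simp: field_simps)
  then show ?thesis using True by (simp add: plateau_def cos_60)
next
  case False
  then have "c = 1" using assms by simp
  have "cos (pi * t) \<le> cos (2 * pi / 3)"
    using \<open>c = 1\<close> assms by (intro cos_monotone_0_pi_le) (auto simp: field_simps)
  moreover have "cos (2 * pi / 3) = - (1 / 2)" using cos_120 by simp
  ultimately show ?thesis using \<open>c = 1\<close> by (simp add: plateau_def)
qed

lemma plateau_ternary:
  assumes c: "\<And>k. c k \<in> {0, 1 :: real}"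
  obtains t where "0 \<le> t" "t \<le> 1" "\<And>k. plateau (3 ^ k * t) = c k"
proof -
  have c01: "0 \<le> c k" "c k \<le> 1" for k using c[of k] by auto
  have g: "(\<lambda>j. 2 / 3 ^ Suc j :: real) sums 1"
    using sums_mult[OF geometric_sums[of "1 / 3 :: real"], of "2 / 3"] by (simp add: power_divide)
  have le: "2 * c (k + j) / 3 ^ Suc j \<le> 2 / 3 ^ Suc j" for k j
    using c01[of "k + j"] by (intro divide_right_mono) auto
  have summ: "summable (\<lambda>j. 2 * c (k + j) / 3 ^ Suc j)" for k
    by (rule summable_comparison_test'[OF sums_summable[OF g], of 0]) (use le c01 in auto)
  \<comment> \<open>\<open>T k\<close> is the number left after deleting the first \<open>k\<close>
    ternary digits. Multiplication by 3 shifts the digits and splits off the even integer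
    \<open>2 * c k\<close>, which the period 2 of \<open>plateau\<close> absorbs.\<close>
  define T where "T = (\<lambda>k. \<Sum>j. 2 * c (k + j) / 3 ^ Suc j)"
  have T0: "0 \<le> T k" for k
    unfolding T_def by (intro suminf_nonneg summ) (use c01 in auto)
  have T1: "T k \<le> 1" for k
    unfolding T_def using suminf_le[OF le summ sums_summable[OF g]] sums_unique[OF g] by simp
  have rec: "3 * T k = 2 * c k + T (Suc k)" for k
  proof -
    have "T k = 2 * c k / 3 + (\<Sum>j. 2 * c (k + Suc j) / 3 ^ Suc (Suc j))"
      unfolding T_def using suminf_split_head[OF summ[of k]] by simp
    also have "(\<Sum>j. 2 * c (k + Suc j) / 3 ^ Suc (Suc j)) = (\<Sum>j. (2 * c (Suc k + j) / 3 ^ Suc j) / 3)"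
      by simp
    also have "\<dots> = T (Suc k) / 3"
      unfolding T_def by (rule suminf_divide[OF summ])
    finally show ?thesis by simp
  qed
  have "\<exists>m::int. 3 ^ k * T 0 = 2 * of_int m + T k" for k
  proof (induction k)
    case 0
    show ?case by (intro exI[of _ 0]) simp
  next
    case (Suc k)
    then obtain m :: int where m: "3 ^ k * T 0 = 2 * of_int m + T k" by blast
    have "c k = of_int (if c k = 0 then 0 else 1)" using c[of k] by auto
    then obtain d :: int where d: "c k = of_int d" by blast
    have "3 ^ Suc k * T 0 = 2 * of_int (3 * m + d) + T (Suc k)"
      using m rec[of k] d by (simp add: algebra_simps)
    then show ?case by blast
  qed
  then have "plateau (3 ^ k * T 0) = plateau (T k)" for k
    by (metis plateau_periodic)
  moreover have "plateau (T k) = c k" for k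
    using rec[of k] T0[of "Suc k"] T1[of "Suc k"] by (intro plateau_digit c) auto
  ultimately show ?thesis by (intro that[of "T 0"] T0 T1) auto
qed

lemma continuous_on_plateau_series:
  "continuous_on UNIV (\<lambda>t. \<Sum>k. plateau (f k * t) / 2 ^ Suc k)"
proof (rule uniform_limit_theorem)
  have "(\<lambda>k. 1 / 2 ^ Suc k :: real) sums 1" using power_half_series by (simp add: power_divide)
  then have "summable (\<lambda>k. 1 / 2 ^ Suc k :: real)" by (rule sums_summable)
  then show "uniform_limit UNIV (\<lambda>n t. \<Sum>k<n. plateau (f k * t) / 2 ^ Suc k)
      (\<lambda>t. \<Sum>k. plateau (f k * t) / 2 ^ Suc k) sequentially"
    by (rule Weierstrass_m_test[rotated])
       (use plateau_bounds in \<open>auto intro!: divide_right_mono\<close>)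
  show "\<forall>\<^sub>F n in sequentially. continuous_on UNIV (\<lambda>t. \<Sum>k<n. plateau (f k * t) / 2 ^ Suc k)"
    by (intro always_eventually allI continuous_intros
        continuous_on_compose2[OF continuous_on_plateau]) auto
qed simp

text \<open>The ternary digits of \<open>t\<close> at even places encode the binary digits of the
  real part, those at odd places the binary digits of the imaginary part.\<close>

lemma space_filling_curve:
  obtains \<psi> :: "real \<Rightarrow> complex"
  where "continuous_on UNIV \<psi>" "\<And>z. Re z \<in> {0..1} \<Longrightarrow> Im z \<in> {0..1} \<Longrightarrow> z \<in> \<psi> ` {0..1}"
proof -
  define X where "X = (\<lambda>t. \<Sum>k. plateau (3 ^ (2 * k) * t) / 2 ^ Suc k)"
  define Y where "Y = (\<lambda>t. \<Sum>k. plateau (3 ^ (2 * k + 1) * t) / 2 ^ Suc k)"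
  have "continuous_on UNIV (\<lambda>t. Complex (X t) (Y t))"
    unfolding X_def Y_def by (intro continuous_intros continuous_on_plateau_series)
  moreover have "z \<in> (\<lambda>t. Complex (X t) (Y t)) ` {0..1}"
    if z: "Re z \<in> {0..1}" "Im z \<in> {0..1}" for z
  proof -
    obtain a where a: "\<And>k. a k \<in> {0, 1}" "(\<lambda>k. a k / 2 ^ Suc k) sums Re z"
      using binary_expansion[of "Re z"] z by auto
    obtain b where b: "\<And>k. b k \<in> {0, 1}" "(\<lambda>k. b k / 2 ^ Suc k) sums Im z"
      using binary_expansion[of "Im z"] z by auto
    obtain t where t: "0 \<le> t" "t \<le> 1"
      "\<And>k. plateau (3 ^ k * t) = (if even k then a (k div 2) else b (k div 2))"
      by (rule plateau_ternary[of "\<lambda>k. if even k then a (k div 2) else b (k div 2)"])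
         (use a(1) b(1) in auto)
    have "X t = Re z" "Y t = Im z"
      unfolding X_def Y_def t(3) using a(2) b(2) by (simp_all add: sums_unique[symmetric])
    then have "z = Complex (X t) (Y t)" by (simp add: complex_eq_iff)
    then show ?thesis using t(1,2) by auto
  qed
  ultimately show ?thesis by (rule that)
qed

text \<open>The curve is made constant on either side of [0, 1], so that kernels pulled back along
  it inherit uniform estimates on the whole line from the compact unit square.\<close>

lemma bounded_subset_continuous_image_interval:
  fixes F :: "complex set"
  assumes "bounded F"
  obtains \<psi> :: "real \<Rightarrow> complex"
  where "continuous_on UNIV \<psi>" "F \<subseteq> \<psi> ` {0..1}" "\<And>s. \<psi> s = \<psi> (max 0 (min 1 s))"
proof -
  obtain \<psi> :: "real \<Rightarrow> complex" where \<psi>: "continuous_on UNIV \<psi>"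
      "\<And>z. Re z \<in> {0..1} \<Longrightarrow> Im z \<in> {0..1} \<Longrightarrow> z \<in> \<psi> ` {0..1}"
    using space_filling_curve by blast
  obtain R where R: "R > 0" "\<And>z. z \<in> F \<Longrightarrow> cmod z \<le> R"
    using assms by (auto simp: bounded_pos)
  define \<phi> where "\<phi> = (\<lambda>s. of_real (2 * R) * \<psi> (max 0 (min 1 s)) - Complex R R)"
  have "continuous_on UNIV \<phi>"
    unfolding \<phi>_def by (intro continuous_intros continuous_on_compose2[OF \<psi>(1)]) auto
  moreover have "F \<subseteq> \<phi> ` {0..1}"
  proof
    fix z assume "z \<in> F"
    then have "\<bar>Re z\<bar> \<le> R" "\<bar>Im z\<bar> \<le> R"
      using R(2) abs_Re_le_cmod[of z] abs_Im_le_cmod[of z] by force+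
    define w where "w = (z + Complex R R) / of_real (2 * R)"
    have "Re w \<in> {0..1}" "Im w \<in> {0..1}"
      using \<open>\<bar>Re z\<bar> \<le> R\<close> \<open>\<bar>Im z\<bar> \<le> R\<close> R(1)
      by (auto simp: w_def Re_divide_of_real Im_divide_of_real field_simps simp del: of_real_mult)
    from \<psi>(2)[OF this] obtain s where s: "s \<in> {0..1}" "w = \<psi> s" by blast
    have "\<phi> s = of_real (2 * R) * w - Complex R R" using s by (simp add: \<phi>_def)
    also have "\<dots> = z" using R(1) by (simp add: w_def)
    finally show "z \<in> \<phi> ` {0..1}" using s(1) by blast
  qed
  moreover have "\<phi> s = \<phi> (max 0 (min 1 s))" for s
    unfolding \<phi>_def by (intro arg_cong2[of _ _ _ _ "(-)"] arg_cong[of _ _ "\<lambda>x. _ * \<psi> x"]) auto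
  ultimately show ?thesis by (rule that)
qed

subsection \<open>Weak limits of empirical measures\<close>

text \<open>The index \<open>n\<close> stands for \<open>n + 1\<close> atoms, hence the denominators
  \<open>real n + 1\<close> below.\<close>

definition empirical :: "(nat \<Rightarrow> real) \<Rightarrow> nat \<Rightarrow> real measure" where
  "empirical t n = distr (uniform_count_measure {..n}) borel t"

lemma real_distribution_empirical: "real_distribution (empirical t n)"
proof -
  interpret prob_space "uniform_count_measure {..n}"
    by (rule prob_space_uniform_count_measure) auto
  show ?thesis
    unfolding empirical_def
    by (rule real_distribution_distr) (simp add: uniform_count_measure_def)
qed

lemma integral_empirical:
  fixes f :: "real \<Rightarrow> real"
  assumes "f \<in> borel_measurable borel"
  shows "integral\<^sup>L (empirical t n) f = (\<Sum>i\<le>n. f (t i)) / (real n + 1)"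
  unfolding empirical_def
  by (subst integral_distr) (use assms in \<open>simp_all add: integral_uniform_count_measure add.commute\<close>)

lemma tight_empirical:
  assumes "\<And>i. t i \<in> {0..1}"
  shows "tight (empirical t)"
  unfolding tight_def
proof (intro conjI allI impI)
  show "real_distribution (empirical t n)" for n by (rule real_distribution_empirical)
  fix e :: real assume "e > 0"
  have "measure (empirical t n) {-1<..1} = 1" for n
  proof -
    interpret real_distribution "empirical t n" by (rule real_distribution_empirical)
    have "measure (empirical t n) {-1<..1} = integral\<^sup>L (empirical t n) (indicator {-1<..1})" by simp
    also have "\<dots> = (\<Sum>i\<le>n. indicator {-1<..1} (t i)) / (real n + 1)"
      by (rule integral_empirical) simp
    also have "(\<Sum>i\<le>n. indicator {-1<..1} (t i)) = (\<Sum>i\<le>n. 1 :: real)"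
    proof (rule sum.cong)
      fix i show "indicator {-1<..1} (t i) = (1::real)"
        using assms[of i] by (auto simp: indicator_def)
    qed simp
    also have "\<dots> / (real n + 1) = 1" by simp
    finally show ?thesis .
  qed
  then show "\<exists>a b. a < b \<and> (\<forall>n. 1 - e < measure (empirical t n) {a<..b})"
    using \<open>e > 0\<close> by (intro exI[of _ "-1"] exI[of _ 1]) auto
qed

lemma integral_bounded:
  fixes f :: "'a \<Rightarrow> real"
  assumes "prob_space M" "f \<in> borel_measurable M" "\<And>x. \<bar>f x\<bar> \<le> B"
  shows "integrable M f" "\<bar>integral\<^sup>L M f\<bar> \<le> B"
proof -
  interpret prob_space M by fact
  show i: "integrable M f"
    by (rule integrable_const_bound[of _ B]) (use assms in auto)
  have "integral\<^sup>L M f \<le> B" by (rule integral_le_const[OF i]) (use assms(3) in \<open>auto simp: abs_le_iff\<close>)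
  moreover have "-B \<le> integral\<^sup>L M f"
    by (rule integral_ge_const[OF i]) (use assms(3) in \<open>auto simp: abs_le_iff minus_le_iff\<close>)
  ultimately show "\<bar>integral\<^sup>L M f\<bar> \<le> B" by auto
qed

text \<open>
  Equicontinuity of the sections \<open>k s\<close> makes the potentials of the empirical measures converge
  uniformly on \<open>[0, 1]\<close>, so that weak convergence passes to the double integrals.
\<close>

lemma empirical_energy_limit:
  fixes k :: "real \<Rightarrow> real \<Rightarrow> real"
  assumes t: "\<And>i. t i \<in> {0..1}" and M: "real_distribution M"
    and lim: "\<And>f :: real \<Rightarrow> real. continuous_on UNIV f \<Longrightarrow> (\<exists>B. \<forall>x. \<bar>f x\<bar> \<le> B) \<Longrightarrow>
       (\<lambda>n. integral\<^sup>L (empirical t (r n)) f) \<longlonglongrightarrow> integral\<^sup>L M f"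
    and bd: "\<And>s s'. \<bar>k s s'\<bar> \<le> B"
    and cont: "\<And>s. continuous_on UNIV (k s)"
    and equi: "\<And>e. e > 0 \<Longrightarrow> \<exists>d>0. \<forall>s s' u. \<bar>s - s'\<bar> < d \<longrightarrow> \<bar>k s u - k s' u\<bar> < e"
  shows "(\<lambda>n. (\<Sum>i\<le>r n. \<Sum>j\<le>r n. k (t i) (t j)) / (real (r n) + 1)\<^sup>2)
    \<longlonglongrightarrow> (\<integral>s. (\<integral>u. k s u \<partial>M) \<partial>M)"
proof -
  interpret M: real_distribution M by fact
  have meas: "k s \<in> borel_measurable borel" for s
    by (rule borel_measurable_continuous_onI[OF cont])
  have int: "integrable M' (k s)" "\<bar>integral\<^sup>L M' (k s)\<bar> \<le> B" if "real_distribution M'" for s M'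
  proof -
    interpret M': real_distribution M' by fact
    show "integrable M' (k s)" "\<bar>integral\<^sup>L M' (k s)\<bar> \<le> B"
      by (rule integral_bounded[OF M'.prob_space_axioms _ bd], use meas in simp)+
  qed
  define H where "H = (\<lambda>s. \<integral>u. k s u \<partial>M)"
  define Hn where "Hn = (\<lambda>n s. \<integral>u. k s u \<partial>empirical t (r n))"
  have diff: "\<bar>(\<integral>u. k s u \<partial>M') - (\<integral>u. k s' u \<partial>M')\<bar> \<le> e"
    if "real_distribution M'" "\<And>u. \<bar>k s u - k s' u\<bar> < e" for M' s s' e
  proof -
    interpret M': real_distribution M' by fact
    have "\<bar>\<integral>u. k s u - k s' u \<partial>M'\<bar> \<le> e"
      by (rule integral_bounded(2)[OF M'.prob_space_axioms])
         (use that(2) meas in \<open>auto intro: less_imp_le\<close>)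
    then show ?thesis using int(1)[OF that(1)] by simp
  qed
  have contH: "continuous_on UNIV H"
    unfolding continuous_on_iff
  proof (intro ballI allI impI)
    fix s :: real and e :: real assume "e > 0"
    then obtain d where d: "d > 0" "\<And>s s' u. \<bar>s - s'\<bar> < d \<Longrightarrow> \<bar>k s u - k s' u\<bar> < e / 2"
      using equi[of "e / 2"] by auto
    have "dist (H s') (H s) < e" if "dist s' s < d" for s'
      using diff[OF M d(2)[of s' s]] that \<open>e > 0\<close> by (simp add: H_def dist_real_def)
    then show "\<exists>d>0. \<forall>s'\<in>UNIV. dist s' s < d \<longrightarrow> dist (H s') (H s) < e" using d(1) by blast
  qed
  have H_lim: "(\<lambda>n. integral\<^sup>L (empirical t (r n)) H) \<longlonglongrightarrow> integral\<^sup>L M H"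
    by (rule lim[OF contH]) (use int(2)[OF M] in \<open>auto simp: H_def\<close>)
  \<comment> \<open>Pointwise convergence on a finite grid of mesh \<open>1 / N\<close> is enough.
    Three errors of size \<open>e\<close> add up: moving to the grid point in \<open>Hn\<close>,
    convergence there, and moving back in \<open>H\<close>.\<close>
  have unif: "\<exists>n0. \<forall>n\<ge>n0. \<forall>s\<in>{0..1}. \<bar>Hn n s - H s\<bar> \<le> 3 * e" if "e > 0" for e
  proof -
    obtain d where d: "d > 0" "\<And>s s' u. \<bar>s - s'\<bar> < d \<Longrightarrow> \<bar>k s u - k s' u\<bar> < e"
      using equi[OF \<open>e > 0\<close>] by auto
    obtain N :: nat where N: "N > 0" "1 / real N < d"
      using reals_Archimedean[OF d(1)] by (metis inverse_eq_divide zero_less_Suc)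
    have "eventually (\<lambda>n. \<forall>a\<in>{..N}. \<bar>Hn n (a / N) - H (a / N)\<bar> < e) sequentially"
    proof (intro eventually_ball_finite ballI)
      fix a
      have "(\<lambda>n. Hn n (a / N)) \<longlonglongrightarrow> H (a / N)"
        unfolding Hn_def H_def by (rule lim[OF cont]) (use bd in blast)
      from tendstoD[OF this \<open>e > 0\<close>]
      show "eventually (\<lambda>n. \<bar>Hn n (a / N) - H (a / N)\<bar> < e) sequentially"
        by (simp add: dist_real_def)
    qed simp
    then obtain n0 where n0: "\<And>n a. n \<ge> n0 \<Longrightarrow> a \<le> N \<Longrightarrow> \<bar>Hn n (a / N) - H (a / N)\<bar> < e"
      by (auto simp: eventually_sequentially)
    have "\<bar>Hn n s - H s\<bar> \<le> 3 * e" if n: "n \<ge> n0" and s: "s \<in> {0..1}" for n s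
    proof -
      define a where "a = nat \<lfloor>s * N\<rfloor>"
      have a: "real a \<le> s * N" "s * N < real a + 1" using s by (auto simp: a_def)
      have "s * N \<le> 1 * real N" using s by (intro mult_right_mono) auto
      then have "a \<le> N" using a(1) by simp
      have "s - a / N = (s * N - a) / N" using N by (simp add: field_simps)
      moreover have "0 \<le> (s * N - a) / N" "(s * N - a) / N \<le> 1 / N"
        using a by (intro divide_nonneg_nonneg divide_right_mono; simp)+
      ultimately have "\<bar>s - a / N\<bar> \<le> 1 / N" by simp
      then have k: "\<bar>k s u - k (a / N) u\<bar> < e" for u using d(2) N by auto
      have "\<bar>H s - H (a / N)\<bar> \<le> e" unfolding H_def by (rule diff[OF M k])
      moreover have "\<bar>Hn n s - Hn n (a / N)\<bar> \<le> e"
        unfolding Hn_def by (rule diff[OF real_distribution_empirical k])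
      moreover have "\<bar>Hn n (a / N) - H (a / N)\<bar> < e" by (rule n0[OF n \<open>a \<le> N\<close>])
      ultimately show ?thesis by linarith
    qed
    then show ?thesis by blast
  qed
  define S where "S = (\<lambda>n. (\<Sum>i\<le>r n. \<Sum>j\<le>r n. k (t i) (t j)) / (real (r n) + 1)\<^sup>2)"
  have S_eq: "S n = (\<Sum>i\<le>r n. Hn n (t i)) / (real (r n) + 1)" for n
    unfolding S_def Hn_def integral_empirical[OF meas]
    by (simp add: power2_eq_square flip: sum_divide_distrib)
  have H_eq: "integral\<^sup>L (empirical t (r n)) H = (\<Sum>i\<le>r n. H (t i)) / (real (r n) + 1)" for n
    by (rule integral_empirical[OF borel_measurable_continuous_onI[OF contH]])
  have "(\<lambda>n. S n - integral\<^sup>L (empirical t (r n)) H) \<longlonglongrightarrow> 0"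
  proof (rule LIMSEQ_I)
    fix e :: real assume "e > 0"
    then have "e / 4 > 0" by simp
    from unif[OF this] obtain n0
      where n0: "\<And>n s. n \<ge> n0 \<Longrightarrow> s \<in> {0..1} \<Longrightarrow> \<bar>Hn n s - H s\<bar> \<le> 3 * (e / 4)"
      by blast
    have "norm (S n - integral\<^sup>L (empirical t (r n)) H - 0) < e" if "n \<ge> n0" for n
    proof -
      have "\<bar>\<Sum>i\<le>r n. Hn n (t i) - H (t i)\<bar> \<le> (\<Sum>i\<le>r n. 3 * (e / 4))"
        by (rule order_trans[OF sum_abs sum_mono]) (rule n0[OF that t])
      then have "\<bar>S n - integral\<^sup>L (empirical t (r n)) H\<bar> \<le> 3 * (e / 4)"
        by (simp add: S_eq H_eq sum_subtractf field_simps flip: diff_divide_distrib)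
      then show ?thesis using \<open>e > 0\<close> by simp
    qed
    then show "\<exists>n0. \<forall>n\<ge>n0. norm (S n - integral\<^sup>L (empirical t (r n)) H - 0) < e" by blast
  qed
  from tendsto_add[OF this H_lim] show ?thesis by (simp add: S_def H_def)
qed

subsection \<open>Sets of capacity zero\<close>

text \<open>The cut at \<open>exp (- L)\<close> removes the singularity on the diagonal and the cut
  at \<open>D\<close> bounds the kernel on the whole plane, so that weak convergence applies. For
  points at distance at most \<open>D\<close> the value is never below the true logarithm.\<close>

definition trunc_log :: "real \<Rightarrow> real \<Rightarrow> complex \<Rightarrow> complex \<Rightarrow> real" where
  "trunc_log D L z w = ln (max (min (dist z w) D) (exp (- L)))"

lemma trunc_log_bounds:
  assumes "1 \<le> D" "0 \<le> L"
  shows "- L \<le> trunc_log D L z w" "trunc_log D L z w \<le> ln D"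
proof -
  show "- L \<le> trunc_log D L z w" unfolding trunc_log_def by (subst ln_ge_iff) (auto simp: less_max_iff_disj)
  have "exp (- L) \<le> 1" using assms by simp
  then have "exp (- L) \<le> D" using assms(1) by (rule order_trans)
  then have "max (min (dist z w) D) (exp (- L)) \<le> D" by simp
  then show "trunc_log D L z w \<le> ln D"
    unfolding trunc_log_def by (intro ln_mono) (auto simp: less_max_iff_disj)
qed

lemma continuous_on_trunc_log:
  assumes "continuous_on S f" "continuous_on S g"
  shows "continuous_on S (\<lambda>x. trunc_log D L (f x) (g x))"
  unfolding trunc_log_def
proof (intro continuous_intros assms ballI)
  fix x
  have "0 < max (min (dist (f x) (g x)) D) (exp (- L))" by (simp add: less_max_iff_disj)
  then show "max (min (dist (f x) (g x)) D) (exp (- L)) \<noteq> 0" by linarith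
qed

lemma trunc_log_diag [simp]:
  assumes "0 \<le> D" shows "trunc_log D L z z = - L"
  using assms by (simp add: trunc_log_def max_def)

lemma trunc_log_ge:
  assumes "z \<noteq> w" "dist z w \<le> D"
  shows "ln (dist z w) \<le> trunc_log D L z w"
  unfolding trunc_log_def using assms by (subst ln_le_cancel_iff) (auto simp: less_max_iff_disj)

text \<open>After the shift by \<open>ln D\<close> the truncations are nonnegative and increase with
  \<open>n\<close>, which prepares monotone convergence; on the diagonal their supremum is
  infinite.\<close>

lemma neg_log_dist_le_SUP:
  assumes "1 \<le> D"
  shows "e2ennreal (- log_dist z w) \<le> (SUP n. ennreal (ln D - trunc_log D (real n) z w))"
proof (cases "z = w")
  case True
  have "of_nat n \<le> (SUP n. ennreal (ln D - trunc_log D (real n) z w))" for n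
    by (rule SUP_upper2[of n]) (use True assms in \<open>auto simp: ennreal_of_nat_eq_real_of_nat intro!: ennreal_leI\<close>)
  then have "(SUP n. of_nat n) \<le> (SUP n. ennreal (ln D - trunc_log D (real n) z w))"
    by (intro SUP_least)
  then have "(SUP n. ennreal (ln D - trunc_log D (real n) z w)) = top"
    unfolding ennreal_SUP_of_nat_eq_top by (rule top.extremum_uniqueI)
  then show ?thesis by (simp only: top_greatest)
next
  case False
  obtain n :: nat where n: "- ln (dist z w) \<le> real n" using real_arch_simple by blast
  have "exp (- real n) \<le> exp (ln (dist z w))" using n by simp
  then have le: "exp (- real n) \<le> dist z w" using False by simp
  have "- ln (dist z w) \<le> ln D - trunc_log D (real n) z w"
  proof (cases "dist z w \<le> D")
    case True
    then have "trunc_log D (real n) z w = ln (dist z w)" using le by (simp add: trunc_log_def max_def)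
    then show ?thesis using assms by simp
  next
    case False
    then have "ln D \<le> ln (dist z w)" using assms by (intro ln_mono) auto
    moreover have "trunc_log D (real n) z w \<le> ln D" by (rule trunc_log_bounds) (use assms in auto)
    moreover have "0 \<le> ln D" using assms by simp
    ultimately show ?thesis using assms by linarith
  qed
  then have "e2ennreal (- log_dist z w) \<le> ennreal (ln D - trunc_log D (real n) z w)"
    using False by (simp add: log_dist_def ennreal_leI)
  also have "\<dots> \<le> (SUP n. ennreal (ln D - trunc_log D (real n) z w))" by (rule SUP_upper) simp
  finally show ?thesis .
qed

lemma trunc_log_antimono: "L \<le> L' \<Longrightarrow> trunc_log D L' z w \<le> trunc_log D L z w"
  unfolding trunc_log_def 
  by (intro ln_mono max.mono order_refl) (simp_all add: less_max_iff_disj)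

lemma exp_ereal_pos:
  assumes "x \<noteq> - \<infinity>" shows "0 < exp_ereal x"
  using assms by (cases x) (auto simp: exp_ereal_def)

text \<open>By monotone convergence in the truncation level, the integral of the negative part of
  the logarithm is at most \<open>ln D + M\<close>. A finite subtrahend keeps the energy away from
  minus infinity.\<close>

lemma log_energy_bounded_below:
  assumes \<mu>: "prob_space \<mu>" "sets \<mu> = sets borel" and D: "1 \<le> D"
    and le: "\<And>n::nat. - M \<le> (\<integral>z. (\<integral>w. trunc_log D (real n) z w \<partial>\<mu>) \<partial>\<mu>)"
  shows "log_energy \<mu> \<noteq> - \<infinity>"
proof -
  interpret prob_space \<mu> by fact
  note [measurable_cong] = \<mu>(2)
  define \<phi> where "\<phi> = (\<lambda>n::nat. \<lambda>z w. ennreal (ln D - trunc_log D (real n) z w))"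
  have meas_pair: "(\<lambda>(z, w). trunc_log D (real n) z w) \<in> borel_measurable (borel \<Otimes>\<^sub>M borel)" for n
  proof -
    have "continuous_on UNIV (\<lambda>p. trunc_log D (real n) (fst p) (snd p))"
      by (intro continuous_on_trunc_log continuous_intros)
    then show ?thesis
      by (simp add: borel_prod borel_measurable_continuous_onI case_prod_unfold)
  qed
  have sets_pair: "sets (\<mu> \<Otimes>\<^sub>M \<mu>) = sets (borel \<Otimes>\<^sub>M borel)"
    by (rule sets_pair_measure_cong) (use \<mu> in auto)
  have meas_pair': "(\<lambda>(z, w). trunc_log D (real n) z w) \<in> borel_measurable (\<mu> \<Otimes>\<^sub>M \<mu>)" for n
    using meas_pair sets_pair by (simp cong: measurable_cong_sets)
  have meas1: "trunc_log D (real n) z \<in> borel_measurable \<mu>" for n z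
    using measurable_Pair2[OF meas_pair'[of n], of z] sets_eq_imp_space_eq[OF \<mu>(2)] by simp
  have meas\<phi>: "\<phi> n z \<in> borel_measurable \<mu>" for n z
    unfolding \<phi>_def using meas1[of n z] by measurable
  have meas\<phi>2: "(\<lambda>z. \<integral>\<^sup>+w. \<phi> n z w \<partial>\<mu>) \<in> borel_measurable \<mu>" for n
  proof (rule borel_measurable_nn_integral)
    show "(\<lambda>(z, w). \<phi> n z w) \<in> borel_measurable (\<mu> \<Otimes>\<^sub>M \<mu>)"
      using meas_pair'[of n] unfolding \<phi>_def case_prod_unfold by measurable
  qed
  have inc: "incseq (\<lambda>n. \<phi> n z)" for z
    unfolding \<phi>_def by (auto simp: incseq_def le_fun_def intro!: ennreal_leI diff_left_mono trunc_log_antimono)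
  have incI: "incseq (\<lambda>n z. \<integral>\<^sup>+w. \<phi> n z w \<partial>\<mu>)"
    using inc by (auto simp: incseq_def le_fun_def intro!: nn_integral_mono)
  have bd: "\<bar>trunc_log D (real n) z w\<bar> \<le> real n + ln D" for n z w
    using trunc_log_bounds[OF D, of "real n" z w] ln_ge_zero[OF D] by linarith
  have single: "(\<integral>\<^sup>+z. (\<integral>\<^sup>+w. \<phi> n z w \<partial>\<mu>) \<partial>\<mu>) \<le> ennreal (ln D + M)" for n
  proof -
    define h where "h = (\<lambda>z. \<integral>w. trunc_log D (real n) z w \<partial>\<mu>)"
    have i1: "integrable \<mu> (trunc_log D (real n) z)" for z
      by (rule integral_bounded(1)[OF prob_space_axioms meas1 bd])
    have inner: "(\<integral>\<^sup>+w. \<phi> n z w \<partial>\<mu>) = ennreal (ln D - h z)" for z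
    proof -
      have "(\<integral>\<^sup>+w. \<phi> n z w \<partial>\<mu>) = ennreal (\<integral>w. ln D - trunc_log D (real n) z w \<partial>\<mu>)"
        unfolding \<phi>_def by (rule nn_integral_eq_integral)
          (use i1 trunc_log_bounds[OF D, of "real n"] in auto)
      then show ?thesis using i1 by (simp add: h_def prob_space)
    qed
    have h_le: "h z \<le> ln D" for z
      unfolding h_def by (rule integral_le_const[OF i1]) (use trunc_log_bounds[OF D, of "real n"] in auto)
    have h_meas: "h \<in> borel_measurable \<mu>"
      unfolding h_def by (rule borel_measurable_lebesgue_integral[OF meas_pair'])
    have "\<bar>h z\<bar> \<le> real n + ln D" for z
      unfolding h_def by (rule integral_bounded(2)[OF prob_space_axioms meas1 bd])
    then have ih: "integrable \<mu> h" by (rule integral_bounded(1)[OF prob_space_axioms h_meas])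
    have "(\<integral>\<^sup>+z. (\<integral>\<^sup>+w. \<phi> n z w \<partial>\<mu>) \<partial>\<mu>) = ennreal (\<integral>z. ln D - h z \<partial>\<mu>)"
      unfolding inner by (rule nn_integral_eq_integral) (use ih h_le in auto)
    also have "(\<integral>z. ln D - h z \<partial>\<mu>) = ln D - integral\<^sup>L \<mu> h" using ih by (simp add: prob_space)
    also have "ennreal \<dots> \<le> ennreal (ln D + M)"
      by (rule ennreal_leI) (use le[of n] in \<open>simp add: h_def\<close>)
    finally show ?thesis .
  qed
  have "(\<integral>\<^sup>+z. (\<integral>\<^sup>+w. e2ennreal (- log_dist z w) \<partial>\<mu>) \<partial>\<mu>) \<le> (\<integral>\<^sup>+z. (\<integral>\<^sup>+w. (SUP n. \<phi> n z w) \<partial>\<mu>) \<partial>\<mu>)"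
    unfolding \<phi>_def by (intro nn_integral_mono neg_log_dist_le_SUP D)
  also have "\<dots> = (\<integral>\<^sup>+z. (SUP n. \<integral>\<^sup>+w. \<phi> n z w \<partial>\<mu>) \<partial>\<mu>)"
    by (simp only: nn_integral_monotone_convergence_SUP[OF inc meas\<phi>])
  also have "\<dots> = (SUP n. \<integral>\<^sup>+z. (\<integral>\<^sup>+w. \<phi> n z w \<partial>\<mu>) \<partial>\<mu>)"
    by (rule nn_integral_monotone_convergence_SUP[OF incI meas\<phi>2])
  also have "\<dots> \<le> ennreal (ln D + M)" by (intro SUP_least single)
  finally have le_c: "(\<integral>\<^sup>+z. (\<integral>\<^sup>+w. e2ennreal (- log_dist z w) \<partial>\<mu>) \<partial>\<mu>) \<le> ennreal (ln D + M)" .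
  define I where "I = (\<integral>\<^sup>+z. (\<integral>\<^sup>+w. e2ennreal (- log_dist z w) \<partial>\<mu>) \<partial>\<mu>)"
  have "I < top" using le_c le_less_trans[OF _ ennreal_less_top] unfolding I_def by blast
  then obtain x where x: "I = ennreal x" "0 \<le> x" by (cases I) auto
  have "P - ereal x \<noteq> - \<infinity>" if "0 \<le> P" for P
    using that by (cases P) auto
  then show ?thesis
    unfolding log_energy_def I_def[symmetric] x(1) using x(2) by (simp add: enn2ereal_ennreal)
qed

lemma log_capacity_mono: "E \<subseteq> F \<Longrightarrow> log_capacity E \<le> log_capacity F"
  unfolding log_capacity_def by (rule SUP_subset_mono) auto

lemma abs_clamp_diff_le:
  fixes s s' :: real
  shows "\<bar>max 0 (min 1 s) - max 0 (min 1 s')\<bar> \<le> \<bar>s - s'\<bar>"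
  by (auto simp: max_def min_def)

text \<open>Uniform continuity on the unit square carries over to all real parameters because
  clamping does not increase distances.\<close>

lemma clamped_kernel_equicontinuous:
  fixes k :: "real \<Rightarrow> real \<Rightarrow> real"
  assumes cont: "continuous_on UNIV (\<lambda>p. k (fst p) (snd p))"
    and clamp: "\<And>s u. k s u = k (max 0 (min 1 s)) (max 0 (min 1 u))" and "e > 0"
  shows "\<exists>d>0. \<forall>s s' u. \<bar>s - s'\<bar> < d \<longrightarrow> \<bar>k s u - k s' u\<bar> < e"
proof -
  have "uniformly_continuous_on ({0..1} \<times> {0..1}) (\<lambda>p. k (fst p) (snd p))"
    by (intro compact_uniformly_continuous compact_Times compact_Icc)
       (rule continuous_on_subset[OF cont], simp)
  then obtain d where d: "d > 0" "\<And>p q. p \<in> {0..1} \<times> {0..1} \<Longrightarrow> q \<in> {0..1} \<times> {0..1} \<Longrightarrow>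
      dist p q < d \<Longrightarrow> dist (k (fst p) (snd p)) (k (fst q) (snd q)) < e"
    unfolding uniformly_continuous_on_def using \<open>e > 0\<close> by (metis dist_commute)
  have "\<bar>k s u - k s' u\<bar> < e" if "\<bar>s - s'\<bar> < d" for s s' u
  proof -
    let ?c = "\<lambda>s. max 0 (min 1 s) :: real"
    have "dist (?c s, ?c u) (?c s', ?c u) < d"
      using that abs_clamp_diff_le[of s s'] by (simp add: dist_Pair_Pair dist_real_def)
    from d(2)[OF _ _ this] have "dist (k (?c s) (?c u)) (k (?c s') (?c u)) < e" by auto
    then show ?thesis unfolding clamp[of s u] clamp[of s' u] by (simp add: dist_real_def)
  qed
  then show ?thesis using d(1) by blast
qed

text \<open>The points are lifted to [0, 1] along the curve, a weak limit \<open>N\<close> of their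
  empirical measures is taken there, and its image under the curve is the desired measure. The
  bounds on the sums keep the truncated energies of the empirical measures above \<open>- M\<close>
  up to a vanishing diagonal term, so those of the limit are at least \<open>- M\<close> at every
  level \<open>L\<close>.\<close>

lemma log_capacity_pos:
  fixes z :: "nat \<Rightarrow> complex"
  assumes F: "compact F" and zF: "\<And>n. z n \<in> F" and M: "0 \<le> M"
    and dist: "\<And>i n. i < n \<Longrightarrow> z i \<noteq> z n"
    and sum: "\<And>n. - M * real n \<le> (\<Sum>i<n. ln (dist (z i) (z n)))"
  shows "0 < log_capacity F"
proof -
  obtain D0 where D0: "\<And>x y. x \<in> F \<Longrightarrow> y \<in> F \<Longrightarrow> dist x y \<le> D0"
    using compact_imp_bounded[OF F] diameter_bounded_bound by blast
  define D where "D = max 1 D0"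
  have D: "1 \<le> D" "\<And>x y. x \<in> F \<Longrightarrow> y \<in> F \<Longrightarrow> dist x y \<le> D" using D0 by (auto simp: D_def le_max_iff_disj)
  obtain \<psi> :: "real \<Rightarrow> complex" where \<psi>: "continuous_on UNIV \<psi>" "F \<subseteq> \<psi> ` {0..1}"
      "\<And>s. \<psi> s = \<psi> (max 0 (min 1 s))"
    using bounded_subset_continuous_image_interval[OF compact_imp_bounded[OF F]] by blast
  have "\<exists>s. s \<in> {0..1} \<and> \<psi> s = z n" for n
  proof -
    have "z n \<in> \<psi> ` {0..1}" using \<psi>(2) zF[of n] by (rule subsetD)
    then show ?thesis by (auto simp: image_iff)
  qed
  then obtain t where t: "\<And>n. t n \<in> {0..1}" "\<And>n. \<psi> (t n) = z n" by metis
  obtain r N where r: "strict_mono r" and N: "real_distribution N"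
      and conv: "weak_conv_m (empirical t \<circ> (\<lambda>x. x) \<circ> r) N"
    using tight_imp_convergent_subsubsequence[of "empirical t" "\<lambda>x. x"] tight_empirical[of t] t(1)
    by (auto simp: strict_mono_def simp del: comp_apply)
  interpret N: real_distribution N by fact
  have lim: "(\<lambda>n. integral\<^sup>L (empirical t (r n)) f) \<longlonglongrightarrow> integral\<^sup>L N f"
    if "continuous_on UNIV f" "\<exists>B. \<forall>x. \<bar>f x\<bar> \<le> B" for f :: "real \<Rightarrow> real"
  proof -
    from that(2) obtain B where "\<And>x. \<bar>f x\<bar> \<le> B" by blast
    then show ?thesis
      using weak_conv_imp_integral_bdd_continuous_conv[OF _ N conv, of f B] \<open>continuous_on UNIV f\<close>
      by (simp add: real_distribution_empirical continuous_on_eq_continuous_at)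
  qed
  have meas\<psi>: "\<psi> \<in> borel_measurable borel" by (rule borel_measurable_continuous_onI[OF \<psi>(1)])
  define k where "k = (\<lambda>L s u. trunc_log D L (\<psi> s) (\<psi> u))"
  have energy: "- M \<le> (\<integral>s. (\<integral>u. k L s u \<partial>N) \<partial>N)" if L: "0 \<le> L" for L
  proof (rule LIMSEQ_le)
    have contk: "continuous_on UNIV (\<lambda>p. k L (fst p) (snd p))"
      unfolding k_def
      by (intro continuous_on_trunc_log continuous_on_compose2[OF \<psi>(1)] continuous_intros) auto
    show "(\<lambda>n. (\<Sum>i\<le>r n. \<Sum>j\<le>r n. k L (t i) (t j)) / (real (r n) + 1)\<^sup>2)
        \<longlonglongrightarrow> (\<integral>s. (\<integral>u. k L s u \<partial>N) \<partial>N)"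
    proof (rule empirical_energy_limit[OF t(1) N lim])
      show "\<bar>k L s u\<bar> \<le> L + ln D" for s u
        using trunc_log_bounds[OF D(1) L, of "\<psi> s" "\<psi> u"] ln_ge_zero[OF D(1)] L
        unfolding k_def by linarith
      show "continuous_on UNIV (k L s)" for s
        unfolding k_def by (intro continuous_on_trunc_log \<psi>(1) continuous_intros)
      show "\<exists>d>0. \<forall>s s' u. \<bar>s - s'\<bar> < d \<longrightarrow> \<bar>k L s u - k L s' u\<bar> < e" if "e > 0" for e
        by (rule clamped_kernel_equicontinuous[OF contk _ that])
           (simp only: k_def \<psi>(3)[symmetric])
    qed
    have "(\<lambda>n. 1 / (real n + 1)) \<longlonglongrightarrow> 0"
      using LIMSEQ_inverse_real_of_nat by (simp add: inverse_eq_divide add.commute)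
    then have "(\<lambda>n. L * (1 / (real n + 1))) \<longlonglongrightarrow> L * 0" by (rule tendsto_mult_left)
    from LIMSEQ_subseq_LIMSEQ[OF this r]
    have "(\<lambda>n. - M - L * (1 / (real (r n) + 1))) \<longlonglongrightarrow> - M - L * 0"
      by (intro tendsto_diff tendsto_const) (simp only: o_def)
    then show "(\<lambda>n. - M - L / (real (r n) + 1)) \<longlonglongrightarrow> - M" by simp
    \<comment> \<open>By symmetry a new point contributes its row twice, and \<open>- L\<close> once
      on the diagonal. The \<open>n + 1\<close> diagonal terms become negligible after division by
      \<open>(real n + 1)\<^sup>2\<close>.\<close>
    have lower: "- M * (real n * (real n + 1)) - L * (real n + 1) \<le> (\<Sum>i\<le>n. \<Sum>j\<le>n. k L (t i) (t j))" for n
    proof (induction n)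
      case 0
      show ?case using D(1) by (simp add: k_def)
    next
      case (Suc n)
      have sym: "k L s u = k L u s" for s u by (simp add: k_def trunc_log_def dist_commute)
      have diag: "k L (t (Suc n)) (t (Suc n)) = - L" using D(1) by (simp add: k_def)
      have col: "(\<Sum>j\<le>n. k L (t (Suc n)) (t j)) = (\<Sum>i\<le>n. k L (t i) (t (Suc n)))"
        by (intro sum.cong refl sym)
      have "- M * real (Suc n) \<le> (\<Sum>i<Suc n. ln (dist (z i) (z (Suc n))))" by (rule sum)
      also have "\<dots> \<le> (\<Sum>i<Suc n. k L (t i) (t (Suc n)))"
        by (intro sum_mono) (use dist D(2) zF in \<open>auto simp: k_def t(2) intro!: trunc_log_ge\<close>)
      finally have row: "- M * real (Suc n) \<le> (\<Sum>i\<le>n. k L (t i) (t (Suc n)))"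
        by (simp add: lessThan_Suc_atMost)
      have "(\<Sum>i\<le>Suc n. \<Sum>j\<le>Suc n. k L (t i) (t j)) =
          (\<Sum>i\<le>n. \<Sum>j\<le>n. k L (t i) (t j)) + 2 * (\<Sum>i\<le>n. k L (t i) (t (Suc n))) - L"
        by (simp add: sum.distrib diag col)
      then show ?case using Suc row by (simp add: algebra_simps)
    qed
    have "- M - L / (real n + 1) \<le> (\<Sum>i\<le>n. \<Sum>j\<le>n. k L (t i) (t j)) / (real n + 1)\<^sup>2" for n
    proof -
      have "(- M - L / (real n + 1)) * (real n + 1)\<^sup>2 = - M * ((real n + 1) * (real n + 1)) - L * (real n + 1)"
        by (simp add: power2_eq_square field_simps)
      also have "\<dots> \<le> - M * (real n * (real n + 1)) - L * (real n + 1)"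
        using M by (intro diff_right_mono mult_left_mono_neg mult_right_mono) auto
      finally have "(- M - L / (real n + 1)) * (real n + 1)\<^sup>2 \<le> (\<Sum>i\<le>n. \<Sum>j\<le>n. k L (t i) (t j))"
        using lower[of n] by linarith
      then show ?thesis by (subst pos_le_divide_eq) auto
    qed
    then show "\<exists>n0. \<forall>n\<ge>n0. - M - L / (real (r n) + 1) \<le>
        (\<Sum>i\<le>r n. \<Sum>j\<le>r n. k L (t i) (t j)) / (real (r n) + 1)\<^sup>2" by blast
  qed
  define \<mu> where "\<mu> = distr N borel \<psi>"
  have \<mu>: "prob_space \<mu>" "sets \<mu> = sets borel"
    unfolding \<mu>_def using meas\<psi> by (auto intro!: N.prob_space_distr)
  have "emeasure \<mu> F = 1"
  proof -
    \<comment> \<open>The limit measure is carried by \<open>F\<close> because this bounded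
      continuous function vanishes at all the sample points, so its integral against
      \<open>N\<close> is 0.\<close>
    define f where "f = (\<lambda>s. min 1 (infdist (\<psi> s) F))"
    have cf: "continuous_on UNIV f" unfolding f_def by (intro continuous_intros \<psi>(1))
    have f01: "0 \<le> f s" "f s \<le> 1" for s by (auto simp: f_def infdist_nonneg)
    have "integral\<^sup>L (empirical t (r n)) f = 0" for n
      by (subst integral_empirical[OF borel_measurable_continuous_onI[OF cf]])
         (simp add: f_def t(2) zF)
    moreover have "\<exists>B. \<forall>x. \<bar>f x\<bar> \<le> B" using f01 by (intro exI[of _ 1]) auto
    ultimately have "(\<lambda>n. 0) \<longlonglongrightarrow> integral\<^sup>L N f" using lim[OF cf] by simp
    then have "integral\<^sup>L N f = 0" by (rule LIMSEQ_unique[OF _ tendsto_const])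
    moreover have "integrable N f"
      by (rule integral_bounded(1)[OF N.prob_space_axioms, of _ 1])
         (use f01 borel_measurable_continuous_onI[OF cf] in auto)
    ultimately have "AE s in N. f s = 0"
      by (subst (asm) integral_nonneg_eq_0_iff_AE) (use f01 in auto)
    then have "AE s in N. \<psi> s \<in> F"
    proof eventually_elim
      case (elim s)
      then have "infdist (\<psi> s) F = 0" by (simp add: f_def min_def split: if_splits)
      then show ?case using in_closed_iff_infdist_zero[OF compact_imp_closed[OF F]] zF by blast
    qed
    then have "AE x in \<mu>. x \<in> F"
      unfolding \<mu>_def using F meas\<psi> by (subst AE_distr_iff) (auto intro: borel_compact)
    then show ?thesis
      using \<mu> F by (intro prob_space.emeasure_eq_1_AE) (auto intro: borel_compact)
  qed
  have "log_energy \<mu> \<noteq> - \<infinity>"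
  proof (rule log_energy_bounded_below[OF \<mu> D(1)])
    fix n :: nat
    have meas2: "(\<lambda>(z, u). trunc_log D (real n) z (\<psi> u)) \<in> borel_measurable (borel \<Otimes>\<^sub>M N)"
    proof -
      have "continuous_on UNIV (\<lambda>p. trunc_log D (real n) (fst p) (\<psi> (snd p)))"
        by (intro continuous_on_trunc_log continuous_on_compose2[OF \<psi>(1)] continuous_intros) auto
      then have "(\<lambda>(z, u). trunc_log D (real n) z (\<psi> u)) \<in> borel_measurable (borel \<Otimes>\<^sub>M borel)"
        by (simp add: borel_prod borel_measurable_continuous_onI case_prod_unfold)
      moreover have "sets (borel \<Otimes>\<^sub>M N) = sets (borel \<Otimes>\<^sub>M borel)"
        by (rule sets_pair_measure_cong) auto
      ultimately show ?thesis by (simp cong: measurable_cong_sets)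
    qed
    have inner: "(\<integral>w. trunc_log D (real n) z w \<partial>\<mu>) = (\<integral>u. trunc_log D (real n) z (\<psi> u) \<partial>N)" for z
      unfolding \<mu>_def using meas\<psi>
      by (intro integral_distr borel_measurable_continuous_onI continuous_on_trunc_log continuous_intros) auto
    have "(\<integral>z. (\<integral>w. trunc_log D (real n) z w \<partial>\<mu>) \<partial>\<mu>) = (\<integral>s. (\<integral>u. k (real n) s u \<partial>N) \<partial>N)"
      unfolding inner k_def unfolding \<mu>_def using meas\<psi>
      by (intro integral_distr N.borel_measurable_lebesgue_integral meas2) auto
    then show "- M \<le> (\<integral>z. (\<integral>w. trunc_log D (real n) z w \<partial>\<mu>) \<partial>\<mu>)" using energy[of "real n"] by simp
  qed
  from exp_ereal_pos[OF this] have "0 < exp_ereal (log_energy \<mu>)" .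
  also have "\<dots> \<le> log_capacity F"
    unfolding log_capacity_def by (rule SUP_upper) (use \<mu> F \<open>emeasure \<mu> F = 1\<close> in auto)
  finally show ?thesis .
qed

text \<open>
  Otherwise a point of \<open>F\<close> at which the product over the previously chosen points is not small can
  be added again and again, and the resulting sequence in \<open>F\<close> has bounded discrete energy.
\<close>

lemma capacity_zero_small_product:
  fixes F K :: "complex set"
  assumes F: "compact F" "log_capacity F = 0" and K: "F \<subseteq> K" "K \<noteq> {}"
  obtains m :: nat and a :: "nat \<Rightarrow> complex" where "0 < m" "\<And>i. i < m \<Longrightarrow> a i \<in> K"
    "\<And>z. z \<in> F \<Longrightarrow> (\<Prod>i<m. dist z (a i)) < exp (- M * real m)"
proof (cases "F = {}")
  case True
  then show ?thesis using K that[of 1 "\<lambda>_. SOME x. x \<in> K"] by (simp add: some_in_eq)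
next
  case False
  show ?thesis
  proof (rule ccontr)
    assume neg: "\<not> thesis"
    note result = that
    \<comment> \<open>\<open>log_capacity_pos\<close> asks for a nonnegative constant, and a product
      below \<open>exp (- M' * real n)\<close> is also below
      \<open>exp (- M * real n)\<close>.\<close>
    define M' where "M' = max M 0"
    have step: "\<exists>x\<in>F. exp (- M' * real n) \<le> (\<Prod>i<n. dist x (a i))" if "\<And>i. i < n \<Longrightarrow> a i \<in> F" for n a
    proof (cases "n = 0")
      case True
      then show ?thesis using \<open>F \<noteq> {}\<close> by auto
    next
      case n: False
      show ?thesis
      proof (rule ccontr)
        assume *: "\<not> ?thesis"
        have "(\<Prod>i<n. dist x (a i)) < exp (- M * real n)" if "x \<in> F" for x
        proof -
          have "(\<Prod>i<n. dist x (a i)) < exp (- M' * real n)" using * that by (auto simp: not_le)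
          also have "\<dots> \<le> exp (- M * real n)" by (simp add: M'_def mult_right_mono)
          finally show ?thesis .
        qed
        then show False using neg result[of n a] n \<open>\<And>i. i < n \<Longrightarrow> a i \<in> F\<close> K(1) by blast
      qed
    qed
    have "\<exists>z. \<forall>n. z n \<in> F \<and> exp (- M' * real n) \<le> (\<Prod>i<n. dist (z n) (z i))"
    proof (rule dependent_wellorder_choice)
      fix n r and f g :: "nat \<Rightarrow> complex"
      assume "\<And>y. y < n \<Longrightarrow> f y = g y"
      then show "(r \<in> F \<and> exp (- M' * real n) \<le> (\<Prod>i<n. dist r (f i))) =
          (r \<in> F \<and> exp (- M' * real n) \<le> (\<Prod>i<n. dist r (g i)))" by simp
    next
      fix n and f :: "nat \<Rightarrow> complex"
      assume "\<And>y. y < n \<Longrightarrow> f y \<in> F \<and> exp (- M' * real y) \<le> (\<Prod>i<y. dist (f y) (f i))"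
      then show "\<exists>r. r \<in> F \<and> exp (- M' * real n) \<le> (\<Prod>i<n. dist r (f i))"
        using step[of n f] by blast
    qed
    then obtain z where z: "\<And>n. z n \<in> F" "\<And>n. exp (- M' * real n) \<le> (\<Prod>i<n. dist (z n) (z i))" by blast
    have "0 < log_capacity F"
    proof (rule log_capacity_pos[OF F(1) z(1)])
      have pos: "0 < (\<Prod>i<n. dist (z n) (z i))" for n
        by (rule less_le_trans[OF exp_gt_zero z(2)])
      show neq: "z i \<noteq> z n" if "i < n" for i n
      proof
        assume "z i = z n"
        then have "(\<Prod>i<n. dist (z n) (z i)) = 0" using that by (intro prod_zero bexI[of _ i]) auto
        then show False using pos[of n] by (simp only: less_irrefl)
      qed
      show "- M' * real n \<le> (\<Sum>i<n. ln (dist (z i) (z n)))" for n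
      proof -
        have "- M' * real n \<le> ln (\<Prod>i<n. dist (z n) (z i))"
          using z(2)[of n] pos[of n] by (subst ln_ge_iff) auto
        also have "\<dots> = (\<Sum>i<n. ln (dist (z n) (z i)))"
          by (rule ln_prod) (use neq in force)+
        finally show ?thesis by (simp add: dist_commute)
      qed
    qed (simp add: M'_def)
    then show False using F(2) by simp
  qed
qed

subsection \<open>Fekete sets\<close>

text \<open>The squared modulus of the Vandermonde determinant: the product runs over ordered pairs,
  so every distance enters twice.\<close>

definition vandermonde_sq :: "complex set \<Rightarrow> real" where
  "vandermonde_sq S = (\<Prod>x\<in>S. \<Prod>y\<in>S - {x}. dist x y)"

lemma vandermonde_sq_insert:
  assumes "finite T" "x \<notin> T"
  shows "vandermonde_sq (insert x T) = (\<Prod>y\<in>T. dist x y)\<^sup>2 * vandermonde_sq T"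
proof -
  have "(\<Prod>y\<in>insert x T - {a}. dist a y) = dist x a * (\<Prod>y\<in>T - {a}. dist a y)" if "a \<in> T" for a
  proof -
    have "insert x T - {a} = insert x (T - {a})" using that assms by auto
    then show ?thesis using assms by (simp add: dist_commute)
  qed
  moreover have "insert x T - {x} = T" using assms by auto
  ultimately show ?thesis
    using assms by (simp add: vandermonde_sq_def prod.distrib power2_eq_square)
qed

lemma vandermonde_sq_pos: "finite S \<Longrightarrow> 0 < vandermonde_sq S"
  unfolding vandermonde_sq_def by (intro prod_pos) auto

text \<open>Take \<open>S\<close> with \<open>vandermonde_sq S\<close> above a quarter of the
  supremum. Exchanging \<open>x\<close> for \<open>z\<close> multiplies this value by the square of
  the quotient of the two products, so that quotient is at most 2. Working near the supremum makes
  boundedness of \<open>K\<close> enough.\<close>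

lemma near_fekete_set:
  fixes K :: "complex set"
  assumes K: "bounded K" "infinite K"
  obtains S where "finite S" "card S = N" "S \<subseteq> K"
    "\<And>x z. x \<in> S \<Longrightarrow> z \<in> K \<Longrightarrow> (\<Prod>y\<in>S - {x}. dist z y) \<le> 2 * (\<Prod>y\<in>S - {x}. dist x y)"
proof -
  define \<S> where "\<S> = {S. finite S \<and> card S = N \<and> S \<subseteq> K}"
  obtain D0 where D0: "\<And>x y. x \<in> K \<Longrightarrow> y \<in> K \<Longrightarrow> dist x y \<le> D0"
    using K(1) diameter_bounded_bound by blast
  define D where "D = max 1 D0"
  have D: "1 \<le> D" "\<And>x y. x \<in> K \<Longrightarrow> y \<in> K \<Longrightarrow> dist x y \<le> D" using D0 by (auto simp: D_def le_max_iff_disj)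
  obtain S0 where "S0 \<in> \<S>" using infinite_arbitrarily_large[OF K(2), of N] by (auto simp: \<S>_def)
  have "vandermonde_sq S \<le> (D ^ (N - 1)) ^ N" if "S \<in> \<S>" for S
  proof -
    have "(\<Prod>y\<in>S - {x}. dist x y) \<le> D ^ (N - 1)" if "x \<in> S" for x
    proof -
      have "(\<Prod>y\<in>S - {x}. dist x y) \<le> (\<Prod>y\<in>S - {x}. D)"
        using \<open>S \<in> \<S>\<close> that by (intro prod_mono) (auto simp: \<S>_def intro!: D(2))
      then show ?thesis using \<open>S \<in> \<S>\<close> that by (simp add: \<S>_def)
    qed
    then have "vandermonde_sq S \<le> (\<Prod>x\<in>S. D ^ (N - 1))"
      unfolding vandermonde_sq_def by (intro prod_mono) (auto intro: prod_nonneg)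
    then show ?thesis using that by (simp add: \<S>_def)
  qed
  then have bdd: "bdd_above (vandermonde_sq ` \<S>)" by (auto simp: bdd_above_def)
  define s where "s = (SUP S\<in>\<S>. vandermonde_sq S)"
  have "0 < vandermonde_sq S0" using \<open>S0 \<in> \<S>\<close> by (intro vandermonde_sq_pos) (simp add: \<S>_def)
  also have "vandermonde_sq S0 \<le> s" unfolding s_def by (rule cSUP_upper[OF \<open>S0 \<in> \<S>\<close> bdd])
  finally have "s / 4 < s" by simp
  then obtain S where S: "S \<in> \<S>" "s / 4 < vandermonde_sq S"
    unfolding s_def using less_cSUP_iff[OF _ bdd] \<open>S0 \<in> \<S>\<close> by blast
  have "(\<Prod>y\<in>S - {x}. dist z y) \<le> 2 * (\<Prod>y\<in>S - {x}. dist x y)" if x: "x \<in> S" and z: "z \<in> K" for x z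
  proof (cases "z \<in> S - {x}")
    case True
    then have "(\<Prod>y\<in>S - {x}. dist z y) = 0" using S by (intro prod_zero) (auto simp: \<S>_def)
    moreover have "0 \<le> 2 * (\<Prod>y\<in>S - {x}. dist x y)" by (simp add: prod_nonneg)
    ultimately show ?thesis by simp
  next
    case False
    define T where "T = S - {x}"
    have T: "finite T" "x \<notin> T" "z \<notin> T" "S = insert x T"
      using S x False by (auto simp: T_def \<S>_def)
    have "insert z T \<in> \<S>" using S z T by (auto simp: \<S>_def)
    then have "vandermonde_sq (insert z T) \<le> s" unfolding s_def by (rule cSUP_upper[OF _ bdd])
    also have "\<dots> \<le> 4 * vandermonde_sq (insert x T)" using S T by simp
    finally have "(\<Prod>y\<in>T. dist z y)\<^sup>2 \<le> (2 * (\<Prod>y\<in>T. dist x y))\<^sup>2"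
      using vandermonde_sq_pos[OF T(1)] T(1-3) by (simp add: vandermonde_sq_insert power_mult_distrib)
    then show ?thesis
      unfolding T_def[symmetric] by (rule power2_le_imp_le) (simp add: prod_nonneg)
  qed
  then show ?thesis using S by (intro that[of S]) (auto simp: \<S>_def)
qed

text \<open>This is interpolation of the constant 1: two polynomials of degree below
  \<open>card S\<close> that agree on \<open>S\<close> are equal.\<close>

lemma sum_lagrange_basis:
  fixes S :: "complex set"
  assumes "finite S" "S \<noteq> {}"
  shows "(\<Sum>x\<in>S. \<Prod>y\<in>S - {x}. (z - y) / (x - y)) = 1"
proof -
  define L where "L = (\<lambda>x. smult (inverse (\<Prod>y\<in>S - {x}. x - y)) (\<Prod>y\<in>S - {x}. [:- y, 1:]))"
  have L: "poly (L x) z = (\<Prod>y\<in>S - {x}. (z - y) / (x - y))" for x z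
    by (simp add: L_def poly_prod prod_dividef field_simps)
  have "degree (L x) \<le> card S - 1" if "x \<in> S" for x
  proof -
    have "degree (L x) \<le> degree (\<Prod>y\<in>S - {x}. [:- y, 1:])" unfolding L_def by (rule degree_smult_le)
    also have "\<dots> = (\<Sum>y\<in>S - {x}. degree [:- y, 1:])" by (rule degree_prod_eq_sum_degree) auto
    also have "\<dots> = card S - 1" using assms that by simp
    finally show ?thesis .
  qed
  then have "degree (\<Sum>x\<in>S. L x) \<le> card S - 1" by (intro degree_sum_le assms(1))
  moreover have "0 < card S" using assms by (simp add: card_gt_0_iff)
  ultimately have deg: "degree (\<Sum>x\<in>S. L x) < card S" "degree (1 :: complex poly) < card S" by auto
  have "poly (\<Sum>x\<in>S. L x) s = poly 1 s" if s: "s \<in> S" for s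
  proof -
    have "(\<Prod>y\<in>S - {x}. (s - y) / (x - y)) = (if x = s then 1 else 0)" if "x \<in> S" for x
    proof (cases "x = s")
      case False
      then show ?thesis using s assms by (auto intro!: prod_zero)
    next
      case True
      then have "(\<Prod>y\<in>S - {x}. (s - y) / (x - y)) = (\<Prod>y\<in>S - {x}. 1)"
        by (intro prod.cong) auto
      then show ?thesis using True by simp
    qed
    then show ?thesis using s assms by (simp add: poly_sum L)
  qed
  from poly_eqI_degree[OF this deg] have "(\<Sum>x\<in>S. L x) = 1" by blast
  then have "poly (\<Sum>x\<in>S. L x) z = 1" by simp
  then show ?thesis by (simp add: poly_sum L)
qed

text \<open>
  The lower bound holds because the Lagrange basis of a near-Fekete set sums to 1: one of its
  members has absolute value at least \<open>1 / N\<close> at \<open>z\<close>.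
\<close>

lemma fekete_polynomial_bounds:
  fixes K :: "complex set"
  assumes K: "bounded K" "infinite K" and "0 < N"
    and D: "\<And>x y. x \<in> K \<Longrightarrow> y \<in> K \<Longrightarrow> dist x y \<le> D"
  obtains S w where "finite S" "card S = N" "S \<subseteq> K" "0 < w"
    "\<And>z. z \<in> K \<Longrightarrow> (\<Prod>a\<in>S. dist z a) \<le> 2 * D * w"
    "\<And>z r. 0 < r \<Longrightarrow> (\<And>a. a \<in> S \<Longrightarrow> r \<le> dist z a) \<Longrightarrow> r * w / real N \<le> (\<Prod>a\<in>S. dist z a)"
proof -
  obtain S where S: "finite S" "card S = N" "S \<subseteq> K"
    and fek: "\<And>x z. x \<in> S \<Longrightarrow> z \<in> K \<Longrightarrow> (\<Prod>y\<in>S - {x}. dist z y) \<le> 2 * (\<Prod>y\<in>S - {x}. dist x y)"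
    using near_fekete_set[OF K] by metis
  have "S \<noteq> {}" using S \<open>0 < N\<close> by auto
  define W where "W = (\<lambda>x. \<Prod>y\<in>S - {x}. dist x y)"
  define w where "w = Min (W ` S)"
  have "w \<in> W ` S" unfolding w_def using S \<open>S \<noteq> {}\<close> by (intro Min_in) auto
  then obtain x0 where x0: "x0 \<in> S" "w = W x0" by blast
  have w_le: "w \<le> W x" if "x \<in> S" for x unfolding w_def using S that by (intro Min_le) auto
  have Wpos: "0 < W x" for x unfolding W_def by (intro prod_pos) auto
  show ?thesis
  proof (rule that[OF S])
    show "0 < w" using Wpos x0 by simp
    \<comment> \<open>The node \<open>x0\<close> with the smallest product is removed: its own
      factor is at most \<open>D\<close>, and near-maximality bounds the others by
      \<open>2 * w\<close>.\<close>
    show "(\<Prod>a\<in>S. dist z a) \<le> 2 * D * w" if z: "z \<in> K" for z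
    proof -
      have "(\<Prod>a\<in>S. dist z a) = dist z x0 * (\<Prod>y\<in>S - {x0}. dist z y)"
        by (rule prod.remove[OF S(1) x0(1)])
      also have "\<dots> \<le> D * (2 * w)"
        using fek[OF x0(1) z] x0 S z D[of z x0] order_trans[OF zero_le_dist D[of z x0]]
        by (intro mult_mono) (auto simp: W_def intro: prod_nonneg)
      finally show ?thesis by simp
    qed
    show "r * w / real N \<le> (\<Prod>a\<in>S. dist z a)"
      if r: "0 < r" "\<And>a. a \<in> S \<Longrightarrow> r \<le> dist z a" for z r
    proof -
      define P where "P = (\<Prod>a\<in>S. dist z a)"
      have "0 \<le> P" unfolding P_def by (simp add: prod_nonneg)
      have "1 = cmod (\<Sum>x\<in>S. \<Prod>y\<in>S - {x}. (z - y) / (x - y))"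
        by (simp only: sum_lagrange_basis[OF S(1) \<open>S \<noteq> {}\<close>] norm_one)
      also have "\<dots> \<le> (\<Sum>x\<in>S. cmod (\<Prod>y\<in>S - {x}. (z - y) / (x - y)))" by (rule norm_sum)
      also have "\<dots> \<le> (\<Sum>x\<in>S. P / (r * w))"
      proof (rule sum_mono)
        fix x assume x: "x \<in> S"
        have "cmod (\<Prod>y\<in>S - {x}. (z - y) / (x - y)) = (\<Prod>y\<in>S - {x}. dist z y) / W x"
          by (simp add: W_def prod_dividef norm_divide dist_norm flip: prod_norm)
        also have "(\<Prod>y\<in>S - {x}. dist z y) = P / dist z x"
          unfolding P_def prod.remove[OF S(1) x] using r x by force
        also have "P / dist z x / W x = P / (dist z x * W x)" by simp
        also have "\<dots> \<le> P / (r * w)"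
          using r(1) r(2)[OF x] less_le_trans[OF r(1) r(2)[OF x]] Wpos[of x] Wpos[of x0] w_le[OF x] x0 \<open>0 \<le> P\<close>
          by (intro divide_left_mono mult_mono mult_pos_pos) simp_all
        finally show "cmod (\<Prod>y\<in>S - {x}. (z - y) / (x - y)) \<le> P / (r * w)" .
      qed
      also have "\<dots> = real N * P / (r * w)" using S by simp
      finally have "r * w \<le> real N * P" using r(1) Wpos[of x0] x0 by (simp add: field_simps)
      then show ?thesis using \<open>0 < N\<close> by (simp add: P_def field_simps)
    qed
  qed
qed

subsection \<open>Approximation of the Green's function by Fekete polynomials\<close>

text \<open>At a point where \<open>g\<close> tends to 0 the set where \<open>g\<close> is at least
  \<eta> cannot accumulate. So only points of the exceptional Borel set remain, and capacity is
  monotone.\<close>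

lemma green_exceptional_set:
  assumes K: "compact K" and g: "green_function K g" and "0 < \<eta>"
  shows "log_capacity (K \<inter> closure {z. z \<notin> K \<and> \<eta> \<le> g z}) = 0"
proof -
  let ?F = "K \<inter> closure {z. z \<notin> K \<and> \<eta> \<le> g z}"
  obtain N where N: "log_capacity N = 0" "\<And>\<zeta>. \<zeta> \<in> frontier K - N \<Longrightarrow> (g \<longlongrightarrow> 0) (at \<zeta> within - K)"
    using g unfolding green_function_def by blast
  have "?F \<subseteq> N"
  proof
    fix \<zeta> assume \<zeta>: "\<zeta> \<in> ?F"
    show "\<zeta> \<in> N"
    proof (rule ccontr)
      assume "\<zeta> \<notin> N"
      have "closure {z. z \<notin> K \<and> \<eta> \<le> g z} \<subseteq> closure (- K)" by (rule closure_mono) auto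
      then have "\<zeta> \<in> frontier K" using \<zeta> closure_subset[of K] by (auto simp: frontier_closures)
      then have "(g \<longlongrightarrow> 0) (at \<zeta> within - K)" using N(2) \<open>\<zeta> \<notin> N\<close> by blast
      from order_tendstoD(2)[OF this \<open>0 < \<eta>\<close>]
      obtain d where d: "d > 0" "\<And>z. z \<notin> K \<Longrightarrow> z \<noteq> \<zeta> \<Longrightarrow> dist z \<zeta> < d \<Longrightarrow> g z < \<eta>"
        by (auto simp: eventually_at)
      obtain z where "z \<notin> K" "\<eta> \<le> g z" "dist z \<zeta> < d"
        using \<zeta> d(1) by (auto simp: closure_approachable)
      then show False using d(2)[of z] \<zeta> by force
    qed
  qed
  then have "log_capacity ?F \<le> log_capacity N" by (rule log_capacity_mono)
  then show ?thesis using N(1) by simp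
qed

text \<open>The part outside \<open>W\<close> of the closure of the set where \<open>g\<close> is at
  least \<eta>, cut down to a large disc, is compact and disjoint from \<open>K\<close>, hence at
  positive distance from it. The bound \<open>r \<le> 1\<close> keeps the relevant points inside
  that disc.\<close>

lemma green_function_le_near:
  assumes K: "compact K" and g: "green_function K g"
    and W: "open W" "K \<inter> closure {z. z \<notin> K \<and> \<eta> \<le> g z} \<subseteq> W"
  obtains r where "0 < r" "r \<le> 1" "\<And>z k. z \<notin> K \<Longrightarrow> k \<in> K \<Longrightarrow> dist z k < r \<Longrightarrow> z \<in> W \<or> g z < \<eta>"
proof -
  obtain R where R: "\<And>z. z \<in> K \<Longrightarrow> cmod z \<le> R"
    using compact_imp_bounded[OF K] by (auto simp: bounded_iff)
  define A where "A = (closure {z. z \<notin> K \<and> \<eta> \<le> g z} - W) \<inter> cball 0 (R + 1)"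
  have "compact A" unfolding A_def using W(1) by (intro closed_Int_compact closed_Diff) auto
  moreover have "A \<inter> K = {}" using W(2) by (auto simp: A_def)
  ultimately obtain d where d: "d > 0" "\<And>x y. x \<in> A \<Longrightarrow> y \<in> K \<Longrightarrow> d \<le> dist x y"
    using separate_compact_closed[OF _ compact_imp_closed[OF K]] by metis
  show ?thesis
  proof (rule that[of "min d 1"])
    fix z k assume z: "z \<notin> K" "k \<in> K" "dist z k < min d 1"
    show "z \<in> W \<or> g z < \<eta>"
    proof (rule ccontr)
      assume *: "\<not> (z \<in> W \<or> g z < \<eta>)"
      have "cmod z \<le> cmod k + dist z k" by (metis add.commute dist_norm norm_triangle_sub)
      then have "cmod z \<le> R + 1" using R[OF z(2)] z(3) by simp
      moreover have "z \<in> closure {z. z \<notin> K \<and> \<eta> \<le> g z}"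
        using * z(1) by (intro subsetD[OF closure_subset]) simp
      ultimately have "z \<in> A" using * by (simp add: A_def)
      then show False using d(2)[of z k] z by simp
    qed
  qed (use d(1) in auto)
qed

lemma sum_ln_dist_bounds:
  fixes z :: complex
  assumes "finite I" "\<And>i. i \<in> I \<Longrightarrow> 0 < c \<and> c \<le> dist z (a i)" "\<And>i. i \<in> I \<Longrightarrow> dist z (a i) \<le> C"
  shows "real (card I) * ln c \<le> (\<Sum>i\<in>I. ln (cmod (z - a i)))"
    and "(\<Sum>i\<in>I. ln (cmod (z - a i))) \<le> real (card I) * ln C"
proof -
  have "(\<Sum>i\<in>I. ln c) \<le> (\<Sum>i\<in>I. ln (cmod (z - a i)))"
    using assms(2) by (intro sum_mono ln_mono) (force simp: dist_norm)+
  then show "real (card I) * ln c \<le> (\<Sum>i\<in>I. ln (cmod (z - a i)))" by simp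
  have "(\<Sum>i\<in>I. ln (cmod (z - a i))) \<le> (\<Sum>i\<in>I. ln C)"
    using assms(2,3) by (intro sum_mono ln_mono) (force simp: dist_norm)+
  then show "(\<Sum>i\<in>I. ln (cmod (z - a i))) \<le> real (card I) * ln C" by simp
qed

text \<open>
  The points of \<open>K\<close> near which \<open>g\<close> is not below \<open>\<eta>\<close> form a compact set \<open>F\<close> of capacity
  zero. A product with zeros in \<open>K\<close> that is tiny near \<open>F\<close> gives a penalty term \<open>h\<close>, large near
  \<open>F\<close>, so that \<open>g - (1 + 2\<delta>) G - \<delta> (h + C)\<close> obeys the maximum principle, where \<open>G\<close> comes from a
  Fekete polynomial (\<open>c\<close> being its normalisation) and \<open>h = - LA / m\<close>.
\<close>

lemma green_function_comparison:
  fixes K S :: "complex set" and a :: "nat \<Rightarrow> complex" and g :: "complex \<Rightarrow> real" and m N :: nat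
  defines "LS \<equiv> \<lambda>z. \<Sum>x\<in>S. ln (cmod (z - x))" and "LA \<equiv> \<lambda>z. \<Sum>i<m. ln (cmod (z - a i))"
  assumes K: "compact K" "K \<noteq> {}" and g: "green_function K g"
    and S: "finite S" "card S = N" "0 < N" "S \<subseteq> K" and a: "\<And>i. i < m \<Longrightarrow> a i \<in> K" "0 < m"
    and r: "0 < r" "r < r0" and \<delta>: "0 < \<delta>" and \<eta>: "0 < \<eta>"
    and near: "\<And>z. z \<notin> K \<Longrightarrow> (\<And>k. k \<in> K \<Longrightarrow> r \<le> dist z k) \<Longrightarrow> (\<exists>k\<in>K. dist z k < r0) \<Longrightarrow>
       g z - (1 + 2 * \<delta>) * (LS z / N - c) - \<delta> * (C - LA z / m) \<le> \<eta>"
    and z: "\<And>k. k \<in> K \<Longrightarrow> r0 \<le> dist z k"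
  shows "g z - (1 + 2 * \<delta>) * (LS z / N - c) - \<delta> * (C - LA z / m) \<le> \<eta>"
\<comment> \<open>The domain reaches into the \<open>r0\<close>-neighbourhood of \<open>K\<close>:
  its points close to the frontier have distance between \<open>r\<close> and \<open>r0\<close> from
  \<open>K\<close>, which is where \<open>near\<close> applies.\<close>
proof (rule maximum_principle[where D = "{z. r < infdist z K}"])
  have closedK: "closed K" by (rule compact_imp_closed[OF K(1)])
  have le_dist: "s \<le> dist z k" if "s \<le> infdist z K" "k \<in> K" for s z k
    using infdist_le[OF that(2), of z] that(1) by simp
  have notK: "z \<notin> K" if "r \<le> infdist z K" for z using that r by force
  have sub: "{z. r < infdist z K} \<subseteq> - K" using notK by force
  have "open {z. r < infdist z K}"
    by (intro open_Collect_less continuous_intros)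
  moreover have "harmonic_on g (- K)" using g by (simp add: green_function_def)
  moreover have "harmonic_on LS (- K)" "harmonic_on LA (- K)"
    unfolding LS_def LA_def using S a closedK by (auto intro!: harmonic_on_sum_ln_dist)
  ultimately have h: "harmonic_on g {z. r < infdist z K}" "harmonic_on LS {z. r < infdist z K}"
      "harmonic_on LA {z. r < infdist z K}" and op: "open {z. r < infdist z K}"
    using harmonic_on_subset[OF _ _ sub] by auto
  have "harmonic_on (\<lambda>z. g z - (1 + 2 * \<delta>) * (1 / N * LS z - c) - \<delta> * (C - 1 / m * LA z))
      {z. r < infdist z K}"
    by (intro harmonic_on_diff harmonic_on_cmult harmonic_on_const h op)
  then show "harmonic_on (\<lambda>z. g z - (1 + 2 * \<delta>) * (LS z / N - c) - \<delta> * (C - LA z / m))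
      {z. r < infdist z K}" by simp
  have "r0 \<le> infdist z K" unfolding infdist_notempty[OF K(2)] using K(2) z by (intro cINF_greatest)
  then show "z \<in> {z. r < infdist z K}" using r by simp
  show "\<forall>\<^sub>F z in at \<zeta> within {z. r < infdist z K}.
      g z - (1 + 2 * \<delta>) * (LS z / N - c) - \<delta> * (C - LA z / m) \<le> \<eta>"
    if "\<zeta> \<in> frontier {z. r < infdist z K}" for \<zeta>
  proof -
    have "\<zeta> \<notin> {z. r < infdist z K}" using that op by (simp add: frontier_def interior_open)
    then have "infdist \<zeta> K < r0" using r by simp
    moreover have "((\<lambda>z. infdist z K) \<longlongrightarrow> infdist \<zeta> K) (at \<zeta> within {z. r < infdist z K})"
      by (intro tendsto_intros)
    ultimately have "\<forall>\<^sub>F z in at \<zeta> within {z. r < infdist z K}. infdist z K < r0"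
      by (intro order_tendstoD(2))
    moreover have "\<forall>\<^sub>F z in at \<zeta> within {z. r < infdist z K}. r < infdist z K"
      by (simp add: eventually_at_filter)
    ultimately show ?thesis
    proof eventually_elim
      case (elim z)
      obtain k where "k \<in> K" "infdist z K = dist z k" using infdist_attains_inf[OF closedK K(2)] by blast
      then have "\<exists>k\<in>K. dist z k < r0" using elim(1) by auto
      moreover have "r \<le> dist z k" if "k \<in> K" for k using le_dist[OF _ that, of r z] elim(2) by simp
      moreover have "z \<notin> K" using notK elim(2) by simp
      ultimately show ?case using near by blast
    qed
  qed
  obtain R' C1 where R': "1 \<le> R'" "\<And>z. R' \<le> cmod z \<Longrightarrow> \<bar>g z - ln (cmod z)\<bar> \<le> C1"
    using green_function_at_infinity[OF g] by blast
  obtain RK where RK: "\<And>z. z \<in> K \<Longrightarrow> cmod z \<le> RK"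
    using compact_imp_bounded[OF K(1)] by (auto simp: bounded_iff)
  \<comment> \<open>At infinity the coefficients of \<open>ln (cmod z)\<close> add up to
    \<open>1 - (1 + 2 * \<delta>) + \<delta> = - \<delta>\<close>: the surplus
    \<open>2 * \<delta>\<close> pays for the growth of the penalising product and leaves a margin.
    \<open>B\<close> collects the constants.\<close>
  define B where "B = C1 + (1 + 2 * \<delta>) * (ln 2 + c) + \<delta> * (ln 2 - C)"
  define b where "b = max R' (max (2 * RK) (exp (B / \<delta>)))"
  show "\<forall>\<^sub>F z in at_infinity. z \<in> {z. r < infdist z K} \<longrightarrow>
      g z - (1 + 2 * \<delta>) * (LS z / N - c) - \<delta> * (C - LA z / m) \<le> \<eta>"
    unfolding eventually_at_infinity
  proof (intro exI[of _ b] allI impI)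
    fix z assume "b \<le> cmod z"
    then have b: "R' \<le> cmod z" "2 * RK \<le> cmod z" "exp (B / \<delta>) \<le> cmod z" by (auto simp: b_def)
    have z0: "0 < cmod z" using b(1) R'(1) by linarith
    have lo: "cmod z / 2 \<le> dist z k" and hi: "dist z k \<le> 2 * cmod z" if "k \<in> K" for k
      using RK[OF that] b(2) norm_triangle_ineq2[of z k] norm_triangle_ineq4[of z k]
      by (simp_all add: dist_norm)
    have "real (card S) * ln (cmod z / 2) \<le> LS z"
      unfolding LS_def using lo hi S z0 by (intro sum_ln_dist_bounds(1)[where C="2 * cmod z"]) auto
    then have 1: "ln (cmod z) - ln 2 \<le> LS z / N"
      using S z0 by (simp add: ln_div field_simps)
    have "LA z \<le> real (card {..<m}) * ln (2 * cmod z)"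
      unfolding LA_def using lo hi a z0 by (intro sum_ln_dist_bounds(2)[where c="cmod z / 2"]) auto
    then have 2: "LA z / m \<le> ln 2 + ln (cmod z)"
      using a(2) z0 by (simp add: ln_mult field_simps)
    have "(1 + 2 * \<delta>) * (ln (cmod z) - ln 2 - c) \<le> (1 + 2 * \<delta>) * (LS z / N - c)"
      using 1 \<delta> by (intro mult_left_mono) auto
    moreover have "\<delta> * (C - (ln 2 + ln (cmod z))) \<le> \<delta> * (C - LA z / m)"
      using 2 \<delta> by (intro mult_left_mono) auto
    moreover have "g z \<le> ln (cmod z) + C1" using R'(2)[OF b(1)] by simp
    moreover have "B \<le> \<delta> * ln (cmod z)"
    proof -
      have "B / \<delta> \<le> ln (cmod z)" using b(3) z0 by (subst ln_ge_iff) auto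
      then show ?thesis using \<delta> by (simp add: field_simps)
    qed
    ultimately show "g z - (1 + 2 * \<delta>) * (LS z / N - c) - \<delta> * (C - LA z / m) \<le> \<eta>"
      using \<eta> by (simp add: B_def algebra_simps)
  qed
qed

lemma green_function_bounded:
  assumes K: "compact K" and g: "green_function K g" and E: "bounded E"
  obtains M where "0 < M" "\<And>z. z \<in> E \<Longrightarrow> z \<notin> K \<Longrightarrow> g z \<le> M"
proof -
  obtain R where R: "\<And>z. z \<in> E \<Longrightarrow> cmod z \<le> R" using E by (auto simp: bounded_iff)
  have "bounded (g ` (- K \<inter> cball 0 R))" using g by (simp add: green_function_def)
  then obtain M where M: "M > 0" "\<And>z. z \<in> - K \<inter> cball 0 R \<Longrightarrow> \<bar>g z\<bar> \<le> M"
    by (auto simp: bounded_pos)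
  show ?thesis by (rule that[OF M(1)]) (use M(2) R in \<open>force simp: abs_le_iff\<close>)
qed

text \<open>The error \<open>e\<close> is spent in thirds: on the level \<eta>, on the terms with
  weight \<delta>, and on the gap between the upper Fekete bound on \<open>K\<close> and the lower
  one at distance \<open>r\<close>. The last third determines \<open>N\<close>, after
  \<open>r\<close> has been fixed.\<close>

theorem green_function_polynomial_approximation:
  assumes K: "compact K" "infinite K" and g: "green_function K g"
    and E: "compact E" "E \<inter> K = {}" and "0 < e"
  obtains p where "0 < degree p" "\<And>z. z \<in> E \<Longrightarrow> poly p z \<noteq> 0"
    "\<And>z w. z \<in> E \<Longrightarrow> w \<in> K \<Longrightarrow> cmod (poly p w) * exp (real (degree p) * (g z - e)) \<le> cmod (poly p z)"
proof -
  have K0: "K \<noteq> {}" using K(2) by auto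
  have bK: "bounded K" by (rule compact_imp_bounded[OF K(1)])
  obtain d0 where d0: "0 < d0" "\<And>z k. z \<in> E \<Longrightarrow> k \<in> K \<Longrightarrow> d0 \<le> dist z k"
    using separate_compact_closed[OF E(1) compact_imp_closed[OF K(1)] E(2)] by auto
  obtain D0 where D0: "\<And>x y. x \<in> K \<Longrightarrow> y \<in> K \<Longrightarrow> dist x y \<le> D0"
    using bK diameter_bounded_bound by blast
  define D where "D = max 1 D0"
  have D: "1 \<le> D" "\<And>x y. x \<in> K \<Longrightarrow> y \<in> K \<Longrightarrow> dist x y \<le> D" using D0 by (auto simp: D_def le_max_iff_disj)
  obtain RK where RK: "\<And>k. k \<in> K \<Longrightarrow> cmod k \<le> RK" using bK by (auto simp: bounded_iff)
  \<comment> \<open>\<open>M0\<close> has to bound \<open>g\<close> near \<open>K\<close> as well as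
    on \<open>E\<close>; hence the unit neighbourhood.\<close>
  have "(\<Union>k\<in>K. cball k 1) \<subseteq> cball 0 (RK + 1)"
  proof
    fix z assume "z \<in> (\<Union>k\<in>K. cball k 1)"
    then obtain k where k: "k \<in> K" "dist k z \<le> 1" by auto
    have "cmod z \<le> cmod k + dist k z" by (metis dist_norm norm_minus_commute norm_triangle_sub)
    then show "z \<in> cball 0 (RK + 1)" using RK[OF k(1)] k(2) by simp
  qed
  then have "bounded (\<Union>k\<in>K. cball k 1)" by (rule bounded_subset[OF bounded_cball])
  then have "bounded (E \<union> (\<Union>k\<in>K. cball k 1))"
    using compact_imp_bounded[OF E(1)] by (simp only: bounded_Un)
  then obtain M0 where M0: "0 < M0" "\<And>z. z \<in> E \<union> (\<Union>k\<in>K. cball k 1) \<Longrightarrow> z \<notin> K \<Longrightarrow> g z \<le> M0"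
    using green_function_bounded[OF K(1) g] by blast
  \<comment> \<open>Points within distance 1 of \<open>K\<close> are at most \<open>D + 1\<close>
    away from every point of \<open>K\<close>, so this \<open>C\<close> makes the penalty
    \<open>C - LA z / m\<close> nonnegative there. On \<open>E\<close> the penalty is at most
    \<open>C'\<close>.\<close>
  define C where "C = ln (D + 1)"
  have "0 \<le> C" using D(1) by (simp add: C_def)
  define C' where "C' = C + \<bar>ln d0\<bar>"
  define \<eta> where "\<eta> = e / 3"
  \<comment> \<open>The weight makes \<open>\<delta> * (C' + 2 * M0)\<close> at most
    \<open>e / 3\<close>: \<open>C'\<close> stands for the penalty on \<open>E\<close>, and
    \<open>2 * M0\<close> for the surplus \<open>2 * \<delta>\<close> in the coefficient of the
    Fekete potential.\<close>
  define \<delta> where "\<delta> = e / (3 * (C' + 2 * M0 + 1))"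
  have pos: "0 < C' + 2 * M0 + 1" using \<open>0 \<le> C\<close> M0 by (simp add: C'_def add_nonneg_pos)
  have "0 < \<eta>" "0 < \<delta>" using \<open>0 < e\<close> pos by (auto simp: \<eta>_def \<delta>_def)
  have \<delta>_small: "\<delta> * (C' + 2 * M0) \<le> e / 3"
    using pos \<open>0 < e\<close> by (simp add: \<delta>_def field_simps)
  define F where "F = K \<inter> closure {z. z \<notin> K \<and> \<eta> \<le> g z}"
  have "compact F" unfolding F_def by (intro compact_Int_closed K(1)) auto
  moreover have "log_capacity F = 0"
    unfolding F_def by (rule green_exceptional_set[OF K(1) g \<open>0 < \<eta>\<close>])
  \<comment> \<open>With the exponent \<open>M0 / \<delta>\<close> the weighted penalty near
    \<open>F\<close> is at least \<open>M0\<close>, thus at least \<open>g\<close>.\<close>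
  ultimately obtain m a where m: "0 < m" and a: "\<And>i. i < m \<Longrightarrow> a i \<in> K"
    and small: "\<And>z. z \<in> F \<Longrightarrow> (\<Prod>i<m. dist z (a i)) < exp (- (M0 / \<delta>) * real m)"
    using capacity_zero_small_product[of F K "M0 / \<delta>"] K0 by (auto simp: F_def)
  define W where "W = {z. (\<Prod>i<m. dist z (a i)) < exp (- (M0 / \<delta>) * real m)}"
  have "open W" unfolding W_def by (intro open_Collect_less continuous_intros)
  moreover have "F \<subseteq> W" using small by (auto simp: W_def)
  ultimately obtain r1 where r1: "0 < r1" "r1 \<le> 1"
      "\<And>z k. z \<notin> K \<Longrightarrow> k \<in> K \<Longrightarrow> dist z k < r1 \<Longrightarrow> z \<in> W \<or> g z < \<eta>"
    using green_function_le_near[OF K(1) g, of W \<eta>] unfolding F_def by blast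
  define r0 where "r0 = min r1 d0"
  define r where "r = r0 / 2"
  have r: "0 < r" "r < r0" "r0 \<le> 1" using r1 d0 by (auto simp: r_def r0_def)
  have "(\<lambda>n. (ln (2 * D) - ln r) / real n + ln (real n) / real n) \<longlonglongrightarrow> 0 + 0"
    by (intro tendsto_add lim_const_over_n lim_ln_over_n)
  then have "\<forall>\<^sub>F n in sequentially. (ln (2 * D) - ln r) / real n + ln (real n) / real n < e / 3"
    using \<open>0 < e\<close> by (intro order_tendstoD(2)) auto
  then obtain n0 where "\<And>n. n0 \<le> n \<Longrightarrow> (ln (2 * D) - ln r) / real n + ln (real n) / real n < e / 3"
    by (auto simp: eventually_sequentially)
  from this[of "Suc n0"] obtain N where N: "0 < N"
      "(ln (2 * D) - ln r) / real N + ln (real N) / real N < e / 3"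
    by (metis le_SucI order_refl zero_less_Suc)
  obtain S w where S: "finite S" "card S = N" "S \<subseteq> K" "0 < w"
    and up: "\<And>z. z \<in> K \<Longrightarrow> (\<Prod>x\<in>S. dist z x) \<le> 2 * D * w"
    and lo: "\<And>z r. 0 < r \<Longrightarrow> (\<And>x. x \<in> S \<Longrightarrow> r \<le> dist z x) \<Longrightarrow> r * w / real N \<le> (\<Prod>x\<in>S. dist z x)"
    using fekete_polynomial_bounds[OF bK K(2) N(1) D(2)] by metis
  define LS where "LS = (\<lambda>z. \<Sum>x\<in>S. ln (cmod (z - x)))"
  define LA where "LA = (\<lambda>z. \<Sum>i<m. ln (cmod (z - a i)))"
  \<comment> \<open>The normalisation for which the lower Fekete bound reads
    \<open>c \<le> LS z / N\<close> at distance at least \<open>r\<close> from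
    \<open>K\<close>.\<close>
  define c where "c = (ln r + ln w - ln (real N)) / N"
  have prodS: "ln (\<Prod>x\<in>S. dist z x) = LS z" if "z \<notin> K" for z
    using that S by (subst ln_prod) (auto simp: LS_def dist_norm)
  have prodA: "ln (\<Prod>i<m. dist z (a i)) = LA z" if "z \<notin> K" for z
    using that a by (subst ln_prod) (auto simp: LA_def dist_norm)
  have near: "g z - (1 + 2 * \<delta>) * (LS z / N - c) - \<delta> * (C - LA z / m) \<le> \<eta>"
    if z: "z \<notin> K" "\<And>k. k \<in> K \<Longrightarrow> r \<le> dist z k" "\<exists>k\<in>K. dist z k < r0" for z
  proof -
    obtain k where k: "k \<in> K" "dist z k < r0" using z(3) by blast
    have "r * w / N \<le> (\<Prod>x\<in>S. dist z x)" using lo[OF r(1)] z(2) S(3) by blast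
    then have "ln (r * w / N) \<le> LS z"
      using prodS[OF z(1)] r(1) S(4) N(1) ln_mono[of "r * w / N" "\<Prod>x\<in>S. dist z x"] by simp
    then have "c \<le> LS z / N"
      using r(1) S(4) N(1) by (simp add: c_def ln_div ln_mult divide_right_mono)
    then have G: "0 \<le> (1 + 2 * \<delta>) * (LS z / N - c)" using \<open>0 < \<delta>\<close> by simp
    have "dist z x \<le> D + 1" if "x \<in> K" for x
      using dist_triangle[of z x k] D(2)[OF k(1) that] k(2) r(3) by simp
    then have "LA z \<le> real (card {..<m}) * ln (D + 1)"
      unfolding LA_def using z(2) r(1) a by (intro sum_ln_dist_bounds(2)[where c=r]) auto
    then have hC: "0 \<le> C - LA z / m" using m by (simp add: C_def field_simps)
    show ?thesis
    proof (cases "g z < \<eta>")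
      case True
      moreover have "0 \<le> \<delta> * (C - LA z / m)" using hC \<open>0 < \<delta>\<close> by simp
      ultimately show ?thesis using G by linarith
    next
      case False
      then have "z \<in> W" using r1(3)[OF z(1) k(1)] k(2) by (auto simp: r0_def)
      moreover have "0 < (\<Prod>i<m. dist z (a i))" using a z(1) by (intro prod_pos) auto
      ultimately have "LA z < - (M0 / \<delta>) * real m"
        unfolding prodA[OF z(1), symmetric] W_def
        using ln_less_cancel_iff[of "\<Prod>i<m. dist z (a i)" "exp (- (M0 / \<delta>) * real m)"] by simp
      then have "LA z / m < - (M0 / \<delta>)" using m by (simp only: pos_divide_less_eq of_nat_0_less_iff)
      then have "M0 / \<delta> \<le> C - LA z / m" using \<open>0 \<le> C\<close> by linarith
      then have "M0 \<le> \<delta> * (C - LA z / m)" using \<open>0 < \<delta>\<close> by (simp add: field_simps)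
      moreover have "z \<in> (\<Union>k\<in>K. cball k 1)"
        using k r(3) by (intro UN_I[of k]) (auto simp: dist_commute)
      then have "g z \<le> M0" using z(1) by (intro M0(2)) auto
      ultimately show ?thesis using G \<open>0 < \<eta>\<close> by linarith
    qed
  qed
  define p where "p = (\<Prod>x\<in>S. [:- x, 1:])"
  have degp: "degree p = N" unfolding p_def using S by (subst degree_prod_eq_sum_degree) auto
  have norm_p: "cmod (poly p z) = (\<Prod>x\<in>S. dist z x)" for z
    by (simp add: p_def poly_prod dist_norm flip: prod_norm)
  have main: "2 * D * w * exp (real N * (g z - e)) \<le> cmod (poly p z)" if z: "z \<in> E" for z
  proof -
    have zK: "z \<notin> K" using z E(2) by blast
    have d: "d0 \<le> dist z k" if "k \<in> K" for k using d0(2)[OF z that] .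
    have "g z - (1 + 2 * \<delta>) * (LS z / N - c) - \<delta> * (C - LA z / m) \<le> \<eta>"
      unfolding LS_def LA_def
    proof (rule green_function_comparison[OF K(1) K0 g S(1) S(2) N(1) S(3) a m r(1,2) \<open>0 < \<delta>\<close> \<open>0 < \<eta>\<close>])
      show "r0 \<le> dist z k" if "k \<in> K" for k using d[OF that] by (simp add: r0_def)
    qed (use near in \<open>auto simp: LS_def LA_def\<close>)
    moreover have "\<delta> * (C - LA z / m) \<le> \<delta> * C'"
    proof -
      obtain U where U: "\<And>k. k \<in> K \<Longrightarrow> dist z k \<le> U"
        using bK unfolding bounded_any_center[of K z] by blast
      have "real (card {..<m}) * ln d0 \<le> LA z"
        unfolding LA_def using d d0(1) a U by (intro sum_ln_dist_bounds(1)[where C=U]) auto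
      then have "ln d0 \<le> LA z / m" using m by (simp add: field_simps)
      then show ?thesis using \<open>0 < \<delta>\<close> by (intro mult_left_mono) (auto simp: C'_def)
    qed
    ultimately have ineq: "g z \<le> \<eta> + (1 + 2 * \<delta>) * (LS z / N - c) + \<delta> * C'" by linarith
    \<comment> \<open>If the normalised potential exceeds \<open>M0\<close>, it already exceeds
      \<open>g z\<close>; otherwise its surplus is at most \<open>2 * \<delta> * M0\<close>.\<close>
    have "g z - 2 * e / 3 \<le> LS z / N - c"
    proof (cases "LS z / N - c \<le> M0")
      case True
      then have "2 * \<delta> * (LS z / N - c) \<le> 2 * \<delta> * M0" using \<open>0 < \<delta>\<close> by (intro mult_left_mono) auto
      then show ?thesis using ineq \<delta>_small by (simp add: \<eta>_def algebra_simps)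
    next
      case False
      then show ?thesis using M0(2)[of z] z zK \<open>0 < e\<close> by simp
    qed
    \<comment> \<open>Passing from the normalisation \<open>c\<close> to the upper bound
      \<open>2 * D * w\<close> on \<open>K\<close> costs exactly the quantity that the choice of
      \<open>N\<close> has put below \<open>e / 3\<close>.\<close>
    moreover have "- c = - ln (2 * D * w) / N + ((ln (2 * D) - ln r) / N + ln (real N) / N)"
      using D(1) S(4) by (simp add: c_def ln_mult add_divide_distrib diff_divide_distrib)
    moreover have "(LS z - ln (2 * D * w)) / N = LS z / N + - ln (2 * D * w) / N"
      by (simp add: diff_divide_distrib)
    ultimately have "g z - e \<le> (LS z - ln (2 * D * w)) / N" using N(2) by linarith
    then have "ln (2 * D * w) + real N * (g z - e) \<le> LS z" using N(1) by (simp add: field_simps)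
    then have "exp (ln (2 * D * w) + real N * (g z - e)) \<le> exp (LS z)" by simp
    also have "exp (LS z) = cmod (poly p z)"
      unfolding norm_p prodS[OF zK, symmetric] using S zK by (intro exp_ln prod_pos) auto
    finally show ?thesis using D(1) S(4) by (simp add: exp_add)
  qed
  show ?thesis
  proof (rule that[of p])
    show "0 < degree p" using degp N(1) by simp
    show "poly p z \<noteq> 0" if "z \<in> E" for z
    proof -
      have "0 < 2 * D * w * exp (real N * (g z - e))" using D(1) S(4) by simp
      then show ?thesis using main[OF that] by auto
    qed
    show "cmod (poly p w') * exp (real (degree p) * (g z - e)) \<le> cmod (poly p z)"
      if "z \<in> E" "w' \<in> K" for z w'
    proof -
      have "cmod (poly p w') * exp (real N * (g z - e)) \<le> 2 * D * w * exp (real N * (g z - e))"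
        using up[OF that(2)] by (intro mult_right_mono) (auto simp: norm_p)
      then show ?thesis using main[OF that(1)] unfolding degp by (rule order_trans)
    qed
  qed
qed

subsection \<open>The polynomially convex hull\<close>

lemma poly_hull_le:
  assumes "S \<noteq> {}" "\<And>\<zeta>. \<zeta> \<in> S \<Longrightarrow> cmod (poly p \<zeta>) \<le> M" "z \<in> poly_hull S"
  shows "cmod (poly p z) \<le> M"
proof -
  have "cmod (poly p z) \<le> (SUP \<zeta>\<in>S. cmod (poly p \<zeta>))" using assms(3) by (simp add: poly_hull_def)
  also have "\<dots> \<le> M" by (rule cSUP_least[OF assms(1,2)])
  finally show ?thesis .
qed

lemma subset_poly_hull:
  assumes "compact S"
  shows "S \<subseteq> poly_hull S"
proof
  fix z assume z: "z \<in> S"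
  have "bdd_above ((\<lambda>\<zeta>. cmod (poly p \<zeta>)) ` S)" for p
    by (intro bounded_imp_bdd_above compact_imp_bounded compact_continuous_image assms continuous_intros)
  then show "z \<in> poly_hull S" unfolding poly_hull_def using z by (auto intro: cSUP_upper)
qed

lemma compact_poly_hull:
  assumes "compact S" "S \<noteq> {}"
  shows "compact (poly_hull S)"
proof -
  have "poly_hull S = (\<Inter>p. {z. cmod (poly p z) \<le> (SUP \<zeta>\<in>S. cmod (poly p \<zeta>))})"
    by (auto simp: poly_hull_def)
  moreover have "closed {z. cmod (poly p z) \<le> c}" for p c
    by (intro closed_Collect_le continuous_intros)
  ultimately have "closed (poly_hull S)" by (simp add: closed_INT)
  moreover obtain R where "\<And>\<zeta>. \<zeta> \<in> S \<Longrightarrow> cmod \<zeta> \<le> R"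
    using compact_imp_bounded[OF assms(1)] by (auto simp: bounded_iff)
  then have "cmod z \<le> R" if "z \<in> poly_hull S" for z
    using poly_hull_le[OF assms(2) _ that, of "[:0, 1:]" R] by simp
  ultimately show ?thesis by (auto simp: compact_eq_bounded_closed bounded_iff)
qed

text \<open>
  On a finite set a polynomial vanishing there would make the right-hand side of the
  Bernstein--Walsh inequality arbitrarily small.
\<close>

lemma green_function_imp_infinite:
  assumes K: "compact K" and g: "green_function K g" and z: "z \<notin> K"
  shows "infinite K"
proof
  assume fin: "finite K"
  define p where "p = (\<Prod>k\<in>K. [:- k, 1:])"
  have p0: "poly p w = 0" if "w \<in> K" for w
    unfolding p_def poly_prod using that fin by (auto intro!: prod_zero)
  have pz: "0 < cmod (poly p z)"
    using z fin by (auto simp: p_def poly_prod)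
  define c where "c = exp (real (degree p) * g z)"
  have "c > 0" by (simp add: c_def)
  have "cmod (poly p z) \<le> cmod (poly p z) / (2 * c) * exp (real (degree p) * g z)"
    by (rule bernstein_walsh[OF K g _ _ z]) (use pz p0 \<open>c > 0\<close> in auto)
  then show False using pz \<open>c > 0\<close> by (simp add: c_def[symmetric])
qed

subsection \<open>Bounds for eta\<close>

lemma eta_bdd_below:
  fixes A :: "'x::complex_normed_vector \<Rightarrow> 'x" and B :: "'y::complex_normed_vector \<Rightarrow> 'y"
  assumes "bounded_clinear A" 
  shows "bdd_below ((\<lambda>p. root (degree p) (onorm (poly_op p A) * onorm (inv (poly_op p B)))) `
    {p. 0 < degree p \<and> invertible_op (poly_op p B)})"
  by (rule bdd_belowI[of _ 0])
     (auto intro!: real_root_ge_zero mult_nonneg_nonneg onorm_nonneg bounded_clinear_poly_op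
        invertible_op_inv assms)

lemma exp_green_le_root:
  fixes A :: "'x::complex_banach \<Rightarrow> 'x" and B :: "'y::complex_banach \<Rightarrow> 'y"
  assumes A: "bounded_clinear A" and B: "bounded_clinear B" and ne: "spectrum A \<noteq> {}"
    and g: "green_function (poly_hull (spectrum A)) g"
    and \<mu>: "\<mu> \<in> spectrum B" "\<mu> \<notin> poly_hull (spectrum A)"
    and p: "0 < degree p" "invertible_op (poly_op p B)"
  shows "exp (- g \<mu>) \<le> root (degree p) (onorm (poly_op p A) * onorm (inv (poly_op p B)))"
proof -
  define n where "n = degree p"
  define P where "P = onorm (poly_op p A)"
  define Q where "Q = onorm (inv (poly_op p B))"
  define E where "E = exp (real n * g \<mu>)"
  have "E > 0" by (simp add: E_def)
  have "P \<ge> 0" "Q \<ge> 0"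
    unfolding P_def Q_def
    by (intro onorm_nonneg bounded_clinear_poly_op A invertible_op_inv p)+
  have K: "compact (poly_hull (spectrum A))"
    by (rule compact_poly_hull[OF compact_spectrum[OF A] ne])
  have "cmod (poly p w) \<le> P" if "w \<in> spectrum A" for w
    unfolding P_def
    by (rule spectrum_bound[OF bounded_clinear_poly_op[OF A]]) (use that in \<open>simp add: spectrum_poly_op[OF A p(1)]\<close>)
  then have hull: "cmod (poly p w) \<le> P" if "w \<in> poly_hull (spectrum A)" for w
    by (rule poly_hull_le[OF ne _ that])
  \<comment> \<open>\<open>bernstein_walsh\<close> requires a positive bound on \<open>K\<close>,
    whereas \<open>P\<close> may be 0; so \<open>P + e / E\<close> is used for arbitrary
    \<open>e > 0\<close>.\<close>
  have "cmod (poly p \<mu>) \<le> P * E"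
  proof (rule field_le_epsilon)
    fix e :: real assume "e > 0"
    then have "cmod (poly p \<mu>) \<le> (P + e / E) * exp (real (degree p) * g \<mu>)"
      using hull \<open>P \<ge> 0\<close> \<open>E > 0\<close>
      by (intro bernstein_walsh[OF K g _ _ \<mu>(2)]) (auto intro: add_nonneg_pos add_increasing2)
    then show "cmod (poly p \<mu>) \<le> P * E + e"
      using \<open>E > 0\<close> by (simp add: n_def[symmetric] E_def[symmetric] distrib_right)
  qed
  moreover have "1 \<le> cmod (poly p \<mu>) * Q"
  proof (rule ccontr)
    assume "\<not> 1 \<le> cmod (poly p \<mu>) * Q"
    then have "invertible_op (\<lambda>x. poly_op p B x - poly p \<mu> *\<^sub>C x)"
      by (intro invertible_op_perturb p bounded_clinear_poly_op B) (simp add: Q_def)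
    then show False using invertible_poly_op_minus_iff[OF B p(1)] \<mu>(1) by auto
  qed
  moreover have "cmod (poly p \<mu>) * Q \<le> P * E * Q"
    using \<open>cmod (poly p \<mu>) \<le> P * E\<close> \<open>Q \<ge> 0\<close> by (rule mult_right_mono)
  ultimately have "1 \<le> P * Q * E" by (simp add: mult_ac)
  then have "exp (- g \<mu>) ^ n \<le> P * Q"
    using \<open>E > 0\<close> by (simp add: E_def exp_minus power_inverse field_simps flip: exp_of_nat_mult)
  then have "root n (exp (- g \<mu>) ^ n) \<le> root n (P * Q)"
    using p(1) by (simp add: n_def)
  moreover have "root n (exp (- g \<mu>) ^ n) = exp (- g \<mu>)"
    using p(1) by (intro real_root_power_cancel) (auto simp: n_def)
  ultimately show ?thesis by (simp add: n_def P_def Q_def)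
qed

text \<open>The strict bounds make the inverses in the dyadic estimate exist on closed discs, for
  \<open>p(A)\<close> up to \<open>1 / a\<close> and for the inverse of \<open>p(B)\<close> up to
  \<open>b\<close>. Both normalised norms then tend to 0, so some power \<open>p ^ k\<close> has
  norm product at most \<open>(a / b) ^ k\<close>; it competes in \<open>eta\<close>, and the root
  of order \<open>degree p * k\<close> gives the bound.\<close>

lemma eta_le_root:
  fixes A :: "'x::complex_normed_vector \<Rightarrow> 'x" and B :: "'y::complex_normed_vector \<Rightarrow> 'y"
  assumes A: "bounded_clinear A" and B: "bounded_clinear B" and p: "0 < degree p"
    and a: "0 < a" "\<And>w. w \<in> spectrum A \<Longrightarrow> cmod (poly p w) < a"
    and b: "0 < b" "\<And>z. z \<in> spectrum B \<Longrightarrow> b < cmod (poly p z)"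
  shows "eta A B \<le> root (degree p) (a / b)"
proof -
  define S where "S = poly_op p A"
  define U where "U = poly_op p B"
  define T where "T = inv U"
  have S: "bounded_clinear S" unfolding S_def by (rule bounded_clinear_poly_op[OF A])
  have Ucl: "bounded_clinear U" unfolding U_def by (rule bounded_clinear_poly_op[OF B])
  have "p \<noteq> 0" using p by auto
  have U: "invertible_op U"
    unfolding U_def using b by (subst invertible_poly_op_iff[OF B \<open>p \<noteq> 0\<close>]) force
  have Tcl: "bounded_clinear T" unfolding T_def by (rule invertible_op_inv[OF U])
  have TU: "T (U x) = x" and UT: "U (T x) = x" for x
    unfolding T_def by (rule inv_op_left[OF U], rule inv_op_right[OF U])
  have Tinv: "invertible_op T" by (rule invertible_opI[OF Ucl UT TU])
  have inv1: "invertible_op (\<lambda>x. x - c *\<^sub>C S x)" if c: "cmod c \<le> 1 / a" for c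
  proof (cases "c = 0")
    case True
    then show ?thesis by (auto intro: invertible_opI[of "\<lambda>x. x"])
  next
    case False
    then have "a \<le> cmod (inverse c)" using le_imp_inverse_le[OF c] by (simp add: norm_inverse)
    then have "inverse c \<notin> poly p ` spectrum A" using a(2) by force
    then have "invertible_op (\<lambda>x. S x - inverse c *\<^sub>C x)"
      using invertible_poly_op_minus_iff[OF A p] by (simp add: S_def)
    from invertible_op_scaleC[of "- c", OF _ this] False S show ?thesis
      by (simp add: scaleC_diff_right scaleC_scaleC scaleC_minus_left
          bounded_clinear_diff_ops bounded_clinear_scaleC_op)
  qed
  \<comment> \<open>The factorisation \<open>1 - c T = T (U - c)\<close>, with \<open>T\<close> the
    inverse of \<open>U\<close>, reduces this to the values of \<open>p\<close> on the spectrum of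
    \<open>B\<close>.\<close>
  have inv2: "invertible_op (\<lambda>x. x - c *\<^sub>C T x)" if c: "cmod c \<le> b" for c
  proof -
    have "c \<notin> poly p ` spectrum B" using b(2) c by force
    then have "invertible_op (\<lambda>x. U x - c *\<^sub>C x)"
      using invertible_poly_op_minus_iff[OF B p] by (simp add: U_def)
    from invertible_op_compose[OF Tinv this] show ?thesis
      by (simp add: bounded_clinear_diff[OF Tcl] bounded_clinear_scaleC[OF Tcl] TU)
  qed
  have "(\<lambda>m. (1 / a) ^ (2 ^ m) * onorm (S ^^ (2 ^ m))) \<longlonglongrightarrow> 0"
    by (rule dyadic_spectral_radius[OF S _ inv1]) (use a in auto)
  moreover have "(\<lambda>m. b ^ (2 ^ m) * onorm (T ^^ (2 ^ m))) \<longlonglongrightarrow> 0"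
    by (rule dyadic_spectral_radius[OF Tcl _ inv2]) (use b in auto)
  ultimately have "(\<lambda>m. ((1 / a) ^ (2 ^ m) * onorm (S ^^ (2 ^ m))) * (b ^ (2 ^ m) * onorm (T ^^ (2 ^ m)))) \<longlonglongrightarrow> 0 * 0"
    by (rule tendsto_mult)
  then have "\<forall>\<^sub>F m in sequentially.
      ((1 / a) ^ (2 ^ m) * onorm (S ^^ (2 ^ m))) * (b ^ (2 ^ m) * onorm (T ^^ (2 ^ m))) < 1"
    by (rule order_tendstoD(2)) simp
  then obtain m where m: "((1 / a) ^ (2 ^ m) * onorm (S ^^ (2 ^ m))) * (b ^ (2 ^ m) * onorm (T ^^ (2 ^ m))) < 1"
    by (meson eventually_sequentially order_refl)
  define k :: nat where "k = 2 ^ m"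
  have "k > 0" by (simp add: k_def)
  have "onorm (S ^^ k) * onorm (T ^^ k) \<le> (a / b) ^ k"
    using m a(1) b(1) unfolding k_def[symmetric] by (simp add: power_divide field_simps)
  then have "root (degree p * k) (onorm (S ^^ k) * onorm (T ^^ k)) \<le> root (degree p * k) ((a / b) ^ k)"
    using p \<open>k > 0\<close> by simp
  also have "\<dots> = root (degree p) (a / b)"
    using \<open>k > 0\<close> a(1) b(1) by (simp add: real_root_mult_exp real_root_power_cancel)
  finally have le: "root (degree p * k) (onorm (S ^^ k) * onorm (T ^^ k)) \<le> root (degree p) (a / b)" .
  have deg: "degree (p ^ k) = degree p * k" by (simp add: degree_power_eq \<open>p \<noteq> 0\<close> mult.commute)
  have pw: "poly_op (p ^ k) A = S ^^ k" "poly_op (p ^ k) B = U ^^ k"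
    by (simp_all add: S_def U_def poly_op_power[OF A] poly_op_power[OF B])
  have TUk: "(T ^^ k) ((U ^^ k) x) = x" and UTk: "(U ^^ k) ((T ^^ k) x) = x" for x
    by (induction k arbitrary: x) (simp_all add: funpow_swap1 TU UT)
  have inv: "inv (U ^^ k) = T ^^ k" by (rule inv_op_eq[OF TUk UTk])
  have "invertible_op (U ^^ k)" by (rule invertible_opI[OF bounded_clinear_power[OF Tcl] TUk UTk])
  then have "p ^ k \<in> {p. 0 < degree p \<and> invertible_op (poly_op p B)}"
    using p \<open>k > 0\<close> by (simp add: deg pw)
  from cINF_lower[OF eta_bdd_below[OF A, of B] this]
  have "eta A B \<le> root (degree p * k) (onorm (S ^^ k) * onorm (T ^^ k))"
    by (simp add: eta_def deg pw inv)
  then show ?thesis using le by (rule order_trans)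
qed

theorem theorem3p2:
  fixes A :: "'x::complex_banach \<Rightarrow> 'x"
    and B :: "'y::complex_banach \<Rightarrow> 'y"
    and g :: "complex \<Rightarrow> real"
    and \<alpha> :: ereal
  assumes X_nonzero: "\<exists>x::'x. x \<noteq> 0"
    and Y_nonzero: "\<exists>y::'y. y \<noteq> 0"
    and A: "bounded_clinear A"
    and B: "bounded_clinear B"
    and disjoint: "poly_hull (spectrum A) \<inter> spectrum B = {}"
    and cap_pos: "0 < log_capacity (poly_hull (spectrum A))"
    and g: "green_function (poly_hull (spectrum A)) g"
    and \<alpha>: "\<alpha> = (INF \<mu>\<in>spectrum B. ereal (g \<mu>))"
  shows "(\<exists>\<mu>\<in>spectrum B. \<alpha> = ereal (g \<mu>)) \<and> 0 < \<alpha> \<and> \<alpha> < \<infinity> \<and>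
         eta A B = exp (- real_of_ereal \<alpha>)"
proof -
  define K where "K = poly_hull (spectrum A)"
  have neA: "spectrum A \<noteq> {}" and neB: "spectrum B \<noteq> {}"
    using spectrum_nonempty[OF A X_nonzero] spectrum_nonempty[OF B Y_nonzero] by auto
  have cA: "compact (spectrum A)" and cB: "compact (spectrum B)"
    by (rule compact_spectrum[OF A], rule compact_spectrum[OF B])
  have K: "compact K" unfolding K_def by (rule compact_poly_hull[OF cA neA])
  have AK: "spectrum A \<subseteq> K" unfolding K_def by (rule subset_poly_hull[OF cA])
  have BK: "spectrum B \<inter> K = {}" using disjoint by (auto simp: K_def)
  have gK: "green_function K g" using g by (simp add: K_def)
  have "continuous_on (- K) g"
    using gK by (intro harmonic_on_imp_continuous_on) (simp add: green_function_def)
  then have "continuous_on (spectrum B) g" by (rule continuous_on_subset) (use BK in auto)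
  then obtain \<mu> where \<mu>: "\<mu> \<in> spectrum B" and min: "\<And>z. z \<in> spectrum B \<Longrightarrow> g \<mu> \<le> g z"
    using continuous_attains_inf[OF cB neB] by metis
  have \<mu>K: "\<mu> \<notin> K" using \<mu> BK by auto
  have \<alpha>_eq: "\<alpha> = ereal (g \<mu>)"
    unfolding \<alpha>
  proof (rule antisym)
    show "(INF \<mu>\<in>spectrum B. ereal (g \<mu>)) \<le> ereal (g \<mu>)" by (rule INF_lower[OF \<mu>])
    show "ereal (g \<mu>) \<le> (INF \<mu>\<in>spectrum B. ereal (g \<mu>))"
      by (rule INF_greatest) (simp add: min)
  qed
  have "0 < g \<mu>" using gK \<mu>K by (auto simp: green_function_def)
  have infK: "infinite K" by (rule green_function_imp_infinite[OF K gK \<mu>K])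
  \<comment> \<open>The witness \<open>p\<close> stays in the conclusion because the lower bound for
    the infimum in \<open>eta\<close> asks for a nonempty index set.\<close>
  have approx: "\<exists>p. 0 < degree p \<and> invertible_op (poly_op p B) \<and> eta A B \<le> exp (- g \<mu> + 3 * e)"
    if "e > 0" for e
  proof -
    obtain p where p: "0 < degree p" "\<And>z. z \<in> spectrum B \<Longrightarrow> poly p z \<noteq> 0"
      "\<And>z w. z \<in> spectrum B \<Longrightarrow> w \<in> K \<Longrightarrow>
        cmod (poly p w) * exp (real (degree p) * (g z - e)) \<le> cmod (poly p z)"
      using green_function_polynomial_approximation[OF K infK gK cB BK \<open>e > 0\<close>] by blast
    define n where "n = real (degree p)"
    have "n > 0" using p(1) by (simp add: n_def)
    have "continuous_on (spectrum B) (\<lambda>z. cmod (poly p z))" by (intro continuous_intros)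
    then obtain z1 where z1: "z1 \<in> spectrum B"
        "\<And>z. z \<in> spectrum B \<Longrightarrow> cmod (poly p z1) \<le> cmod (poly p z)"
      using continuous_attains_inf[OF cB neB] by metis
    \<comment> \<open>The minima of \<open>cmod p\<close> and of \<open>g\<close> over the spectrum
      of \<open>B\<close> may be at different points. The approximation is used at
      \<open>z1\<close>, where \<open>cmod p\<close> is smallest, together with
      \<open>g \<mu> \<le> g z1\<close>.\<close>
    define b where "b = cmod (poly p z1)"
    have "b > 0" using p(2)[OF z1(1)] by (simp add: b_def)
    \<comment> \<open>One \<open>e\<close> in the exponent comes from the approximation; one more on
      each side provides the strict inequalities, hence \<open>3 * e\<close> in total.\<close>
    have "eta A B \<le> root (degree p) ((b * exp (- (n * (g \<mu> - 2 * e)))) / (b * exp (- (n * e))))"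
    proof (rule eta_le_root[OF A B p(1)])
      fix w assume "w \<in> spectrum A"
      then have "w \<in> K" using AK by blast
      have "cmod (poly p w) * exp (n * (g \<mu> - e)) \<le> cmod (poly p w) * exp (n * (g z1 - e))"
        using min[OF z1(1)] \<open>n > 0\<close> by (intro mult_left_mono) auto
      also have "\<dots> \<le> b" using p(3)[OF z1(1) \<open>w \<in> K\<close>] by (simp add: n_def b_def)
      finally have "cmod (poly p w) * exp (n * (g \<mu> - e)) * exp (- (n * (g \<mu> - e)))
          \<le> b * exp (- (n * (g \<mu> - e)))"
        by (rule mult_right_mono) simp
      then have "cmod (poly p w) \<le> b * exp (- (n * (g \<mu> - e)))"
        by (simp only: mult.assoc flip: exp_add) simp
      also have "\<dots> < b * exp (- (n * (g \<mu> - 2 * e)))"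
        using \<open>b > 0\<close> \<open>n > 0\<close> \<open>e > 0\<close> by simp
      finally show "cmod (poly p w) < b * exp (- (n * (g \<mu> - 2 * e)))" .
    next
      fix z assume "z \<in> spectrum B"
      have "b * exp (- (n * e)) < b * 1" using \<open>b > 0\<close> \<open>n > 0\<close> \<open>e > 0\<close> by (intro mult_strict_left_mono) auto
      also have "\<dots> \<le> cmod (poly p z)" using z1(2)[OF \<open>z \<in> spectrum B\<close>] by (simp add: b_def)
      finally show "b * exp (- (n * e)) < cmod (poly p z)" .
    qed (use \<open>b > 0\<close> in auto)
    also have "(b * exp (- (n * (g \<mu> - 2 * e)))) / (b * exp (- (n * e))) = exp (- g \<mu> + 3 * e) ^ degree p"
      using \<open>b > 0\<close> by (simp add: n_def exp_of_nat_mult[symmetric] algebra_simps flip: exp_diff)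
    also have "root (degree p) \<dots> = exp (- g \<mu> + 3 * e)"
      using p(1) by (intro real_root_power_cancel) auto
    finally have "eta A B \<le> exp (- g \<mu> + 3 * e)" .
    moreover have "p \<noteq> 0" using p(1) by auto
    then have "invertible_op (poly_op p B)" using invertible_poly_op_iff[OF B] p(2) by blast
    ultimately show ?thesis using p(1) by blast
  qed
  have "exp (- g \<mu>) \<le> eta A B"
    unfolding eta_def
  proof (rule cINF_greatest)
    show "{p. 0 < degree p \<and> invertible_op (poly_op p B)} \<noteq> {}" using approx[of 1] by auto
    show "exp (- g \<mu>) \<le> root (degree p) (onorm (poly_op p A) * onorm (inv (poly_op p B)))"
      if "p \<in> {p. 0 < degree p \<and> invertible_op (poly_op p B)}" for p
      using that \<mu>K by (intro exp_green_le_root[OF A B neA g \<mu>]) (auto simp: K_def)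
  qed
  moreover have "eta A B \<le> exp (- g \<mu>)"
  proof -
    have "((\<lambda>e. exp (- g \<mu> + 3 * e)) \<longlongrightarrow> exp (- g \<mu> + 3 * 0)) (at_right 0)"
      by (intro tendsto_intros)
    moreover have "\<forall>\<^sub>F e in at_right 0. eta A B \<le> exp (- g \<mu> + 3 * e)"
      using approx by (auto simp: eventually_at_right_field intro!: exI[of _ 1])
    ultimately have "eta A B \<le> exp (- g \<mu> + 3 * 0)"
      by (rule tendsto_lowerbound) simp
    then show ?thesis by simp
  qed
  ultimately have "eta A B = exp (- g \<mu>)" by simp
  then show ?thesis using \<mu> \<alpha>_eq \<open>0 < g \<mu>\<close> by auto
qed

end
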